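(* Let $G$ be a locally compact second countable group, $m$ an admissible probability measure on $G$, and $\mathcal{X}=(X,\mu)$ an $m$-system. Let $\Pi(\mathcal{X})=(M(X),P^* )$, and let $\mathcal{X}^*=(X^*,\mu^* )$ be the canonically associated $m$-system $\mathcal{X}^*=\mathcal{X}\curlyvee\Pi(\mathcal{X})$. Then $\mathcal{X}^*$ is standard, $\Pi(\mathcal{X})$ is $m$-proximal, and there are homomorphisms of $m$-systems $$\pi:\mathcal{X}^*\to\mathcal{X},\qquad \sigma:\mathcal{X}^*\to\Pi(\mathcal{X})$$ (the coordinate projections) such that $\pi$ is an $m$-proximal extension and $\sigma$ is a measure preserving extension. Thus every $m$-system admits an $m$-proximal extension which is standard. Moreover, $\mathcal{X}$ is measure preserving if and only if $\Pi(\mathcal{X})$ is trivial (a one point system), and $\mathcal{X}$ is $m$-proximal if and only if both $\pi$ and $\sigma$ are isomorphisms.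
   Context: $G$ is a locally compact second countable topological group; a probability measure $m$ on $G$ is admissible if (i) some convolution power $m^{*k}$, $k\ge 1$, is absolutely continuous with respect to Haar measure, and (ii) the smallest closed subgroup of $G$ containing $\mathrm{supp}(m)$ is $G$. An $m$-system $\mathcal{X}=(X,\mu)$ is a standard Borel $G$-space $X$, taken (with no loss of generality) to be a compact metric space on which $G$ acts continuously by homeomorphisms, with a Borel probability measure $\mu$ that is $m$-stationary: $m*\mu=\int_G g\mu\,dm(g)=\mu$. By convention $m$-systems are ergodic, i.e. $\mu$ is an extreme point of the convex set of $m$-stationary probability measures on $X$. $M(X)$ is the compact metrizable space of Borel probability measures on $X$ with the weak* topology. The system is measure preserving if $g\mu=\mu$ for all $g\in G$. A homomorphism $\pi:(X,\mu)\to(Y,\nu)$ of $m$-systems is a measurable map intertwining the $G$-actions with $\pi_*\mu=\nu$; then $(Y,\nu)$ is a factor of $(X,\mu)$ and $(X,\mu)$ is an extension of $(Y,\nu)$. Everything is understood modulo null sets. Conditional measures: let $\Omega=G^{\mathbb{N}}$, $P=m^{\mathbb{N}}$, and $\xi_n:\Omega\to G$ the $n$-th coordinate. For $P$-a.e. $\omega$ the weak* limit $\mu_\omega=\lim_{n}\xi_1(\omega)\cdots\xi_n(\omega)\mu$ exists in $M(X)$; the $\mu_\omega$ are the conditional measures of $(X,\mu)$ and $\int\mu_\omega\,dP(\omega)=\mu$. The system $(X,\mu)$ is $m$-proximal if $\mu_\omega$ is a point mass for $P$-a.e. $\omega$. A homomorphism $\pi:(X,\mu)\to(Y,\nu)$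 is a measure preserving homomorphism (extension) if for every $g\in G$, $g\mu_y=\mu_{gy}$ for $\nu$-a.e. $y$, where $\mu=\int\mu_y\,d\nu(y)$ is the disintegration of $\mu$ over $\nu$. It is an $m$-proximal homomorphism (extension) if for $P$-a.e. $\omega$ the map $\pi:(X,\mu_\omega)\to(Y,\nu_\omega)$ is a.s. one-to-one. $P^*\in M(M(X))$ denotes the distribution of the random variable $\omega\mapsto\mu_\omega$, and $\Pi(\mathcal{X})=(M(X),P^* )$ with the induced $G$-action on $M(X)$. For two $m$-systems $(X,\mu),(Y,\nu)$ their $m$-join is $\mathcal{X}\curlyvee\mathcal{Y}=(X\times Y,\mu\curlyvee\nu)$ with diagonal action and $\mu\curlyvee\nu=\int\mu_\omega\times\nu_\omega\,dP(\omega)$. Thus $X^*=X\times M(X)$ and $\mu^*=\mu\curlyvee P^*=\int\mu_\omega\times\delta_{\mu_\omega}\,dP(\omega)$. An $m$-system $(X,\mu)$ is standard if there is a measure preserving homomorphism $(X,\mu)\to(Y,\nu)$ onto an $m$-proximal system $(Y,\nu)$. *)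

theory Defs
  imports "HOL-Probability.Probability"
begin

text \<open>
  The group is a type of class \<^class>\<open>topological_group_add\<close>. This class is not commutative:
  the product \<open>g h\<close> of the group is written \<open>g + h\<close>, the identity \<open>0\<close> and the inverse \<open>- g\<close>.
\<close>

section \<open>Admissible measures\<close>

text \<open>In a second countable locally compact group a Borel measure that is finite on compact sets
  is automatically regular.\<close>

definition left_haar :: "'g::topological_group_add measure \<Rightarrow> bool" where
  "left_haar l \<longleftrightarrow>
     sets l = sets borel \<and> emeasure l UNIV \<noteq> 0 \<and>
     (\<forall>K. compact K \<longrightarrow> emeasure l K < \<infinity>) \<and>
     (\<forall>g. distr l borel (\<lambda>x. g + x) = l)"

text \<open>The library's \<^const>\<open>convolution\<close> is restricted to Euclidean spaces.\<close>

definition gconv :: "'g::topological_group_add measure \<Rightarrow> 'g measure \<Rightarrow> 'g measure" where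
  "gconv m n = distr (m \<Otimes>\<^sub>M n) borel (\<lambda>(g, h). g + h)"

fun conv_power :: "'g::topological_group_add measure \<Rightarrow> nat \<Rightarrow> 'g measure" where
  "conv_power m 0 = return borel 0"
| "conv_power m (Suc k) = gconv m (conv_power m k)"

definition supp :: "'g::topological_space measure \<Rightarrow> 'g set" where
  "supp m = {x. \<forall>U. open U \<and> x \<in> U \<longrightarrow> emeasure m U > 0}"

definition closed_subgroup :: "'g::topological_group_add set \<Rightarrow> bool" where
  "closed_subgroup H \<longleftrightarrow>
     closed H \<and> 0 \<in> H \<and> (\<forall>g\<in>H. \<forall>h\<in>H. g + h \<in> H) \<and> (\<forall>g\<in>H. - g \<in> H)"

definition admissible :: "'g::topological_group_add measure \<Rightarrow> bool" where
  "admissible m \<longleftrightarrow>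
     prob_space m \<and> sets m = sets borel \<and>
     (\<exists>l k. left_haar l \<and> 1 \<le> k \<and> absolutely_continuous l (conv_power m k)) \<and>
     \<Inter>{H. closed_subgroup H \<and> supp m \<subseteq> H} = UNIV"


section \<open>The space of probability measures\<close>

definition borel_of :: "'a topology \<Rightarrow> 'a measure" where
  "borel_of T = sigma (topspace T) {U. openin T U}"

abbreviation prob_measures :: "'a topology \<Rightarrow> 'a measure set" where
  "prob_measures T \<equiv> space (prob_algebra (borel_of T))"

text \<open>The weak* topology on \<open>M(X)\<close>, for compact \<open>X\<close>: the coarsest topology making
  \<open>\<mu> \<mapsto> \<integral> f d\<mu>\<close> continuous for all continuous real functions \<open>f\<close> on \<open>X\<close>.\<close>

definition weak_star :: "'a topology \<Rightarrow> 'a measure topology" where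
  "weak_star T = topology_generated_by
     {{\<mu> \<in> prob_measures T. (\<integral>x. f x \<partial>\<mu>) \<in> U} | f U.
        continuous_map T euclideanreal f \<and> open U}"


section \<open>Systems\<close>

record ('g, 'a) gsystem =
  points :: "'a topology"
  act :: "'g \<Rightarrow> 'a \<Rightarrow> 'a"
  law :: "'a measure"

abbreviation borel_sys :: "('g, 'a) gsystem \<Rightarrow> 'a measure" where
  "borel_sys X \<equiv> borel_of (points X)"

definition translate :: "('g, 'a) gsystem \<Rightarrow> 'g \<Rightarrow> 'a measure \<Rightarrow> 'a measure" where
  "translate X g \<mu> = distr \<mu> (borel_sys X) (act X g)"

definition compact_metric_gspace ::
    "('g::topological_group_add, 'a) gsystem \<Rightarrow> bool" where
  "compact_metric_gspace X \<longleftrightarrow>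
     compact_space (points X) \<and> metrizable_space (points X) \<and>
     continuous_map (prod_topology euclidean (points X)) (points X) (\<lambda>(g, x). act X g x) \<and>
     (\<forall>x\<in>topspace (points X). act X 0 x = x) \<and>
     (\<forall>g h. \<forall>x\<in>topspace (points X). act X (g + h) x = act X g (act X h x))"

definition stationary :: "'g measure \<Rightarrow> ('g, 'a) gsystem \<Rightarrow> 'a measure \<Rightarrow> bool" where
  "stationary m X \<mu> \<longleftrightarrow>
     \<mu> \<in> prob_measures (points X) \<and> bind m (\<lambda>g. translate X g \<mu>) = \<mu>"

text \<open>Extreme points of the convex set of stationary measures; measures do not form a real
  vector space, so the convex combination is written setwise.\<close>

definition ergodic :: "'g measure \<Rightarrow> ('g, 'a) gsystem \<Rightarrow> bool" where
  "ergodic m X \<longleftrightarrow>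
     stationary m X (law X) \<and>
     (\<forall>\<mu>1 \<mu>2 t. stationary m X \<mu>1 \<and> stationary m X \<mu>2 \<and> 0 < t \<and> t < (1::real) \<and>
        (\<forall>A\<in>sets (borel_sys X).
           measure (law X) A = t * measure \<mu>1 A + (1 - t) * measure \<mu>2 A)
        \<longrightarrow> \<mu>1 = \<mu>2)"

definition m_system ::
    "'g::topological_group_add measure \<Rightarrow> ('g, 'a) gsystem \<Rightarrow> bool" where
  "m_system m X \<longleftrightarrow> compact_metric_gspace X \<and> stationary m X (law X) \<and> ergodic m X"

definition measure_preserving_system :: "('g, 'a) gsystem \<Rightarrow> bool" where
  "measure_preserving_system X \<longleftrightarrow> (\<forall>g. translate X g (law X) = law X)"


section \<open>Homomorphisms\<close>

definition system_hom ::
    "'g::topological_group_add measure \<Rightarrow> ('g, 'a) gsystem \<Rightarrow> ('g, 'b) gsystem \<Rightarrow>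
     ('a \<Rightarrow> 'b) \<Rightarrow> bool" where
  "system_hom m X Y \<pi> \<longleftrightarrow>
     m_system m X \<and> m_system m Y \<and>
     \<pi> \<in> measurable (borel_sys X) (borel_sys Y) \<and>
     (\<forall>g. AE x in law X. \<pi> (act X g x) = act Y g (\<pi> x)) \<and>
     distr (law X) (borel_sys Y) \<pi> = law Y"

definition system_iso ::
    "'g::topological_group_add measure \<Rightarrow> ('g, 'a) gsystem \<Rightarrow> ('g, 'b) gsystem \<Rightarrow>
     ('a \<Rightarrow> 'b) \<Rightarrow> bool" where
  "system_iso m X Y \<pi> \<longleftrightarrow>
     system_hom m X Y \<pi> \<and>
     (\<exists>\<rho>. system_hom m Y X \<rho> \<and>
        (AE x in law X. \<rho> (\<pi> x) = x) \<and> (AE y in law Y. \<pi> (\<rho> y) = y))"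

definition disintegration ::
    "('g, 'a) gsystem \<Rightarrow> ('g, 'b) gsystem \<Rightarrow> ('a \<Rightarrow> 'b) \<Rightarrow> ('b \<Rightarrow> 'a measure) \<Rightarrow> bool" where
  "disintegration X Y \<pi> \<kappa> \<longleftrightarrow>
     \<kappa> \<in> measurable (borel_sys Y) (prob_algebra (borel_sys X)) \<and>
     bind (law Y) \<kappa> = law X \<and>
     (AE y in law Y. AE x in \<kappa> y. \<pi> x = y)"

text \<open>Disintegrations exist and are unique up to null sets, so it does not matter which one is
  used below.\<close>

definition measure_preserving_hom ::
    "'g::topological_group_add measure \<Rightarrow> ('g, 'a) gsystem \<Rightarrow> ('g, 'b) gsystem \<Rightarrow>
     ('a \<Rightarrow> 'b) \<Rightarrow> bool" where
  "measure_preserving_hom m X Y \<pi> \<longleftrightarrow>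
     system_hom m X Y \<pi> \<and>
     (\<exists>\<kappa>. disintegration X Y \<pi> \<kappa> \<and>
        (\<forall>g. AE y in law Y. translate X g (\<kappa> y) = \<kappa> (act Y g y)))"

definition one_point_system :: "('g, unit) gsystem" where
  "one_point_system =
     \<lparr>points = discrete_topology UNIV, act = (\<lambda>_ _. ()),
      law = return (borel_of (discrete_topology UNIV)) ()\<rparr>"

definition trivial_system ::
    "'g::topological_group_add measure \<Rightarrow> ('g, 'a) gsystem \<Rightarrow> bool" where
  "trivial_system m X \<longleftrightarrow> (\<exists>\<pi>. system_iso m X one_point_system \<pi>)"


section \<open>Conditional measures\<close>

definition path_measure :: "'g measure \<Rightarrow> (nat \<Rightarrow> 'g) measure" where
  "path_measure m = PiM UNIV (\<lambda>_. m)"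

text \<open>The coordinates of a path are indexed from \<open>0\<close>, and new increments are multiplied on the
  right: \<open>walk \<omega> n = \<omega> 0 + \<dots> + \<omega> (n - 1)\<close>.\<close>

fun walk :: "(nat \<Rightarrow> 'g::group_add) \<Rightarrow> nat \<Rightarrow> 'g" where
  "walk \<omega> 0 = 0"
| "walk \<omega> (Suc n) = walk \<omega> n + \<omega> n"

definition cond_limit ::
    "('g::group_add, 'a) gsystem \<Rightarrow> (nat \<Rightarrow> 'g) \<Rightarrow> 'a measure \<Rightarrow> bool" where
  "cond_limit X \<omega> \<nu> \<longleftrightarrow>
     limitin (weak_star (points X)) (\<lambda>n. translate X (walk \<omega> n) (law X)) \<nu> sequentially"

text \<open>The limit exists for almost every path. On the exceptional null set the value is set to
  \<open>law X\<close>, so that the conditional measure is a measurable function of the path.\<close>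

definition cond_measure ::
    "('g::group_add, 'a) gsystem \<Rightarrow> (nat \<Rightarrow> 'g) \<Rightarrow> 'a measure" where
  "cond_measure X \<omega> =
     (if \<exists>\<nu>. cond_limit X \<omega> \<nu> then THE \<nu>. cond_limit X \<omega> \<nu> else law X)"

definition m_proximal ::
    "'g::topological_group_add measure \<Rightarrow> ('g, 'a) gsystem \<Rightarrow> bool" where
  "m_proximal m X \<longleftrightarrow>
     m_system m X \<and>
     (AE \<omega> in path_measure m.
        \<exists>x\<in>topspace (points X). cond_measure X \<omega> = return (borel_sys X) x)"

definition m_proximal_hom ::
    "'g::topological_group_add measure \<Rightarrow> ('g, 'a) gsystem \<Rightarrow> ('g, 'b) gsystem \<Rightarrow>
     ('a \<Rightarrow> 'b) \<Rightarrow> bool" where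
  "m_proximal_hom m X Y \<pi> \<longleftrightarrow>
     system_hom m X Y \<pi> \<and>
     (AE \<omega> in path_measure m.
        \<exists>N\<in>null_sets (cond_measure X \<omega>). inj_on \<pi> (space (cond_measure X \<omega>) - N))"

text \<open>The existential over the \<open>m\<close>-proximal factor ranges over systems whose points are taken from
  the type \<open>'y\<close>. A compact metrizable space has at most continuum many points, so every type with
  at least continuum many elements, e.g. \<open>'a measure\<close>, yields the same notion; for any other
  \<open>'y\<close> the predicate is at most stronger.\<close>

definition standard ::
    "'y itself \<Rightarrow> 'g::topological_group_add measure \<Rightarrow> ('g, 'a) gsystem \<Rightarrow> bool" where
  "standard _ m X \<longleftrightarrow>
     m_system m X \<and>
     (\<exists>(Y :: ('g, 'y) gsystem) \<pi>. m_proximal m Y \<and> measure_preserving_hom m X Y \<pi>)"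


section \<open>The systems \<open>\<Pi>(X)\<close> and \<open>X*\<close>\<close>

definition Pi_system ::
    "'g::topological_group_add measure \<Rightarrow> ('g, 'a) gsystem \<Rightarrow> ('g, 'a measure) gsystem" where
  "Pi_system m X =
     \<lparr>points = weak_star (points X), act = translate X,
      law = distr (path_measure m) (borel_of (weak_star (points X))) (cond_measure X)\<rparr>"

definition m_join ::
    "'g::topological_group_add measure \<Rightarrow> ('g, 'a) gsystem \<Rightarrow> ('g, 'b) gsystem \<Rightarrow>
     ('g, 'a \<times> 'b) gsystem" where
  "m_join m X Y =
     \<lparr>points = prod_topology (points X) (points Y),
      act = (\<lambda>g (x, y). (act X g x, act Y g y)),
      law = bind (path_measure m) (\<lambda>\<omega>. cond_measure X \<omega> \<Otimes>\<^sub>M cond_measure Y \<omega>)\<rparr>"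

definition star_system ::
    "'g::topological_group_add measure \<Rightarrow> ('g, 'a) gsystem \<Rightarrow>
     ('g, 'a \<times> 'a measure) gsystem" where
  "star_system m X = m_join m X (Pi_system m X)"

end

theory Submission
  imports Defs
begin

text \<open>
  Let \<open>\<mu>\<^sub>\<omega>\<close> be the weak* limit of the translates of \<open>\<mu>\<close> along the random walk \<open>\<omega>\<close>. It exists almost
  surely: the integrals of a continuous function against the translates form a bounded martingale
  (\<open>martingale_convergence\<close>), countably many functions suffice, and limits of integrals are integrals
  against a measure (\<open>riesz\<close>). The same compactness argument makes \<open>M(X)\<close> a compact metrizable space
  on which the group acts continuously. Integrating the martingale shows that every stationary
  measure is the barycentre of its conditional measures (\<open>bind_cond\<close>); hence stationary measures
  with the same conditional measures are equal, and ergodicity can be tested on them.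

  The key point is that the distribution \<open>P*\<close> of \<open>\<mu>\<^sub>\<omega>\<close> has the point masses at \<open>\<mu>\<^sub>\<omega>\<close> as its conditional
  measures (\<open>AE_cond_Pi\<close>). Indeed, deleting the first \<open>n\<close> increments of a path changes \<open>\<mu>\<^sub>\<omega>\<close> by the
  translation by their product, so translating \<open>P*\<close> by this product gives the conditional distribution
  of \<open>\<mu>\<^sub>\<omega>\<close> given the first \<open>n\<close> increments, and Levy's zero-one law (\<open>levy\<close>) applies. So \<open>\<Pi>(X)\<close> is
  proximal, and it is ergodic because point masses are extreme.

  It follows that the join has the law \<open>\<integral> J \<nu> dP*(\<nu>)\<close>, where \<open>J \<nu> = \<nu> \<times> \<delta>\<^sub>\<nu>\<close> is the only measure with
  marginals \<open>\<nu>\<close> and \<open>\<delta>\<^sub>\<nu>\<close>. Since \<open>J\<close> commutes with the action, it is an invariant disintegration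
  over \<open>\<Pi>(X)\<close>; and the conditional measures \<open>J \<mu>\<^sub>\<omega>\<close> live on slices, on which the first projection is
  injective. For ergodicity of the join, both marginals of a component of its law are the
  laws of the factors, by ergodicity of these; this determines the conditional measures
  (\<open>AE_cond_joining\<close>) and so the component. Finally, if \<open>P*\<close> is a point mass, it sits at the
  barycentre \<open>\<mu>\<close>, and equivariance makes \<open>\<mu>\<close> invariant; and the second projection is
  invertible exactly when almost every fibre \<open>J \<nu>\<close>, equivalently almost every \<open>\<nu>\<close>, is a point mass.
\<close>

section \<open>Borel sets of an abstract topology\<close>

lemma space_borel_of [simp]: "space (borel_of T) = topspace T"
  by (simp add: borel_of_def space_measure_of_conv)

lemma sets_borel_of: "sets (borel_of T) = sigma_sets (topspace T) {U. openin T U}"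
  unfolding borel_of_def by (rule sets_measure_of) (auto dest: openin_subset)

lemma openin_sets_borel_of: "openin T U \<Longrightarrow> U \<in> sets (borel_of T)"
  by (auto simp: sets_borel_of)

lemma closedin_sets_borel_of: "closedin T C \<Longrightarrow> C \<in> sets (borel_of T)"
  using openin_sets_borel_of[of T "topspace T - C"] sets.compl_sets[of "topspace T - C" "borel_of T"]
  by (auto simp: closedin_def double_diff)

lemma borel_of_euclidean [simp]: "borel_of euclidean = borel"
  unfolding borel_of_def borel_def by (simp add: open_openin)

lemma measurable_continuous_map:
  assumes "continuous_map T T' f" shows "f \<in> borel_of T \<rightarrow>\<^sub>M borel_of T'"
proof (rule measurable_sigma_sets[OF sets_borel_of])
  show "{U. openin T' U} \<subseteq> Pow (topspace T')" by (auto dest: openin_subset)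
  show "f \<in> space (borel_of T) \<rightarrow> topspace T'" using assms by (auto simp: continuous_map_def)
  fix U assume "U \<in> {U. openin T' U}"
  then have "openin T {x \<in> topspace T. f x \<in> U}" using assms by (auto simp: continuous_map_def)
  moreover have "{x \<in> topspace T. f x \<in> U} = f -` U \<inter> space (borel_of T)" by auto
  ultimately show "f -` U \<inter> space (borel_of T) \<in> sets (borel_of T)"
    by (simp add: openin_sets_borel_of)
qed

lemma borel_measurable_continuous_map:
  "continuous_map T euclidean f \<Longrightarrow> f \<in> borel_of T \<rightarrow>\<^sub>M borel"
  using measurable_continuous_map[of T euclidean f] by simp

lemma measurable_into_borel_of:
  assumes "\<And>x. x \<in> space M \<Longrightarrow> f x \<in> topspace T"
    and "\<And>U. openin T U \<Longrightarrow> {x \<in> space M. f x \<in> U} \<in> sets M"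
  shows "f \<in> M \<rightarrow>\<^sub>M borel_of T"
proof (rule measurable_sigma_sets[OF sets_borel_of])
  show "{U. openin T U} \<subseteq> Pow (topspace T)" by (auto dest: openin_subset)
  fix U assume "U \<in> {U. openin T U}"
  then show "f -` U \<inter> space M \<in> sets M"
    using assms(2)[of U] by (simp add: vimage_def Int_def conj_commute)
qed (use assms in auto)

lemma sets_borel_of_prod:
  assumes "second_countable T" "second_countable T'"
  shows "sets (borel_of (prod_topology T T')) = sets (borel_of T \<Otimes>\<^sub>M borel_of T')"
proof
  have fst: "fst \<in> borel_of (prod_topology T T') \<rightarrow>\<^sub>M borel_of T"
    and snd: "snd \<in> borel_of (prod_topology T T') \<rightarrow>\<^sub>M borel_of T'"
    by (auto intro!: measurable_continuous_map continuous_map_fst continuous_map_snd)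
  have "(\<lambda>z. (fst z, snd z)) \<in> borel_of (prod_topology T T') \<rightarrow>\<^sub>M borel_of T \<Otimes>\<^sub>M borel_of T'"
    using fst snd by (rule measurable_Pair)
  then have id: "(\<lambda>z. z) \<in> borel_of (prod_topology T T') \<rightarrow>\<^sub>M borel_of T \<Otimes>\<^sub>M borel_of T'" by simp
  show "sets (borel_of T \<Otimes>\<^sub>M borel_of T') \<subseteq> sets (borel_of (prod_topology T T'))"
  proof
    fix A assume A: "A \<in> sets (borel_of T \<Otimes>\<^sub>M borel_of T')"
    then have "A \<subseteq> topspace T \<times> topspace T'" using sets.sets_into_space[OF A] by (simp add: space_pair_measure)
    with measurable_sets[OF id A] show "A \<in> sets (borel_of (prod_topology T T'))"
      by (simp add: Int_absorb2)
  qed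
  obtain B where B: "countable B" "\<And>V. V \<in> B \<Longrightarrow> openin T V"
      "\<And>U x. openin T U \<Longrightarrow> x \<in> U \<Longrightarrow> \<exists>V\<in>B. x \<in> V \<and> V \<subseteq> U"
    using assms(1) unfolding second_countable_def by metis
  obtain B' where B': "countable B'" "\<And>V. V \<in> B' \<Longrightarrow> openin T' V"
      "\<And>U x. openin T' U \<Longrightarrow> x \<in> U \<Longrightarrow> \<exists>V\<in>B'. x \<in> V \<and> V \<subseteq> U"
    using assms(2) unfolding second_countable_def by metis
  have "U \<in> sets (borel_of T \<Otimes>\<^sub>M borel_of T')" if U: "openin (prod_topology T T') U" for U
  proof -
    let ?R = "{(V, V') \<in> B \<times> B'. V \<times> V' \<subseteq> U}"
    have "U = (\<Union>(V, V')\<in>?R. V \<times> V')"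
    proof (intro equalityI subsetI)
      fix z assume z: "z \<in> U"
      obtain x y where xy: "z = (x, y)" by (cases z)
      obtain W W' where W: "openin T W" "openin T' W'" "x \<in> W" "y \<in> W'" "W \<times> W' \<subseteq> U"
        using iffD1[OF openin_prod_topology_alt U, rule_format, of x y] z xy by blast
      obtain V V' where "V \<in> B" "x \<in> V" "V \<subseteq> W" "V' \<in> B'" "y \<in> V'" "V' \<subseteq> W'"
        using B(3)[OF W(1,3)] B'(3)[OF W(2,4)] by blast
      then have "(V, V') \<in> ?R" "z \<in> V \<times> V'" using W(5) xy by auto
      then show "z \<in> (\<Union>(V, V')\<in>?R. V \<times> V')" by blast
    qed auto
    moreover have "countable ?R"
      using B(1) B'(1) by (auto intro: countable_subset[of _ "B \<times> B'"])
    then have "(\<Union>(V, V')\<in>?R. V \<times> V') \<in> sets (borel_of T \<Otimes>\<^sub>M borel_of T')"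
      using B(2) B'(2) by (intro sets.countable_UN') (auto intro!: pair_measureI openin_sets_borel_of)
    ultimately show ?thesis by simp
  qed
  moreover have "topspace (prod_topology T T') = space (borel_of T \<Otimes>\<^sub>M borel_of T')"
    by (simp add: space_pair_measure)
  ultimately show "sets (borel_of (prod_topology T T')) \<subseteq> sets (borel_of T \<Otimes>\<^sub>M borel_of T')"
    unfolding sets_borel_of[of "prod_topology T T'"] by (auto intro!: sets.sigma_sets_subset)
qed

lemma prob_measures_iff: "\<mu> \<in> prob_measures T \<longleftrightarrow> prob_space \<mu> \<and> sets \<mu> = sets (borel_of T)"
  by (auto simp: space_prob_algebra)

lemma prob_measures_space: "\<mu> \<in> prob_measures T \<Longrightarrow> space \<mu> = topspace T"
  using sets_eq_imp_space_eq[of \<mu> "borel_of T"] by (auto simp: prob_measures_iff)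

section \<open>Continuous functions and measures on compact metrizable spaces\<close>

locale compact_metrizable =
  fixes T :: "'a topology"
  assumes compact: "compact_space T" and metrizable: "metrizable_space T"
begin

lemma normal: "normal_space T"
  using metrizable by (rule metrizable_imp_normal_space)

lemma continuous_bounded:
  assumes "continuous_map T euclideanreal f"
  obtains B where "B > 0" "\<And>x. x \<in> topspace T \<Longrightarrow> \<bar>f x\<bar> \<le> B"
proof -
  have "compactin euclideanreal (f ` topspace T)"
    using compact assms image_compactin[of T "topspace T"] unfolding compact_space_def by blast
  then have "bounded (f ` topspace T)" by (simp add: compact_imp_bounded)
  then obtain B where "B > 0" "\<forall>y\<in>f ` topspace T. norm y \<le> B" unfolding bounded_pos by blast
  then show ?thesis using that by auto
qed

lemma integrable_continuous:
  assumes "\<mu> \<in> prob_measures T" "continuous_map T euclideanreal f"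
  shows "integrable \<mu> f"
proof -
  interpret prob_space \<mu> using assms by (simp add: prob_measures_iff)
  obtain B where "\<And>x. x \<in> topspace T \<Longrightarrow> \<bar>f x\<bar> \<le> B" using continuous_bounded[OF assms(2)] by blast
  moreover have "f \<in> borel_measurable \<mu>"
    using borel_measurable_continuous_map[OF assms(2)] assms(1)
    by (simp add: prob_measures_iff cong: measurable_cong_sets)
  ultimately show ?thesis
    using prob_measures_space[OF assms(1)] by (intro integrable_const_bound[of _ B]) auto
qed

text \<open>Finite maxima of the functions \<open>x \<mapsto> q - L d(x, p)\<close> are dense in \<open>C(T)\<close>: with \<open>L\<close> steep
  compared to the modulus of continuity of \<open>f\<close>, and \<open>q\<close> close to \<open>f p\<close>, such cones stay below
  \<open>f\<close> up to a small error, and they reach \<open>f\<close> near their apex.\<close>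
lemma ex_dense_sequence:
  "\<exists>F :: nat \<Rightarrow> 'a \<Rightarrow> real. (\<forall>i. continuous_map T euclideanreal (F i)) \<and>
     (\<forall>f e. continuous_map T euclideanreal f \<longrightarrow> 0 < e \<longrightarrow> (\<exists>i. \<forall>x\<in>topspace T. \<bar>f x - F i x\<bar> \<le> e))"
proof -
  obtain M d where Md: "Metric_space M d" and T: "T = Metric_space.mtopology M d"
    using metrizable metrizable_space_def by blast
  interpret Metric_space M d by fact
  have top: "topspace T = M" by (simp add: T)
  have "mtotally_bounded M"
    using compact unfolding T by (intro compactin_imp_mtotally_bounded) (simp add: compact_space_def)
  then have "\<exists>K. \<forall>n. finite (K n) \<and> K n \<subseteq> M \<and> M \<subseteq> (\<Union>x\<in>K n. mball x (1 / real (Suc n)))"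
    unfolding mtotally_bounded_def by (intro choice) simp
  then obtain K where K: "\<And>n. finite (K n)" "\<And>n. K n \<subseteq> M" "\<And>n. M \<subseteq> (\<Union>x\<in>K n. mball x (1 / real (Suc n)))"
    by blast
  define D where "D = (\<Union>n. K n)"
  have DM: "D \<subseteq> M" and cD: "countable D" using K by (auto simp: D_def intro: countable_finite)
  let ?c = "\<lambda>(q, L, p) x. q - real (L::nat) * d x p"
  define S where "S = {A. finite A \<and> A \<subseteq> (\<rat> :: real set) \<times> (UNIV :: nat set) \<times> D}"
  have cS: "countable S"
    unfolding S_def using cD by (intro countable_Collect_finite_subset countable_SIGMA countable_rat countableI_type cD)
  define g where "g A x = (if A = {} then 0 else Max ((\<lambda>c. ?c c x) ` A))" for A x
  have contd: "continuous_map T euclideanreal (\<lambda>x. d x p)" if "p \<in> M" for p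
    using that continuous_map_mdist[of T "metric (M, d)" "\<lambda>x. x" "\<lambda>_. p"]
    by (simp add: T mtopology_of_def)
  have cont: "continuous_map T euclideanreal (g A)" if "A \<in> S" for A
  proof (cases "A = {}")
    case False
    have "finite A" "A \<subseteq> \<rat> \<times> UNIV \<times> D" using that by (auto simp: S_def)
    from this(1) False this(2) have "continuous_map T euclideanreal (\<lambda>x. Max ((\<lambda>c. ?c c x) ` A))"
    proof (induction rule: finite_ne_induct)
      case (singleton c)
      obtain q L p where c: "c = (q, L, p)" "p \<in> M" using singleton DM by (cases c) auto
      then show ?case using contd[of p] by (auto simp: c intro!: continuous_intros)
    next
      case (insert c A)
      obtain q L p where c: "c = (q, L, p)" "p \<in> M" using insert DM by (cases c) auto
      have "continuous_map T euclideanreal (?c c)" using contd[of p] c by (auto intro!: continuous_intros)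
      then have "continuous_map T euclideanreal (\<lambda>x. max (?c c x) (Max ((\<lambda>c. ?c c x) ` A)))"
        using insert by (intro continuous_intros) auto
      then show ?case using insert by simp
    qed
    then show ?thesis using False by (simp add: g_def[abs_def])
  qed (simp add: g_def[abs_def])
  have dense: "\<exists>A\<in>S. \<forall>x\<in>topspace T. \<bar>f x - g A x\<bar> \<le> e"
    if f: "continuous_map T euclideanreal f" and e: "0 < e" for f and e :: real
  proof (cases "M = {}")
    case True then show ?thesis by (auto simp: top S_def)
  next
    case False
    obtain B where B: "B > 0" "\<And>x. x \<in> M \<Longrightarrow> \<bar>f x\<bar> \<le> B"
      using continuous_bounded[OF f] top by metis
    define r where "r = e / 3"
    have r: "r > 0" using e by (simp add: r_def)
    let ?U = "(\<lambda>y. {x \<in> M. \<bar>f x - f y\<bar> < r / 2}) ` M"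
    have op: "openin mtopology {x \<in> M. \<bar>f x - f y\<bar> < r / 2}" for y
    proof -
      have "open {z. \<bar>z - f y\<bar> < r / 2}" by (intro open_Collect_less continuous_intros)
      then show ?thesis using f unfolding continuous_map_def top by (auto simp: T)
    qed
    obtain \<delta> where \<delta>: "\<delta> > 0" "\<And>x. x \<in> M \<Longrightarrow> \<exists>U\<in>?U. mball x \<delta> \<subseteq> U"
    proof -
      have "M \<subseteq> \<Union>?U" using r by auto
      moreover have "compactin mtopology M" using compact by (simp add: T compact_space_def)
      moreover have "\<And>U. U \<in> ?U \<Longrightarrow> openin mtopology U" using op by blast
      ultimately show ?thesis using lebesgue_number[of M ?U] that by blast
    qed
    have uc: "\<bar>f x - f y\<bar> < r" if "x \<in> M" "y \<in> M" "d x y < \<delta>" for x y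
    proof -
      obtain z where "mball x \<delta> \<subseteq> {x \<in> M. \<bar>f x - f z\<bar> < r / 2}" using \<delta>(2)[OF \<open>x \<in> M\<close>] by blast
      moreover have "x \<in> mball x \<delta>" "y \<in> mball x \<delta>" using that \<delta> by auto
      ultimately have "\<bar>f x - f z\<bar> < r / 2" "\<bar>f y - f z\<bar> < r / 2" by blast+
      then show ?thesis by linarith
    qed
    obtain L :: nat where "2 * B / \<delta> \<le> real L" using real_arch_simple by blast
    then have L: "2 * B \<le> real L * \<delta>" using \<delta> by (simp add: field_simps)
    obtain n where n: "1 / real (Suc n) < min \<delta> (r / (real L + 1))"
      using nat_approx_posE[of "min \<delta> (r / (real L + 1))"] \<delta> r by auto
    have "\<exists>q. q \<in> \<rat> \<and> f p - r < q \<and> q < f p" for p using Rats_dense_in_real[of "f p - r" "f p"] r by auto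
    then obtain q where q: "\<And>p. q p \<in> \<rat>" "\<And>p. f p - r < q p" "\<And>p. q p < f p" by metis
    let ?A = "(\<lambda>p. (q p, L, p)) ` K n"
    have A: "?A \<in> S" using K q by (auto simp: S_def D_def)
    have ne: "K n \<noteq> {}" using K(3)[of n] False by auto
    have gA: "g ?A x = Max ((\<lambda>p. q p - real L * d x p) ` K n)" for x
      using ne by (simp add: g_def image_image)
    have "\<bar>f x - g ?A x\<bar> \<le> e" if x: "x \<in> M" for x
    proof -
      have up: "q p - real L * d x p \<le> f x + r" if "p \<in> K n" for p
      proof (cases "d x p < \<delta>")
        case True
        then have "\<bar>f x - f p\<bar> < r" using uc x that K(2) by blast
        moreover have "0 \<le> real L * d x p" by simp
        ultimately show ?thesis using q(3)[of p] by linarith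
      next
        case False
        then have "real L * \<delta> \<le> real L * d x p" by (intro mult_left_mono) auto
        moreover have "\<bar>f p\<bar> \<le> B" "\<bar>f x\<bar> \<le> B" using B that K(2) x by blast+
        ultimately show ?thesis using q(3)[of p] L r by linarith
      qed
      obtain p where p: "p \<in> K n" "d x p < 1 / real (Suc n)"
        using K(3)[of n] x by (auto simp: commute)
      have "\<bar>f x - f p\<bar> < r" using uc[of x p] x p n K(2) by auto
      moreover have "real L * d x p \<le> r"
      proof -
        have "real L * d x p \<le> (real L + 1) * (r / (real L + 1))"
          using p n by (intro mult_mono) auto
        then show ?thesis by simp
      qed
      ultimately have "f x - 3 * r \<le> q p - real L * d x p" using q(2)[of p] by linarith
      also have "\<dots> \<le> g ?A x" unfolding gA using K(1) p by (intro Max_ge) auto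
      finally have "f x - 3 * r \<le> g ?A x" .
      moreover have "g ?A x \<le> f x + r" unfolding gA using K(1) ne up by (subst Max_le_iff) auto
      ultimately show ?thesis using r by (simp add: r_def)
    qed
    then show ?thesis using A top by blast
  qed
  have "S \<noteq> {}" by (auto simp: S_def)
  then have rng: "range (from_nat_into S) = S" using cS by (rule range_from_nat_into)
  have "from_nat_into S i \<in> S" for i using rng by blast
  moreover have "\<exists>i. A = from_nat_into S i" if "A \<in> S" for A using rng that by blast
  ultimately show ?thesis
    using cont dense by (intro exI[of _ "\<lambda>i. g (from_nat_into S i)"]) metis
qed

text \<open>Integrals against this sequence encode a probability measure by a point of \<open>nat \<Rightarrow> real\<close>.\<close>
definition dense_seq :: "nat \<Rightarrow> 'a \<Rightarrow> real" where
  "dense_seq = (SOME F. (\<forall>i. continuous_map T euclideanreal (F i)) \<and>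
     (\<forall>f e. continuous_map T euclideanreal f \<longrightarrow> 0 < e \<longrightarrow> (\<exists>i. \<forall>x\<in>topspace T. \<bar>f x - F i x\<bar> \<le> e)))"

lemma continuous_dense_seq: "continuous_map T euclideanreal (dense_seq i)"
  and dense_seq_approx: "continuous_map T euclideanreal f \<Longrightarrow> 0 < e \<Longrightarrow>
    \<exists>i. \<forall>x\<in>topspace T. \<bar>f x - dense_seq i x\<bar> \<le> e"
  using someI_ex[OF ex_dense_sequence, folded dense_seq_def] by blast+

text \<open>Open sets of a metrizable space are countable unions of closed sets, which Urysohn functions
  separate from the complement. Hence measures of open sets are limits of integrals of continuous
  functions.\<close>
lemma open_approx:
  assumes U: "openin T U"
  obtains u :: "nat \<Rightarrow> 'a \<Rightarrow> real" where "\<And>n. continuous_map T euclideanreal (u n)"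
    "\<And>n x. x \<in> topspace T \<Longrightarrow> 0 \<le> u n x \<and> u n x \<le> 1"
    "\<And>x. x \<in> topspace T \<Longrightarrow> (\<lambda>n. u n x) \<longlonglongrightarrow> indicator U x"
proof -
  have "gdelta_in T (topspace T - U)"
    using U metrizable by (intro closed_imp_gdelta_in) (auto simp: closedin_def)
  then have "fsigma_in T U"
    using U by (simp add: fsigma_in_gdelta_in openin_subset)
  then obtain C where C: "\<And>n. closedin T (C n)" "\<And>n. C n \<subseteq> C (Suc n)" "\<Union> (range C) = U"
    unfolding fsigma_in_ascending by blast
  have "\<exists>u. continuous_map T (top_of_set {0..1::real}) u \<and> u ` (topspace T - U) \<subseteq> {0} \<and> u ` C n \<subseteq> {1}" for n
  proof -
    have "closedin T (topspace T - U)" using U by blast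
    moreover have "disjnt (topspace T - U) (C n)" using C(3) by (auto simp: disjnt_def)
    ultimately show ?thesis
      using Urysohn_lemma[OF normal _ C(1)[of n], of "topspace T - U" 0 1] by (metis zero_le_one)
  qed
  then obtain u where u: "\<And>n. continuous_map T (top_of_set {0..1::real}) (u n)"
    "\<And>n. u n ` (topspace T - U) \<subseteq> {0}" "\<And>n. u n ` C n \<subseteq> {1}"
    by metis
  have "(\<lambda>n. u n x) \<longlonglongrightarrow> indicator U x" if x: "x \<in> topspace T" for x
  proof (cases "x \<in> U")
    case True
    then obtain k where k: "x \<in> C k" using C(3) by blast
    have "u n x = 1" if "k \<le> n" for n
    proof -
      have "C k \<subseteq> C n" using C(2) that by (rule lift_Suc_mono_le)
      then show ?thesis using k u(3)[of n] by blast
    qed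
    then have "eventually (\<lambda>n. u n x = 1) sequentially" by (auto simp: eventually_sequentially)
    then show ?thesis using True by (simp add: tendsto_eventually)
  next
    case False
    then have "u n x = 0" for n using u(2)[of n] x by blast
    then show ?thesis using False by simp
  qed
  moreover have "0 \<le> u n x \<and> u n x \<le> 1" if "x \<in> topspace T" for n x
    using u(1)[of n] that by (auto simp: continuous_map_in_subtopology)
  moreover have "continuous_map T euclideanreal (u n)" for n
    using u(1) by (auto simp: continuous_map_in_subtopology)
  ultimately show ?thesis using that by blast
qed

lemma measure_open_tendsto:
  assumes "\<mu> \<in> prob_measures T" "openin T U"
    "\<And>n. continuous_map T euclideanreal (u n)"
    "\<And>n x. x \<in> topspace T \<Longrightarrow> 0 \<le> u n x \<and> u n x \<le> (1::real)"
    "\<And>x. x \<in> topspace T \<Longrightarrow> (\<lambda>n. u n x) \<longlonglongrightarrow> indicator U x"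
  shows "(\<lambda>n. \<integral>x. u n x \<partial>\<mu>) \<longlonglongrightarrow> measure \<mu> U"
proof -
  interpret prob_space \<mu> using assms by (simp add: prob_measures_iff)
  have sp: "space \<mu> = topspace T" and [measurable_cong]: "sets \<mu> = sets (borel_of T)"
    using prob_measures_space assms(1) by (auto simp: prob_measures_iff)
  have [measurable]: "U \<in> sets (borel_of T)" "\<And>n. u n \<in> borel_measurable (borel_of T)"
    using assms by (auto intro: openin_sets_borel_of borel_measurable_continuous_map)
  have "(\<lambda>n. \<integral>x. u n x \<partial>\<mu>) \<longlonglongrightarrow> (\<integral>x. indicator U x \<partial>\<mu>)"
    using assms(4,5) by (intro integral_dominated_convergence[where w="\<lambda>_. 1"]) (auto simp: sp)
  then show ?thesis by simp
qed

lemma prob_measures_eqI_open: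
  assumes \<mu>: "\<mu> \<in> prob_measures T" and \<nu>: "\<nu> \<in> prob_measures T"
    and eq: "\<And>U. openin T U \<Longrightarrow> measure \<mu> U = measure \<nu> U"
  shows "\<mu> = \<nu>"
proof -
  interpret \<mu>: prob_space \<mu> using \<mu> by (simp add: prob_measures_iff)
  interpret \<nu>: prob_space \<nu> using \<nu> by (simp add: prob_measures_iff)
  have eqo: "emeasure \<mu> U = emeasure \<nu> U" if "openin T U" for U
    using eq[OF that] by (simp add: \<mu>.emeasure_eq_measure \<nu>.emeasure_eq_measure)
  show ?thesis
  proof (rule measure_eqI_generator_eq[where E="{U. openin T U}" and \<Omega>="topspace T" and A="\<lambda>_. topspace T"])
    show "Int_stable {U. openin T U}" by (auto simp: Int_stable_def)
    show "{U. openin T U} \<subseteq> Pow (topspace T)" by (auto dest: openin_subset)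
  qed (use \<mu> \<nu> eqo in \<open>auto simp: prob_measures_iff sets_borel_of\<close>)
qed

lemma prob_measures_eqI:
  assumes \<mu>: "\<mu> \<in> prob_measures T" and \<nu>: "\<nu> \<in> prob_measures T"
    and eq: "\<And>f. continuous_map T euclideanreal f \<Longrightarrow> (\<integral>x. f x \<partial>\<mu>) = (\<integral>x. f x \<partial>\<nu>)"
  shows "\<mu> = \<nu>"
proof (rule prob_measures_eqI_open[OF \<mu> \<nu>])
  fix U assume U: "openin T U"
  obtain u where u: "\<And>n. continuous_map T euclideanreal (u n)"
    "\<And>n x. x \<in> topspace T \<Longrightarrow> 0 \<le> u n x \<and> u n x \<le> (1::real)"
    "\<And>x. x \<in> topspace T \<Longrightarrow> (\<lambda>n. u n x) \<longlonglongrightarrow> indicator U x"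
    using open_approx[OF U] by blast
  show "measure \<mu> U = measure \<nu> U"
    using measure_open_tendsto[OF \<mu> U u] measure_open_tendsto[OF \<nu> U u]
    by (auto simp: eq[OF u(1)] intro: LIMSEQ_unique)
qed

lemma integral_uniform_close:
  assumes \<mu>: "\<mu> \<in> prob_measures T"
    and "continuous_map T euclideanreal f" "continuous_map T euclideanreal g"
    and "\<And>x. x \<in> topspace T \<Longrightarrow> \<bar>f x - g x\<bar> \<le> e"
  shows "\<bar>(\<integral>x. f x \<partial>\<mu>) - (\<integral>x. g x \<partial>\<mu>)\<bar> \<le> e"
proof -
  interpret prob_space \<mu> using \<mu> by (simp add: prob_measures_iff)
  have i: "integrable \<mu> f" "integrable \<mu> g" using assms integrable_continuous by auto
  have "\<bar>(\<integral>x. f x \<partial>\<mu>) - (\<integral>x. g x \<partial>\<mu>)\<bar> = \<bar>\<integral>x. f x - g x \<partial>\<mu>\<bar>" using i by simp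
  also have "\<dots> \<le> (\<integral>x. \<bar>f x - g x\<bar> \<partial>\<mu>)" by (rule integral_abs_bound)
  also have "\<dots> \<le> (\<integral>x. e \<partial>\<mu>)" 
    using i assms(4) prob_measures_space[OF \<mu>] by (intro integral_mono) auto
  finally show ?thesis by (simp add: prob_space)
qed

end

section \<open>Positive functionals on C(T) are measures\<close>

text \<open>The measure is the restriction of the outer measure that is generated by the inner content
  \<open>lam U\<close>, the supremum of \<open>L\<close> over the functions between \<open>0\<close> and the indicator of the open set \<open>U\<close>.\<close>
locale positive_functional = compact_metrizable T for T :: "'a topology" +
  fixes L :: "('a \<Rightarrow> real) \<Rightarrow> real"
  assumes L_add: "continuous_map T euclideanreal f \<Longrightarrow> continuous_map T euclideanreal g \<Longrightarrow>
      L (\<lambda>x. f x + g x) = L f + L g"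
    and L_scale: "continuous_map T euclideanreal f \<Longrightarrow> L (\<lambda>x. c * f x) = c * L f"
    and L_nonneg: "continuous_map T euclideanreal f \<Longrightarrow> (\<And>x. x \<in> topspace T \<Longrightarrow> 0 \<le> f x) \<Longrightarrow> 0 \<le> L f"
    and L_one: "L (\<lambda>_. 1) = 1"
begin

lemma L_diff:
  assumes "continuous_map T euclideanreal f" "continuous_map T euclideanreal g"
  shows "L (\<lambda>x. f x - g x) = L f - L g"
  using L_add[OF assms(1), of "\<lambda>x. (-1) * g x"] L_scale[OF assms(2), of "-1"] assms(2)
  by (simp add: continuous_map_minus)

lemma L_mono:
  assumes "continuous_map T euclideanreal f" "continuous_map T euclideanreal g"
    and "\<And>x. x \<in> topspace T \<Longrightarrow> f x \<le> g x"
  shows "L f \<le> L g"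
  using L_nonneg[of "\<lambda>x. g x - f x"] assms by (auto simp: L_diff intro!: continuous_intros)

lemma L_const: "L (\<lambda>_. c) = c"
  using L_scale[of "\<lambda>_. 1" c] by (simp add: L_one)

lemma L_sum:
  assumes "finite I" "\<And>i. i \<in> I \<Longrightarrow> continuous_map T euclideanreal (f i)"
  shows "L (\<lambda>x. \<Sum>i\<in>I. f i x) = (\<Sum>i\<in>I. L (f i))"
  using assms by (induction rule: finite_induct) (auto simp: L_const L_add continuous_map_sum)

definition below :: "'a set \<Rightarrow> ('a \<Rightarrow> real) set" where
  "below U = {f. continuous_map T euclideanreal f \<and> (\<forall>x\<in>topspace T. 0 \<le> f x \<and> f x \<le> 1) \<and>
     (\<forall>x\<in>topspace T - U. f x = 0)}"

definition lam :: "'a set \<Rightarrow> real" where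
  "lam U = (SUP f\<in>below U. L f)"

lemma below_continuous: "f \<in> below U \<Longrightarrow> continuous_map T euclideanreal f"
  by (simp add: below_def)

lemma below_zero: "f \<in> below U \<Longrightarrow> x \<in> topspace T \<Longrightarrow> x \<notin> U \<Longrightarrow> f x = 0"
  by (auto simp: below_def)

lemma below_bounds: "f \<in> below U \<Longrightarrow> x \<in> topspace T \<Longrightarrow> 0 \<le> f x \<and> f x \<le> 1"
  by (auto simp: below_def)

lemma below_mono: "U \<subseteq> V \<Longrightarrow> below U \<subseteq> below V"
  by (auto simp: below_def)

lemma zero_below: "(\<lambda>_. 0) \<in> below U"
  by (simp add: below_def)

lemma L_below: "f \<in> below U \<Longrightarrow> 0 \<le> L f \<and> L f \<le> 1"
  using L_mono[of f "\<lambda>_. 1"] L_nonneg[of f] by (auto simp: below_def L_one)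

lemma bdd_below_L: "bdd_above (L ` below U)"
  using L_below by (intro bdd_aboveI[of _ 1]) auto

lemma L_le_lam: "f \<in> below U \<Longrightarrow> L f \<le> lam U"
  unfolding lam_def using bdd_below_L by (rule cSUP_upper2) auto

lemma lam_least: "(\<And>f. f \<in> below U \<Longrightarrow> L f \<le> c) \<Longrightarrow> lam U \<le> c"
  unfolding lam_def using zero_below by (intro cSUP_least) auto

lemma lam_mono: "U \<subseteq> V \<Longrightarrow> lam U \<le> lam V"
  using below_mono L_le_lam by (intro lam_least) blast

lemma lam_nonneg: "0 \<le> lam U"
  using L_le_lam[OF zero_below, of U] by (simp add: L_const)

lemma lam_le_1: "lam U \<le> 1"
  using L_below by (intro lam_least) auto

lemma lam_empty: "lam {} = 0"
proof (intro antisym lam_nonneg lam_least)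
  fix f assume "f \<in> below {}"
  then show "L f \<le> 0" using L_mono[of f "\<lambda>_. 0"] by (auto simp: below_def L_const)
qed

lemma lam_top: "lam (topspace T) = 1"
  using L_le_lam[of "\<lambda>_. 1" "topspace T"] lam_le_1[of "topspace T"] by (auto simp: L_one below_def)

text \<open>Truncating at a small height makes the positivity set of a function below \<open>U\<close> a subset of
  a compact subset of \<open>U\<close>, at an arbitrarily small cost.\<close>
lemma truncate:
  assumes f: "f \<in> below U" and \<delta>: "0 < \<delta>"
  shows "L f \<le> L (\<lambda>x. max (f x - \<delta>) 0) + \<delta>"
proof -
  have c: "continuous_map T euclideanreal (\<lambda>x. max (f x - \<delta>) 0)"
    using below_continuous[OF f] by (intro continuous_intros) auto
  have "L f \<le> L (\<lambda>x. max (f x - \<delta>) 0 + \<delta>)"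
    using c below_continuous[OF f] by (intro L_mono continuous_intros) auto
  also have "\<dots> = L (\<lambda>x. max (f x - \<delta>) 0) + \<delta>" using L_add[OF c, of "\<lambda>_. \<delta>"] by (simp add: L_const)
  finally show ?thesis .
qed

lemma closedin_level:
  assumes "continuous_map T euclideanreal f"
  shows "closedin T {x \<in> topspace T. \<delta> \<le> f x}"
  using closedin_continuous_map_preimage[OF assms, of "{\<delta>..}"] by simp

lemma openin_level:
  assumes "continuous_map T euclideanreal f"
  shows "openin T {x \<in> topspace T. f x < \<delta>}" "openin T {x \<in> topspace T. \<delta> < f x}"
  using openin_continuous_map_preimage[OF assms, of "{..<\<delta>}"]
    openin_continuous_map_preimage[OF assms, of "{\<delta><..}"] by simp_all

text \<open>A truncated function below a union is split by a Urysohn function into two functions, each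
  below one of the two sets.\<close>
lemma lam_Un:
  assumes U: "openin T U" and V: "openin T V"
  shows "lam (U \<union> V) \<le> lam U + lam V"
proof (rule lam_least, rule field_le_epsilon)
  fix f and \<delta> :: real assume f: "f \<in> below (U \<union> V)" and \<delta>: "0 < \<delta>"
  let ?K = "{x \<in> topspace T. \<delta> \<le> f x}"
  have "closedin T (topspace T - U)" using U by blast
  moreover have "closedin T (?K - V)"
    using closedin_level[OF below_continuous[OF f]] V by (rule closedin_diff)
  moreover have "disjnt (topspace T - U) (?K - V)"
    using below_zero[OF f] \<delta> by (force simp: disjnt_def)
  ultimately obtain u where u: "continuous_map T (top_of_set {0..1::real}) u"
    "u ` (topspace T - U) \<subseteq> {0}" "u ` (?K - V) \<subseteq> {1}"
    using Urysohn_lemma[OF normal, of "topspace T - U" "?K - V" 0 1] by (metis zero_le_one)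
  have uc: "continuous_map T euclideanreal u" and u01: "\<And>x. x \<in> topspace T \<Longrightarrow> 0 \<le> u x \<and> u x \<le> 1"
    using u(1) by (auto simp: continuous_map_in_subtopology)
  define h where "h x = max (f x - \<delta>) 0" for x
  have hc: "continuous_map T euclideanreal h"
    unfolding h_def using below_continuous[OF f] by (intro continuous_intros) auto
  have h01: "0 \<le> h x \<and> h x \<le> 1" if "x \<in> topspace T" for x
    using below_bounds[OF f that] \<delta> by (auto simp: h_def)
  have "(\<lambda>x. h x * u x) \<in> below U"
    using hc uc h01 u01 u(2) unfolding below_def
    by (auto intro!: continuous_map_real_mult mult_le_one)
  moreover have "(\<lambda>x. h x * (1 - u x)) \<in> below V"
  proof -
    have "h x * (1 - u x) = 0" if "x \<in> topspace T - V" for x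
      using that u(3) by (cases "\<delta> \<le> f x") (auto simp: h_def)
    then show ?thesis
      using hc uc h01 u01 unfolding below_def
      by (auto intro!: continuous_map_real_mult mult_le_one continuous_intros)
  qed
  moreover have "L h = L (\<lambda>x. h x * u x) + L (\<lambda>x. h x * (1 - u x))"
  proof -
    have "L (\<lambda>x. h x * u x + h x * (1 - u x)) = L (\<lambda>x. h x * u x) + L (\<lambda>x. h x * (1 - u x))"
      using hc uc by (intro L_add continuous_map_real_mult continuous_intros) auto
    then show ?thesis by (simp add: algebra_simps)
  qed
  ultimately have "L h \<le> lam U + lam V" by (metis L_le_lam add_mono)
  then show "L f \<le> lam U + lam V + \<delta>" using truncate[OF f \<delta>] by (simp add: h_def[abs_def])
qed

lemma lam_UN_finite:
  assumes "\<And>i. openin T (U i)"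
  shows "lam (\<Union>i<(n::nat). U i) \<le> (\<Sum>i<n. lam (U i))"
proof (induction n)
  case 0 show ?case by (simp add: lam_empty)
next
  case (Suc n)
  have "(\<Union>i<Suc n. U i) = (\<Union>i<n. U i) \<union> U n" by (auto simp: less_Suc_eq)
  moreover have "openin T (\<Union>i<n. U i)" using assms by blast
  ultimately show ?case using lam_Un[of "\<Union>i<n. U i" "U n"] assms[of n] Suc by simp
qed

lemma lam_UN:
  assumes U: "\<And>i::nat. openin T (U i)"
  shows "ennreal (lam (\<Union>i. U i)) \<le> (\<Sum>i. ennreal (lam (U i)))"
proof (rule ennreal_le_epsilon)
  fix e :: real assume fin: "(\<Sum>i. ennreal (lam (U i))) < top" and e: "0 < e"
  have "summable (\<lambda>i. lam (U i))"
    using fin by (intro summable_suminf_not_top lam_nonneg) simp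
  then have part: "(\<Sum>i<n. lam (U i)) \<le> (\<Sum>i. lam (U i))" for n
    using lam_nonneg by (intro sum_le_suminf) auto
  have eq: "(\<Sum>i. ennreal (lam (U i))) = ennreal (\<Sum>i. lam (U i))"
    using fin by (intro suminf_ennreal lam_nonneg) simp
  have "lam (\<Union>i. U i) \<le> (\<Sum>i. lam (U i)) + e"
  proof (rule lam_least)
    fix f assume f: "f \<in> below (\<Union>i. U i)"
    let ?K = "{x \<in> topspace T. e \<le> f x}"
    have "compactin T ?K"
      using compact closedin_level[OF below_continuous[OF f]] by (rule closedin_compact_space)
    moreover have "?K \<subseteq> \<Union> (range U)"
      using below_zero[OF f] e by force
    ultimately obtain \<F> where F: "finite \<F>" "\<F> \<subseteq> range U" "?K \<subseteq> \<Union>\<F>"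
      using U compactinD[of T ?K "range U"] by blast
    then obtain I where "finite I" "\<F> = U ` I" by (meson finite_subset_image)
    then have I: "finite I" "?K \<subseteq> (\<Union>i\<in>I. U i)" using F by auto
    then obtain n where "I \<subseteq> {..<n}" using finite_nat_iff_bounded by blast
    then have K: "?K \<subseteq> (\<Union>i<n. U i)" using I by blast
    have "(\<lambda>x. max (f x - e) 0) \<in> below (\<Union>i<n. U i)"
    proof -
      have "f x < e" if "x \<in> topspace T - (\<Union>i<n. U i)" for x using K that by force
      then have "max (f x - e) 0 = 0" if "x \<in> topspace T - (\<Union>i<n. U i)" for x
        using that by fastforce
      moreover have "0 \<le> max (f x - e) 0 \<and> max (f x - e) 0 \<le> 1" if "x \<in> topspace T" for x
        using below_bounds[OF f that] e by auto
      ultimately show ?thesis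
        using below_continuous[OF f] unfolding below_def by (auto intro!: continuous_intros)
    qed
    then have "L (\<lambda>x. max (f x - e) 0) \<le> lam (\<Union>i<n. U i)" by (rule L_le_lam)
    also have "\<dots> \<le> (\<Sum>i<n. lam (U i))" by (rule lam_UN_finite[OF U])
    also have "\<dots> \<le> (\<Sum>i. lam (U i))" by (rule part)
    finally have "L (\<lambda>x. max (f x - e) 0) \<le> (\<Sum>i. lam (U i))" .
    then show "L f \<le> (\<Sum>i. lam (U i)) + e" using truncate[OF f e] by linarith
  qed
  then have "ennreal (lam (\<Union>i. U i)) \<le> ennreal ((\<Sum>i. lam (U i)) + e)" by (rule ennreal_leI)
  also have "\<dots> = (\<Sum>i. ennreal (lam (U i))) + ennreal e"
    using e part[of 0] by (simp add: eq ennreal_plus)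
  finally show "ennreal (lam (\<Union>i. U i)) \<le> (\<Sum>i. ennreal (lam (U i))) + ennreal e" .
qed

definition outer :: "'a set \<Rightarrow> real" where
  "outer A = (INF U\<in>{U. openin T U \<and> A \<subseteq> U}. lam U)"

lemma outer_le_lam: "openin T U \<Longrightarrow> A \<subseteq> U \<Longrightarrow> outer A \<le> lam U"
  unfolding outer_def using lam_nonneg by (intro cINF_lower bdd_belowI[of _ 0]) auto

lemma outer_greatest:
  "A \<subseteq> topspace T \<Longrightarrow> (\<And>U. openin T U \<Longrightarrow> A \<subseteq> U \<Longrightarrow> c \<le> lam U) \<Longrightarrow> c \<le> outer A"
  unfolding outer_def by (intro cINF_greatest) auto

lemma outer_nonneg: "A \<subseteq> topspace T \<Longrightarrow> 0 \<le> outer A"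
  by (intro outer_greatest lam_nonneg)

lemma outer_open: "openin T U \<Longrightarrow> outer U = lam U"
  by (intro antisym outer_le_lam outer_greatest lam_mono openin_subset) auto

lemma outer_mono: "A \<subseteq> B \<Longrightarrow> B \<subseteq> topspace T \<Longrightarrow> outer A \<le> outer B"
  by (intro outer_greatest outer_le_lam) auto

lemma ex_open_outer:
  assumes "A \<subseteq> topspace T" "0 < e"
  shows "\<exists>U. openin T U \<and> A \<subseteq> U \<and> lam U < outer A + e"
proof (rule ccontr)
  assume "\<not> ?thesis"
  then have "outer A + e \<le> outer A"
    using assms by (intro outer_greatest) (auto simp: not_less)
  then show False using assms by simp
qed

lemma outer_measure_space_outer:
  "outer_measure_space (Pow (topspace T)) (\<lambda>A. ennreal (outer A))"
  unfolding outer_measure_space_def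
proof (intro conjI)
  show "positive (Pow (topspace T)) (\<lambda>A. ennreal (outer A))"
    by (simp add: positive_def outer_open lam_empty)
  show "increasing (Pow (topspace T)) (\<lambda>A. ennreal (outer A))"
    by (auto simp: increasing_def intro!: ennreal_leI outer_mono)
  show "countably_subadditive (Pow (topspace T)) (\<lambda>A. ennreal (outer A))"
    unfolding countably_subadditive_def
  proof safe
    fix A :: "nat \<Rightarrow> 'a set" assume A: "range A \<subseteq> Pow (topspace T)"
    show "ennreal (outer (\<Union> (range A))) \<le> (\<Sum>i. ennreal (outer (A i)))"
    proof (rule ennreal_le_epsilon)
      fix e :: real assume e: "0 < e"
      have "\<exists>U. openin T U \<and> A i \<subseteq> U \<and> lam U < outer (A i) + e * (1 / 2) ^ Suc i" for i
        using A e by (intro ex_open_outer) auto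
      then obtain U where U: "\<And>i. openin T (U i)" "\<And>i. A i \<subseteq> U i"
        "\<And>i. lam (U i) < outer (A i) + e * (1 / 2) ^ Suc i" by metis
      have "ennreal (outer (\<Union> (range A))) \<le> ennreal (lam (\<Union>i. U i))"
        using U by (intro ennreal_leI outer_le_lam) auto
      also have "\<dots> \<le> (\<Sum>i. ennreal (lam (U i)))" by (rule lam_UN[OF U(1)])
      also have "\<dots> \<le> (\<Sum>i. ennreal (outer (A i)) + ennreal (e * (1 / 2) ^ Suc i))"
      proof (rule suminf_le)
        fix i
        have "ennreal (lam (U i)) \<le> ennreal (outer (A i) + e * (1 / 2) ^ Suc i)"
          using U(3)[of i] by (intro ennreal_leI) simp
        also have "\<dots> = ennreal (outer (A i)) + ennreal (e * (1 / 2) ^ Suc i)"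
          using A e outer_nonneg[of "A i"] by (intro ennreal_plus) auto
        finally show "ennreal (lam (U i)) \<le> ennreal (outer (A i)) + ennreal (e * (1 / 2) ^ Suc i)" .
      qed auto
      also have "\<dots> = (\<Sum>i. ennreal (outer (A i))) + (\<Sum>i. ennreal (e * (1 / 2) ^ Suc i))"
        by (subst suminf_add[symmetric]) auto
      also have "(\<Sum>i. ennreal (e * (1 / 2) ^ Suc i)) = ennreal e"
      proof -
        have "(\<lambda>i. e * (1 / 2) ^ Suc i) sums (e * 1)"
          by (intro sums_mult power_half_series)
        then show ?thesis using e by (subst suminf_ennreal2) (auto simp: sums_iff)
      qed
      finally show "ennreal (outer (\<Union> (range A))) \<le> (\<Sum>i. ennreal (outer (A i))) + ennreal e" .
    qed
  qed
qed

lemma outer_Un: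
  assumes "A \<subseteq> topspace T" "B \<subseteq> topspace T"
  shows "outer (A \<union> B) \<le> outer A + outer B"
proof (rule field_le_epsilon)
  fix e :: real assume "0 < e"
  then obtain U V where U: "openin T U" "A \<subseteq> U" "lam U < outer A + e / 2"
    and V: "openin T V" "B \<subseteq> V" "lam V < outer B + e / 2"
    using ex_open_outer[OF assms(1), of "e / 2"] ex_open_outer[OF assms(2), of "e / 2"] half_gt_zero
    by metis
  then have "outer (A \<union> B) \<le> lam (U \<union> V)" by (intro outer_le_lam) auto
  also have "\<dots> \<le> lam U + lam V" using U V by (intro lam_Un)
  finally show "outer (A \<union> B) \<le> outer A + outer B + e" using U V by linarith
qed

text \<open>An almost optimal function \<open>f\<close> below \<open>V \<inter> U\<close>, truncated at height \<open>\<delta>\<close>, and any function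
  below \<open>V \<inter> {f < \<delta>}\<close> are nonzero at disjoint sets of points, so that their sum is below \<open>V\<close>.\<close>
lemma open_in_lambda_system:
  assumes U: "openin T U"
  shows "U \<in> lambda_system (topspace T) (Pow (topspace T)) (\<lambda>A. ennreal (outer A))"
  unfolding lambda_system_def
proof (intro CollectI conjI ballI)
  show "U \<in> Pow (topspace T)" using openin_subset[OF U] by blast
  fix A assume "A \<in> Pow (topspace T)"
  then have A: "A \<subseteq> topspace T" by blast
  have UA: "U \<inter> A \<subseteq> topspace T" "(topspace T - U) \<inter> A \<subseteq> topspace T" using A by auto
  have "outer (U \<inter> A) + outer ((topspace T - U) \<inter> A) \<le> outer A"
  proof (rule outer_greatest[OF A])
    fix V assume V: "openin T V" "A \<subseteq> V"
    have "lam (V \<inter> U) \<le> lam V - outer ((topspace T - U) \<inter> A)"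
    proof (rule lam_least, rule field_le_epsilon)
      fix f and \<delta> :: real assume f: "f \<in> below (V \<inter> U)" and \<delta>: "0 < \<delta>"
      define h where "h x = max (f x - \<delta>) 0" for x
      have hc: "continuous_map T euclideanreal h"
        unfolding h_def using below_continuous[OF f] by (intro continuous_intros) auto
      let ?W = "{x \<in> topspace T. f x < \<delta>}"
      have "openin T (V \<inter> ?W)"
        using V openin_level[OF below_continuous[OF f]] by auto
      moreover have "(topspace T - U) \<inter> A \<subseteq> V \<inter> ?W"
        using V below_zero[OF f] \<delta> A by auto
      ultimately have "outer ((topspace T - U) \<inter> A) \<le> lam (V \<inter> ?W)" by (rule outer_le_lam)
      also have "lam (V \<inter> ?W) \<le> lam V - L h"
      proof (rule lam_least)
        fix g assume g: "g \<in> below (V \<inter> ?W)"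
        have "(\<lambda>x. h x + g x) \<in> below V"
        proof -
          have "0 \<le> h x + g x \<and> h x + g x \<le> 1" if "x \<in> topspace T" for x
            using below_bounds[OF f that] below_bounds[OF g that] below_zero[OF g that] \<delta>
            by (cases "f x < \<delta>") (auto simp: h_def)
          moreover have "h x + g x = 0" if "x \<in> topspace T - V" for x
            using below_zero[OF f, of x] below_zero[OF g, of x] that \<delta> by (auto simp: h_def)
          ultimately show ?thesis
            using hc below_continuous[OF g] unfolding below_def by (auto intro!: continuous_intros)
        qed
        then have "L (\<lambda>x. h x + g x) \<le> lam V" by (rule L_le_lam)
        then show "L g \<le> lam V - L h" using L_add[OF hc below_continuous[OF g]] by simp
      qed
      finally show "L f \<le> lam V - outer ((topspace T - U) \<inter> A) + \<delta>"
        using truncate[OF f \<delta>] by (simp add: h_def[abs_def])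
    qed
    moreover have "outer (U \<inter> A) \<le> lam (V \<inter> U)" using U V by (intro outer_le_lam) auto
    ultimately show "outer (U \<inter> A) + outer ((topspace T - U) \<inter> A) \<le> lam V" by linarith
  qed
  moreover have "outer A \<le> outer (U \<inter> A) + outer ((topspace T - U) \<inter> A)"
  proof -
    have "U \<inter> A \<union> (topspace T - U) \<inter> A = A" using A by blast
    then show ?thesis using outer_Un[OF UA] by simp
  qed
  ultimately show "ennreal (outer (U \<inter> A)) + ennreal (outer ((topspace T - U) \<inter> A)) = ennreal (outer A)"
    using outer_nonneg[OF UA(1)] outer_nonneg[OF UA(2)] by (simp add: ennreal_plus[symmetric] del: ennreal_plus)
qed

definition riesz_measure :: "'a measure" where
  "riesz_measure = measure_of (topspace T) {U. openin T U} (\<lambda>A. ennreal (outer A))"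

lemma sets_riesz [simp]: "sets riesz_measure = sets (borel_of T)"
  unfolding riesz_measure_def sets_borel_of by (intro sets_measure_of) (auto dest: openin_subset)

lemma emeasure_riesz:
  assumes "A \<in> sets (borel_of T)" shows "emeasure riesz_measure A = ennreal (outer A)"
proof -
  interpret P: sigma_algebra "topspace T" "Pow (topspace T)" by (rule sigma_algebra_Pow)
  let ?\<Lambda> = "lambda_system (topspace T) (Pow (topspace T)) (\<lambda>A. ennreal (outer A))"
  have ms: "measure_space (topspace T) ?\<Lambda> (\<lambda>A. ennreal (outer A))"
    using outer_measure_space_outer by (rule P.caratheodory_lemma)
  then have sa: "sigma_algebra (topspace T) ?\<Lambda>" by (simp add: measure_space_def)
  have sub: "sigma_sets (topspace T) {U. openin T U} \<subseteq> ?\<Lambda>"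
    using open_in_lambda_system by (intro sigma_algebra.sigma_sets_subset[OF sa]) auto
  have sg: "{U. openin T U} \<subseteq> Pow (topspace T)" by (auto dest: openin_subset)
  have "measure_space (topspace T) (sigma_sets (topspace T) {U. openin T U}) (\<lambda>A. ennreal (outer A))"
    using ms sigma_algebra_sigma_sets[OF sg] sub by (rule measure_down)
  then show ?thesis
    using assms sg unfolding measure_space_def sets_borel_of[symmetric]
    by (intro emeasure_measure_of[OF riesz_measure_def]) auto
qed

lemma riesz_prob: "riesz_measure \<in> prob_measures T"
proof -
  have "space riesz_measure = topspace T" using sets_eq_imp_space_eq[OF sets_riesz] by simp
  then show ?thesis
    by (auto simp: prob_measures_iff emeasure_riesz openin_sets_borel_of outer_open lam_top intro!: prob_spaceI)
qed

lemma measure_riesz_open: "openin T U \<Longrightarrow> measure riesz_measure U = lam U"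
  by (simp add: measure_def emeasure_riesz openin_sets_borel_of outer_open lam_nonneg)

text \<open>A function \<open>f\<close> with values in the unit interval is the sum of \<open>n\<close> layers of height \<open>1/n\<close>; the
  \<open>k\<close>-th layer lives on \<open>{f > k/n}\<close> and is full on \<open>{f > (k+1)/n}\<close>, so \<open>L f\<close> exceeds the
  integral at most by the lowest layer.\<close>
lemma L_le_integral:
  assumes c: "continuous_map T euclideanreal f" and f01: "\<And>x. x \<in> topspace T \<Longrightarrow> 0 \<le> f x \<and> f x \<le> 1"
  shows "L f \<le> (\<integral>x. f x \<partial>riesz_measure)"
proof (rule field_le_epsilon)
  fix e :: real assume "0 < e"
  then obtain n where n: "1 / real (Suc n) < e" using nat_approx_posE by blast
  let ?n = "real (Suc n)"
  interpret prob_space riesz_measure using riesz_prob by (simp add: prob_measures_iff)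
  define h where "h k x = min (max (f x - real k / ?n) 0) (1 / ?n)" for k x
  have hc: "continuous_map T euclideanreal (h k)" for k
    unfolding h_def using c by (intro continuous_intros) auto
  have hi: "integrable riesz_measure (h k)" for k by (rule integrable_continuous[OF riesz_prob hc])
  have h_sum: "(\<Sum>k<j. h k x) = min (f x) (real j / ?n)" if "x \<in> topspace T" for j x
  proof (induction j)
    case 0 then show ?case using f01[OF that] by simp
  next
    case (Suc j)
    have "real (Suc j) / ?n = real j / ?n + 1 / ?n" by (simp add: add_divide_distrib)
    moreover have "min y a + min (max (y - a) 0) b = min y (a + b)" if "0 \<le> b" for a b y :: real
      using that by linarith
    ultimately show ?case using Suc by (simp add: h_def del: of_nat_Suc)
  qed
  have sp: "space riesz_measure = topspace T" by (rule prob_measures_space[OF riesz_prob])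
  let ?E = "\<lambda>k. {x \<in> topspace T. real k / ?n < f x}"
  have oE: "openin T (?E k)" for k using openin_level[OF c] by blast
  have Lh: "L (h k) \<le> measure riesz_measure (?E k) / ?n" for k
  proof -
    have "(\<lambda>x. ?n * h k x) \<in> below (?E k)"
    proof -
      have "0 \<le> h k x" "h k x \<le> 1 / ?n" for x by (auto simp: h_def)
      then have "0 \<le> ?n * h k x" "?n * h k x \<le> 1" for x
        using mult_left_mono[of "h k x" "1 / ?n" ?n] by (auto simp del: of_nat_Suc)
      moreover have "h k x = 0" if "x \<in> topspace T - ?E k" for x
        using that by (auto simp: h_def)
      moreover have "continuous_map T euclideanreal (\<lambda>x. ?n * h k x)"
        using hc by (intro continuous_intros)
      ultimately show ?thesis unfolding below_def by (auto simp del: of_nat_Suc)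
    qed
    then have "L (\<lambda>x. ?n * h k x) \<le> lam (?E k)" by (rule L_le_lam)
    then show ?thesis using L_scale[OF hc, of ?n k] measure_riesz_open[OF oE, of k]
      by (simp add: pos_le_divide_eq mult.commute del: of_nat_Suc)
  qed
  have Eh: "measure riesz_measure (?E (Suc k)) / ?n \<le> (\<integral>x. h k x \<partial>riesz_measure)" for k
  proof -
    have m: "?E (Suc k) \<in> events" unfolding sets_riesz by (rule openin_sets_borel_of[OF oE])
    have "integrable riesz_measure (indicator (?E (Suc k)) :: 'a \<Rightarrow> real)"
      by (rule integrable_real_indicator[OF m]) (simp add: emeasure_eq_measure)
    then have ind: "integrable riesz_measure (\<lambda>x. indicator (?E (Suc k)) x / ?n)"
      by (rule integrable_divide_zero)
    have "measure riesz_measure (?E (Suc k)) / ?n = (\<integral>x. indicator (?E (Suc k)) x / ?n \<partial>riesz_measure)" 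
      by (simp add: sp Int_absorb2)
    also have "\<dots> \<le> (\<integral>x. h k x \<partial>riesz_measure)"
    proof (rule integral_mono)
      fix x assume "x \<in> space riesz_measure"
      have "real (Suc k) / ?n = real k / ?n + 1 / ?n" by (simp add: add_divide_distrib)
      then show "indicator (?E (Suc k)) x / ?n \<le> h k x" 
        by (cases "x \<in> ?E (Suc k)") (auto simp: h_def simp del: of_nat_Suc)
    qed (rule ind, rule hi)
    finally show ?thesis .
  qed
  have "L f = L (\<lambda>x. \<Sum>k<Suc n. h k x)"
    using c hc f01 h_sum[of _ "Suc n"]
    by (intro antisym L_mono continuous_intros) auto
  also have "\<dots> = (\<Sum>k<Suc n. L (h k))" using hc by (intro L_sum) auto
  also have "\<dots> \<le> (\<Sum>k<Suc n. measure riesz_measure (?E k) / ?n)" by (intro sum_mono Lh)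
  also have "\<dots> = measure riesz_measure (?E 0) / ?n + (\<Sum>k<n. measure riesz_measure (?E (Suc k)) / ?n)"
    by (rule sum.lessThan_Suc_shift)
  also have "\<dots> \<le> 1 / ?n + (\<Sum>k<n. \<integral>x. h k x \<partial>riesz_measure)"
    by (intro add_mono sum_mono Eh divide_right_mono) auto
  also have "(\<Sum>k<n. \<integral>x. h k x \<partial>riesz_measure) = (\<integral>x. (\<Sum>k<n. h k x) \<partial>riesz_measure)"
    using hi by simp
  also have "\<dots> \<le> (\<integral>x. f x \<partial>riesz_measure)"
    using hi integrable_continuous[OF riesz_prob c] sp by (intro integral_mono) (auto simp: h_sum)
  finally show "L f \<le> (\<integral>x. f x \<partial>riesz_measure) + e" using n by linarith
qed

text \<open>The inequality \<open>L g \<le> \<integral> g\<close> for bounded \<open>g\<close> follows by rescaling to the unit interval; applied to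
  \<open>f\<close> and to \<open>- f\<close> it gives equality.\<close>
theorem riesz: "continuous_map T euclideanreal f \<Longrightarrow> L f = (\<integral>x. f x \<partial>riesz_measure)"
proof -
  assume c: "continuous_map T euclideanreal f"
  interpret prob_space riesz_measure using riesz_prob by (simp add: prob_measures_iff)
  obtain B where B: "B > 0" "\<And>x. x \<in> topspace T \<Longrightarrow> \<bar>f x\<bar> \<le> B" using continuous_bounded[OF c] by blast
  have le: "L g \<le> (\<integral>x. g x \<partial>riesz_measure)"
    if g: "continuous_map T euclideanreal g" "\<And>x. x \<in> topspace T \<Longrightarrow> \<bar>g x\<bar> \<le> B" for g
  proof -
    define h where "h x = (1 / (2 * B)) * (g x + B)" for x
    have hc: "continuous_map T euclideanreal h"
      unfolding h_def using g by (intro continuous_intros) auto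
    have "0 \<le> h x \<and> h x \<le> 1" if "x \<in> topspace T" for x
      using g(2)[OF that] B by (auto simp: h_def field_simps)
    then have "L h \<le> (\<integral>x. h x \<partial>riesz_measure)" by (rule L_le_integral[OF hc])
    moreover have "L h = (L g + B) / (2 * B)"
      unfolding h_def using g by (subst L_scale) (auto simp: L_add L_const intro!: continuous_intros)
    moreover have "(\<integral>x. h x \<partial>riesz_measure) = ((\<integral>x. g x \<partial>riesz_measure) + B) / (2 * B)"
      unfolding h_def using integrable_continuous[OF riesz_prob g(1)] by (simp add: prob_space)
    ultimately show ?thesis using B by (simp add: divide_le_cancel)
  qed
  have "L (\<lambda>x. - f x) \<le> (\<integral>x. - f x \<partial>riesz_measure)" using c B by (intro le continuous_intros) auto
  moreover have "L (\<lambda>x. - f x) = - L f" using L_scale[OF c, of "-1"] by simp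
  ultimately show ?thesis using le[OF c B(2)] by simp
qed

end

section \<open>The space of probability measures\<close>

lemma integral_distr_continuous:
  assumes "\<mu> \<in> prob_measures T" "continuous_map T T' \<phi>" "continuous_map T' euclideanreal f"
  shows "(\<integral>y. f y \<partial>distr \<mu> (borel_of T') \<phi>) = (\<integral>x. f (\<phi> x) \<partial>\<mu>)"
proof (rule integral_distr)
  show "\<phi> \<in> \<mu> \<rightarrow>\<^sub>M borel_of T'"
    using measurable_continuous_map[OF assms(2)] assms(1)
    by (simp add: prob_measures_iff cong: measurable_cong_sets)
qed (rule borel_measurable_continuous_map[OF assms(3)])

lemma distr_prob_measures:
  assumes "\<mu> \<in> prob_measures T" "\<phi> \<in> borel_of T \<rightarrow>\<^sub>M borel_of T'"
  shows "distr \<mu> (borel_of T') \<phi> \<in> prob_measures T'"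
proof -
  have "\<phi> \<in> \<mu> \<rightarrow>\<^sub>M borel_of T'"
    using assms by (simp add: prob_measures_iff cong: measurable_cong_sets)
  moreover have "prob_space \<mu>" using assms(1) by (simp add: prob_measures_iff)
  ultimately show ?thesis by (simp add: prob_measures_iff prob_space.prob_space_distr)
qed

context compact_metrizable
begin

lemma second_countable: "second_countable T"
  unfolding second_countable_def
proof (intro exI conjI ballI allI impI)
  let ?B = "range (\<lambda>i. {x \<in> topspace T. 1 / 2 < dense_seq i x})"
  show "countable ?B" by simp
  show "openin T V" if "V \<in> ?B" for V
    using that openin_continuous_map_preimage[OF continuous_dense_seq, of "{1/2<..}"] by auto
  fix U x assume Ux: "openin T U \<and> x \<in> U"
  then have x: "x \<in> topspace T" using openin_subset by blast
  have "closedin T {x}"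
    using x metrizable_imp_t1_space[OF metrizable] by (simp add: closedin_t1_singleton)
  moreover have "closedin T (topspace T - U)" using Ux by blast
  moreover have "disjnt (topspace T - U) {x}" using Ux by auto
  ultimately obtain f where f: "continuous_map T (top_of_set {0..1::real}) f"
    "f ` (topspace T - U) \<subseteq> {0}" "f ` {x} \<subseteq> {1}"
    using Urysohn_lemma[OF normal, of "topspace T - U" "{x}" 0 1] by (metis zero_le_one)
  then have "continuous_map T euclideanreal f" by (auto simp: continuous_map_in_subtopology)
  then obtain i where i: "\<And>y. y \<in> topspace T \<Longrightarrow> \<bar>f y - dense_seq i y\<bar> \<le> 1 / 4"
    using dense_seq_approx[of f "1/4"] by auto
  have "f x = 1" using f(3) by simp
  then have "1 / 2 < dense_seq i x" using i[OF x] by linarith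
  moreover have "y \<in> U" if "y \<in> topspace T" "1 / 2 < dense_seq i y" for y
  proof (rule ccontr)
    assume "y \<notin> U"
    then have "f y = 0" using f(2) that by blast
    then show False using i[OF that(1)] that(2) by linarith
  qed
  ultimately have "x \<in> {y \<in> topspace T. 1 / 2 < dense_seq i y} \<and> {y \<in> topspace T. 1 / 2 < dense_seq i y} \<subseteq> U"
    using x by blast
  then show "\<exists>V\<in>?B. x \<in> V \<and> V \<subseteq> U" by (rule bexI) (rule rangeI)
qed

lemma topspace_weak_star [simp]: "topspace (weak_star T) = prob_measures T"
proof -
  let ?S = "{{\<mu> \<in> prob_measures T. (\<integral>x. f x \<partial>\<mu>) \<in> U} | f U.
        continuous_map T euclideanreal f \<and> open U}"
  have "{\<mu> \<in> prob_measures T. (\<integral>x. (0::real) \<partial>\<mu>) \<in> UNIV} \<in> ?S"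
    by (intro CollectI exI[of _ "\<lambda>_. 0"] exI[of _ UNIV] conjI refl) simp_all
  then have "prob_measures T \<subseteq> \<Union>?S" by (intro Union_upper) simp
  moreover have "\<Union>?S \<subseteq> prob_measures T" by (intro Union_least) blast
  ultimately show ?thesis
    unfolding weak_star_def topology_generated_by_topspace by (rule antisym[rotated])
qed

lemma continuous_map_integral:
  assumes "continuous_map T euclideanreal f"
  shows "continuous_map (weak_star T) euclideanreal (\<lambda>\<mu>. \<integral>x. f x \<partial>\<mu>)"
  unfolding continuous_map_def
proof (intro conjI allI impI)
  fix U :: "real set" assume "openin euclideanreal U"
  then show "openin (weak_star T) {\<mu> \<in> topspace (weak_star T). (\<integral>x. f x \<partial>\<mu>) \<in> U}"
    unfolding topspace_weak_star unfolding weak_star_def using assms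
    by (intro topology_generated_by_Basis CollectI exI[of _ f] exI[of _ U] conjI refl) simp_all
qed simp

lemma continuous_map_into_weak_star:
  assumes "\<And>y. y \<in> topspace S \<Longrightarrow> h y \<in> prob_measures T"
    and "\<And>f. continuous_map T euclideanreal f \<Longrightarrow> continuous_map S euclideanreal (\<lambda>y. \<integral>x. f x \<partial>h y)"
  shows "continuous_map S (weak_star T) h"
  unfolding weak_star_def
proof (rule continuous_on_generated_topo)
  have "h ` topspace S \<subseteq> topspace (weak_star T)" using assms(1) by auto
  then show "h ` topspace S \<subseteq> \<Union>{{\<mu> \<in> prob_measures T. (\<integral>x. f x \<partial>\<mu>) \<in> U} | f U.
        continuous_map T euclideanreal f \<and> open U}"
    unfolding weak_star_def topology_generated_by_topspace .
  fix V assume "V \<in> {{\<mu> \<in> prob_measures T. (\<integral>x. f x \<partial>\<mu>) \<in> U} | f U.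
        continuous_map T euclideanreal f \<and> open U}"
  then obtain f U where V: "V = {\<mu> \<in> prob_measures T. (\<integral>x. f x \<partial>\<mu>) \<in> U}"
    and f: "continuous_map T euclideanreal f" and U: "open U" by blast
  have "h -` V \<inter> topspace S = {y \<in> topspace S. (\<integral>x. f x \<partial>h y) \<in> U}"
    using assms(1) by (auto simp: V)
  moreover have "openin S {y \<in> topspace S. (\<integral>x. f x \<partial>h y) \<in> U}"
    using openin_continuous_map_preimage[OF assms(2)[OF f], of U] U by simp
  ultimately show "openin S (h -` V \<inter> topspace S)" by simp
qed

lemma limitin_weak_star:
  "limitin (weak_star T) s \<nu> F \<longleftrightarrow> \<nu> \<in> prob_measures T \<and> (\<forall>\<^sub>F n in F. s n \<in> prob_measures T) \<and>
     (\<forall>f. continuous_map T euclideanreal f \<longrightarrow> ((\<lambda>n. \<integral>x. f x \<partial>s n) \<longlongrightarrow> (\<integral>x. f x \<partial>\<nu>)) F)"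
  (is "?L \<longleftrightarrow> ?R")
proof
  assume L: ?L
  then have "\<nu> \<in> prob_measures T" using limitin_topspace by force
  moreover have "\<forall>\<^sub>F n in F. s n \<in> prob_measures T"
    using L unfolding limitin_def by (metis openin_topspace topspace_weak_star)
  moreover have "((\<lambda>n. \<integral>x. f x \<partial>s n) \<longlongrightarrow> (\<integral>x. f x \<partial>\<nu>)) F"
    if "continuous_map T euclideanreal f" for f
    using continuous_map_limit[OF continuous_map_integral[OF that] L] by (simp add: o_def)
  ultimately show ?R by blast
next
  assume R: ?R
  have "\<nu> \<in> U \<longrightarrow> (\<forall>\<^sub>F n in F. s n \<in> U)" if "openin (weak_star T) U" for U
    using that[unfolded weak_star_def, THEN openin_topology_generated_by]
  proof (induction rule: generate_topology_on.induct)
    case (Int a b) then show ?case by (auto intro: eventually_conj)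
  next
    case (UN K)
    show ?case
    proof
      assume "\<nu> \<in> \<Union>K"
      then obtain k where "k \<in> K" "\<nu> \<in> k" by blast
      then have "\<forall>\<^sub>F n in F. s n \<in> k" using UN by blast
      then show "\<forall>\<^sub>F n in F. s n \<in> \<Union>K" using \<open>k \<in> K\<close> by (auto elim: eventually_mono)
    qed
  next
    case (Basis V)
    then obtain f U where V: "V = {\<mu> \<in> prob_measures T. (\<integral>x. f x \<partial>\<mu>) \<in> U}"
      and f: "continuous_map T euclideanreal f" and U: "open U" by blast
    show ?case
    proof
      assume "\<nu> \<in> V"
      then have "\<forall>\<^sub>F n in F. (\<integral>x. f x \<partial>s n) \<in> U"
        using R f U V by (intro topological_tendstoD[of _ "\<integral>x. f x \<partial>\<nu>"]) auto
      then show "\<forall>\<^sub>F n in F. s n \<in> V"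
        using conjunct1[OF conjunct2[OF R]] by eventually_elim (simp add: V)
    qed
  qed simp
  then show ?L using R by (simp add: limitin_def)
qed

definition emb :: "'a measure \<Rightarrow> nat \<Rightarrow> real" where
  "emb \<mu> = (\<lambda>i. \<integral>x. dense_seq i x \<partial>\<mu>)"

lemma emb_close:
  assumes "continuous_map T euclideanreal f" "0 < e"
  shows "\<exists>i. \<forall>\<mu>\<in>prob_measures T. \<bar>(\<integral>x. f x \<partial>\<mu>) - emb \<mu> i\<bar> \<le> e"
proof -
  obtain i where "\<forall>x\<in>topspace T. \<bar>f x - dense_seq i x\<bar> \<le> e" using dense_seq_approx[OF assms] by blast
  then have "\<bar>(\<integral>x. f x \<partial>\<mu>) - emb \<mu> i\<bar> \<le> e" if "\<mu> \<in> prob_measures T" for \<mu>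
    unfolding emb_def using that assms continuous_dense_seq by (intro integral_uniform_close) auto
  then show ?thesis by blast
qed

lemma emb_inj:
  assumes "\<mu> \<in> prob_measures T" "\<nu> \<in> prob_measures T" "emb \<mu> = emb \<nu>"
  shows "\<mu> = \<nu>"
proof (rule prob_measures_eqI[OF assms(1,2)])
  fix f assume f: "continuous_map T euclideanreal f"
  have "\<bar>(\<integral>x. f x \<partial>\<mu>) - (\<integral>x. f x \<partial>\<nu>)\<bar> \<le> e" if e: "0 < e" for e
  proof -
    obtain i where i: "\<forall>\<mu>\<in>prob_measures T. \<bar>(\<integral>x. f x \<partial>\<mu>) - emb \<mu> i\<bar> \<le> e / 2"
      using emb_close[OF f half_gt_zero[OF e]] by blast
    show ?thesis
      using i[rule_format, OF assms(1), unfolded assms(3)] i[rule_format, OF assms(2)] by linarith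
  qed
  then have "\<bar>(\<integral>x. f x \<partial>\<mu>) - (\<integral>x. f x \<partial>\<nu>)\<bar> \<le> 0" by (rule dense_ge)
  then show "(\<integral>x. f x \<partial>\<mu>) = (\<integral>x. f x \<partial>\<nu>)" by simp
qed

text \<open>A sequence of probability measures whose integrals converge has a limit: the limits of the
  integrals form a positive functional.\<close>
lemma ex_weak_star_limit:
  assumes s: "\<And>n. s n \<in> prob_measures T" and conv: "\<And>i. convergent (\<lambda>n. emb (s n) i)"
  shows "\<exists>\<nu>. limitin (weak_star T) s \<nu> sequentially"
proof -
  have all: "convergent (\<lambda>n. \<integral>x. f x \<partial>s n)" if f: "continuous_map T euclideanreal f" for f
    unfolding Cauchy_convergent_iff[symmetric]
  proof (rule metric_CauchyI)
    fix e :: real assume "0 < e"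
    then have "0 < e / 4" by simp
    then obtain i where i: "\<forall>\<mu>\<in>prob_measures T. \<bar>(\<integral>x. f x \<partial>\<mu>) - emb \<mu> i\<bar> \<le> e / 4"
      using emb_close[OF f] by blast
    have "Cauchy (\<lambda>n. emb (s n) i)" using conv by (simp add: Cauchy_convergent_iff)
    then obtain N where N: "\<And>m n. m \<ge> N \<Longrightarrow> n \<ge> N \<Longrightarrow> \<bar>emb (s m) i - emb (s n) i\<bar> < e / 4"
      using \<open>0 < e\<close> metric_CauchyD[of "\<lambda>n. emb (s n) i" "e / 4"] by (auto simp: dist_real_def)
    have "dist (\<integral>x. f x \<partial>s m) (\<integral>x. f x \<partial>s n) < e" if "m \<ge> N" "n \<ge> N" for m n
      using i[rule_format, OF s[of m]] i[rule_format, OF s[of n]] N[OF that] \<open>0 < e\<close> unfolding dist_real_def by linarith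
    then show "\<exists>M. \<forall>m\<ge>M. \<forall>n\<ge>M. dist (\<integral>x. f x \<partial>s m) (\<integral>x. f x \<partial>s n) < e" by blast
  qed
  define L :: "('a \<Rightarrow> real) \<Rightarrow> real" where "L f = lim (\<lambda>n. \<integral>x. f x \<partial>s n)" for f
  have L: "(\<lambda>n. \<integral>x. f x \<partial>s n) \<longlonglongrightarrow> L f" if "continuous_map T euclideanreal f" for f
    using all[OF that] by (simp add: L_def convergent_LIMSEQ_iff)
  have int: "integrable (s n) f" if "continuous_map T euclideanreal f" for f n
    using integrable_continuous[OF s that] .
  interpret positive_functional T L
  proof unfold_locales
    fix f g assume fg: "continuous_map T euclideanreal f" "continuous_map T euclideanreal g"
    have "(\<lambda>n. \<integral>x. f x + g x \<partial>s n) \<longlonglongrightarrow> L f + L g"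
      using tendsto_add[OF L[OF fg(1)] L[OF fg(2)]] int fg by simp
    then show "L (\<lambda>x. f x + g x) = L f + L g" unfolding L_def[of "\<lambda>x. f x + g x"] by (rule limI)
  next
    fix f :: "'a \<Rightarrow> real" and c assume f: "continuous_map T euclideanreal f"
    have "(\<lambda>n. \<integral>x. c * f x \<partial>s n) \<longlonglongrightarrow> c * L f"
      using tendsto_mult_left[OF L[OF f], of c] by simp
    then show "L (\<lambda>x. c * f x) = c * L f" unfolding L_def[of "\<lambda>x. c * f x"] by (rule limI)
  next
    fix f assume f: "continuous_map T euclideanreal f" "\<And>x. x \<in> topspace T \<Longrightarrow> 0 \<le> f x"
    have "0 \<le> (\<integral>x. f x \<partial>s n)" for n
      using f(2) prob_measures_space[OF s[of n]] by (intro integral_nonneg_AE AE_I2) auto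
    then show "0 \<le> L f" using L[OF f(1)] by (intro LIMSEQ_le_const) auto
  next
    have "(\<integral>x. (1::real) \<partial>s n) = 1" for n
      using s[of n] by (simp add: prob_measures_iff prob_space.prob_space)
    then show "L (\<lambda>_. 1) = 1" by (simp add: L_def)
  qed
  have "limitin (weak_star T) s riesz_measure sequentially"
    using L s riesz_prob by (simp add: limitin_weak_star riesz)
  then show ?thesis by blast
qed

lemma continuous_emb: "continuous_map (weak_star T) euclidean emb"
  unfolding euclidean_product_topology[symmetric] continuous_map_componentwise_UNIV
  by (simp add: emb_def continuous_map_integral continuous_dense_seq)

text \<open>The inverse map is continuous because every integral of a continuous function is a uniform
  limit of coordinates.\<close>
lemma homeomorphic_emb: "homeomorphic_map (weak_star T) (top_of_set (emb ` prob_measures T)) emb"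
proof -
  let ?S = "emb ` prob_measures T"
  define r where "r = inv_into (prob_measures T) emb"
  have inj: "inj_on emb (prob_measures T)" using emb_inj by (auto intro: inj_onI)
  have r: "r c \<in> prob_measures T" "emb (r c) = c" if "c \<in> ?S" for c
    using that by (auto simp: r_def inv_into_into f_inv_into_f)
  have "continuous_map (top_of_set ?S) (weak_star T) r"
  proof (rule continuous_map_into_weak_star)
    fix f assume f: "continuous_map T euclideanreal f"
    have "\<exists>i. \<forall>\<mu>\<in>prob_measures T. \<bar>(\<integral>x. f x \<partial>\<mu>) - emb \<mu> i\<bar> \<le> 1 / Suc k" for k
      by (rule emb_close[OF f]) simp
    then obtain i where i: "\<And>k \<mu>. \<mu> \<in> prob_measures T \<Longrightarrow> \<bar>(\<integral>x. f x \<partial>\<mu>) - emb \<mu> (i k)\<bar> \<le> 1 / Suc k"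
      by metis
    have "uniform_limit ?S (\<lambda>k c. c (i k)) (\<lambda>c. \<integral>x. f x \<partial>r c) sequentially"
      unfolding uniform_limit_sequentially_iff
    proof (intro allI impI)
      fix e :: real assume "0 < e"
      then obtain N where N: "1 / real (Suc N) < e" using nat_approx_posE by blast
      have "dist (c (i k)) (\<integral>x. f x \<partial>r c) < e" if "k \<ge> N" "c \<in> ?S" for k c
      proof -
        have "1 / real (Suc k) \<le> 1 / real (Suc N)" using that by (simp add: frac_le)
        then show ?thesis using i[of "r c" k] r[OF that(2)] N by (auto simp: dist_real_def)
      qed
      then show "\<exists>N. \<forall>n\<ge>N. \<forall>c\<in>?S. dist (c (i n)) (\<integral>x. f x \<partial>r c) < e" by blast
    qed
    then have "continuous_on ?S (\<lambda>c. \<integral>x. f x \<partial>r c)"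
      by (rule uniform_limit_theorem[rotated])
        (auto intro!: always_eventually continuous_on_subset[OF continuous_on_product_coordinates])
    then show "continuous_map (top_of_set ?S) euclideanreal (\<lambda>c. \<integral>x. f x \<partial>r c)" by simp
  qed (use r in auto)
  moreover have "continuous_map (weak_star T) (top_of_set ?S) emb"
    using continuous_emb by (auto simp: continuous_map_in_subtopology)
  ultimately have "homeomorphic_maps (weak_star T) (top_of_set ?S) emb r"
    using r inj by (auto simp: homeomorphic_maps_def r_def)
  then show ?thesis using homeomorphic_maps_map by blast
qed

text \<open>Bounds on the functions put the image into a product of compact intervals, and it is closed there
  because coordinatewise limits of integrals are integrals against a measure.\<close>
lemma compact_emb: "compact (emb ` prob_measures T)"
proof -
  have "\<exists>B. \<forall>x\<in>topspace T. \<bar>dense_seq i x\<bar> \<le> B" for i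
    using continuous_bounded[OF continuous_dense_seq, of i] by metis
  then obtain B where B: "\<And>i x. x \<in> topspace T \<Longrightarrow> \<bar>dense_seq i x\<bar> \<le> B i" by metis
  let ?K = "PiE UNIV (\<lambda>i. {- B i .. B i})"
  have "compactin (product_topology (\<lambda>_. euclideanreal) UNIV) ?K"
    by (simp add: compactin_PiE)
  then have "compact ?K" by (simp add: euclidean_product_topology)
  moreover have "emb \<mu> i \<in> {- B i .. B i}" if \<mu>: "\<mu> \<in> prob_measures T" for \<mu> i
    using integral_uniform_close[OF \<mu> continuous_dense_seq[of i], of "\<lambda>_. 0" "B i"] B
    by (auto simp: emb_def)
  then have "emb ` prob_measures T \<subseteq> ?K" by (intro image_subsetI PiE_I) auto
  moreover have "closed (emb ` prob_measures T)"
    unfolding closed_sequential_limits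
  proof (intro allI impI, elim conjE)
    fix c l assume c: "\<forall>n. c n \<in> emb ` prob_measures T" and l: "c \<longlonglongrightarrow> l"
    have "\<forall>n. \<exists>\<mu>. \<mu> \<in> prob_measures T \<and> c n = emb \<mu>" using c by blast
    then obtain s where s: "\<And>n. s n \<in> prob_measures T" "\<And>n. c n = emb (s n)"
      unfolding choice_iff by blast
    have lim: "(\<lambda>n. emb (s n) i) \<longlonglongrightarrow> l i" for i
    proof -
      have "isCont (\<lambda>x. x i) l" 
        using continuous_on_product_coordinates[of i] continuous_on_eq_continuous_at[OF open_UNIV]
        by blast
      from isCont_tendsto_compose[OF this l] show ?thesis by (simp add: s(2))
    qed
    then obtain \<nu> where \<nu>: "limitin (weak_star T) s \<nu> sequentially"
      using ex_weak_star_limit[of s] s(1) by (auto simp: convergent_def)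
    then have "(\<lambda>n. emb (s n) i) \<longlonglongrightarrow> emb \<nu> i" for i
      unfolding limitin_weak_star emb_def using continuous_dense_seq by blast
    then have "emb \<nu> i = l i" for i using lim by (rule LIMSEQ_unique)
    then have "l = emb \<nu>" by auto
    moreover have "\<nu> \<in> prob_measures T" using \<nu> limitin_weak_star by blast
    ultimately show "l \<in> emb ` prob_measures T" by (rule image_eqI)
  qed
  ultimately show ?thesis using compact_Int_closed[of ?K "emb ` prob_measures T"] by (simp add: Int_absorb1)
qed

lemma compact_metrizable_weak_star: "compact_metrizable (weak_star T)"
proof
  have hs: "weak_star T homeomorphic_space top_of_set (emb ` prob_measures T)"
    using homeomorphic_emb homeomorphic_map_imp_homeomorphic_space by blast
  show "compact_space (weak_star T)"
    using homeomorphic_compact_space[OF hs] compact_emb by (simp add: compact_space_subtopology)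
  show "metrizable_space (weak_star T)"
    using homeomorphic_metrizable_space[OF hs]
    by (simp add: metrizable_space_subtopology metrizable_space_euclidean)
qed

lemma measurable_into_weak_star:
  assumes "\<And>y. y \<in> space M \<Longrightarrow> h y \<in> prob_measures T"
    and "\<And>f. continuous_map T euclideanreal f \<Longrightarrow> (\<lambda>y. \<integral>x. f x \<partial>h y) \<in> borel_measurable M"
  shows "h \<in> M \<rightarrow>\<^sub>M borel_of (weak_star T)"
proof (rule measurable_into_borel_of)
  fix U assume U: "openin (weak_star T) U"
  then have sub: "U \<subseteq> prob_measures T" using openin_subset by fastforce
  have "openin (top_of_set (emb ` prob_measures T)) (emb ` U)"
    using homeomorphic_map_openness_eq[OF homeomorphic_emb] U by blast
  then obtain V where V: "open V" "emb ` U = emb ` prob_measures T \<inter> V"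
    unfolding openin_open by blast
  have UV: "\<mu> \<in> U \<longleftrightarrow> emb \<mu> \<in> V" if \<mu>: "\<mu> \<in> prob_measures T" for \<mu>
  proof
    assume "emb \<mu> \<in> V"
    then obtain \<nu> where "\<nu> \<in> U" "emb \<mu> = emb \<nu>" using V \<mu> by blast
    then show "\<mu> \<in> U" using emb_inj \<mu> sub by blast
  qed (use V in blast)
  have "(\<lambda>y. emb (h y)) \<in> borel_measurable M"
    using assms(2)[OF continuous_dense_seq]
    by (intro measurable_coordinatewise_then_product) (simp add: emb_def)
  then have "(\<lambda>y. emb (h y)) -` V \<inter> space M \<in> sets M"
    using V(1) by (intro measurable_sets) auto
  moreover have "(\<lambda>y. emb (h y)) -` V \<inter> space M = {y \<in> space M. h y \<in> U}"
    using UV assms(1) by auto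
  ultimately show "{y \<in> space M. h y \<in> U} \<in> sets M" by simp
qed (use assms in simp)

lemma measurable_into_prob_algebra:
  assumes "\<And>y. y \<in> space M \<Longrightarrow> h y \<in> prob_measures T"
    and "\<And>f. continuous_map T euclideanreal f \<Longrightarrow> (\<lambda>y. \<integral>x. f x \<partial>h y) \<in> borel_measurable M"
  shows "h \<in> M \<rightarrow>\<^sub>M prob_algebra (borel_of T)"
proof (rule measurable_prob_algebra_generated[OF sets_borel_of])
  show "Int_stable {U. openin T U}" by (auto simp: Int_stable_def)
  show "{U. openin T U} \<subseteq> Pow (topspace T)" by (auto dest: openin_subset)
  show "prob_space (h y)" "sets (h y) = sets (borel_of T)" if "y \<in> space M" for y
    using assms(1)[OF that] by (auto simp: prob_measures_iff)
  fix U assume "U \<in> {U. openin T U}"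
  then have U: "openin T U" by simp
  obtain u where u: "\<And>n. continuous_map T euclideanreal (u n)"
      "\<And>n x. x \<in> topspace T \<Longrightarrow> 0 \<le> u n x \<and> u n x \<le> (1::real)"
      "\<And>x. x \<in> topspace T \<Longrightarrow> (\<lambda>n. u n x) \<longlonglongrightarrow> indicator U x"
    using open_approx[OF U] by blast
  have "(\<lambda>y. measure (h y) U) \<in> borel_measurable M"
    using assms(2)[OF u(1)] measure_open_tendsto[OF assms(1) U u]
    by (rule borel_measurable_LIMSEQ_real[rotated])
  then have "(\<lambda>y. ennreal (measure (h y) U)) \<in> borel_measurable M" by simp
  moreover have "emeasure (h y) U = ennreal (measure (h y) U)" if "y \<in> space M" for y
  proof -
    interpret prob_space "h y" using assms(1)[OF that] by (simp add: prob_measures_iff)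
    show ?thesis by (rule emeasure_eq_measure)
  qed
  ultimately show "(\<lambda>y. emeasure (h y) U) \<in> borel_measurable M"
    by (simp cong: measurable_cong)
qed

lemma measurable_integral_prob_algebra:
  assumes "continuous_map T euclideanreal f"
  shows "(\<lambda>\<mu>. \<integral>x. f x \<partial>\<mu>) \<in> borel_measurable (prob_algebra (borel_of T))"
  using borel_measurable_continuous_map[OF assms]
  unfolding prob_algebra_def by (intro measurable_restrict_space1 integral_measurable_subprob_algebra)

text \<open>Both sides are generated by the integrals of continuous functions. This makes kernels the same
  as measurable maps into the weak* topology.\<close>
lemma sets_borel_of_weak_star: "sets (borel_of (weak_star T)) = sets (prob_algebra (borel_of T))"
proof -
  have 1: "(\<lambda>\<mu>. \<mu>) \<in> prob_algebra (borel_of T) \<rightarrow>\<^sub>M borel_of (weak_star T)"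
    using measurable_integral_prob_algebra by (intro measurable_into_weak_star) auto
  have 2: "(\<lambda>\<mu>. \<mu>) \<in> borel_of (weak_star T) \<rightarrow>\<^sub>M prob_algebra (borel_of T)"
    using borel_measurable_continuous_map[OF continuous_map_integral]
    by (intro measurable_into_prob_algebra) auto
  have sub: "sets N \<subseteq> sets M" if "(\<lambda>\<mu>. \<mu>) \<in> M \<rightarrow>\<^sub>M N" "space M = space N" for M N :: "'a measure measure"
  proof
    fix A assume "A \<in> sets N"
    then show "A \<in> sets M"
      using measurable_sets[OF that(1), of A] sets.sets_into_space[of A N] that(2) by (simp add: Int_absorb2)
  qed
  show ?thesis by (rule antisym) (rule sub[OF 1], simp, rule sub[OF 2], simp)
qed

lemma return_prob_measures: "x \<in> topspace T \<Longrightarrow> return (borel_of T) x \<in> prob_measures T"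
  by (auto simp: prob_measures_iff prob_space_return)

lemma continuous_return: "continuous_map T (weak_star T) (return (borel_of T))"
proof (rule continuous_map_into_weak_star)
  fix f assume f: "continuous_map T euclideanreal f"
  show "continuous_map T euclideanreal (\<lambda>y. \<integral>x. f x \<partial>return (borel_of T) y)"
    using f by (rule continuous_map_eq) (simp add: integral_return borel_measurable_continuous_map[OF f])
qed (rule return_prob_measures)

end

section \<open>Bounded martingales on a space of independent increments\<close>

lemma (in prob_space) integrable_bounded:
  fixes f :: "'a \<Rightarrow> real"
  assumes "f \<in> borel_measurable M" "\<And>x. x \<in> space M \<Longrightarrow> \<bar>f x\<bar> \<le> B"
  shows "integrable M f"
  using assms by (intro integrable_const_bound[of _ B]) auto

lemma (in prob_space) abs_integral_le:
  fixes f :: "'a \<Rightarrow> real"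
  assumes "f \<in> borel_measurable M" "\<And>x. x \<in> space M \<Longrightarrow> \<bar>f x\<bar> \<le> B"
  shows "\<bar>\<integral>x. f x \<partial>M\<bar> \<le> B"
proof -
  have "\<bar>\<integral>x. f x \<partial>M\<bar> \<le> (\<integral>x. \<bar>f x\<bar> \<partial>M)" by (rule integral_abs_bound)
  also have "\<dots> \<le> (\<integral>x. B \<partial>M)"
    using integrable_bounded[OF assms] assms(2) by (intro integral_mono) auto
  finally show ?thesis by (simp add: prob_space)
qed

lemma comb_seq_comb_seq: "comb_seq (n + j) (comb_seq n \<omega> \<omega>') \<omega>'' = comb_seq n \<omega> (comb_seq j \<omega>' \<omega>'')"
  by (rule ext) (auto simp: comb_seq_def)

context sequence_space
begin

lemma comb_seq_space: "\<omega> \<in> space S \<Longrightarrow> \<omega>' \<in> space S \<Longrightarrow> comb_seq n \<omega> \<omega>' \<in> space S"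
  by (auto simp: space_PiM PiE_iff comb_seq_def)

lemma measurable_comb_seq_right: "\<omega> \<in> space S \<Longrightarrow> comb_seq n \<omega> \<in> S \<rightarrow>\<^sub>M S"
  by (rule measurable_comb_seq'[OF measurable_const measurable_ident_sets[OF refl]])

lemma integral_comb_seq:
  fixes F :: "_ \<Rightarrow> real"
  assumes F: "F \<in> borel_measurable S" and B: "\<And>\<omega>. \<omega> \<in> space S \<Longrightarrow> \<bar>F \<omega>\<bar> \<le> B"
  shows "(\<integral>\<omega>. F \<omega> \<partial>S) = (\<integral>\<omega>. (\<integral>\<omega>'. F (comb_seq n \<omega> \<omega>') \<partial>S) \<partial>S)"
proof -
  interpret SS: pair_prob_space S S ..
  have m: "(\<lambda>z. F (comb_seq n (fst z) (snd z))) \<in> borel_measurable (S \<Otimes>\<^sub>M S)"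
    by (rule measurable_compose[OF _ F]) measurable
  have "(\<integral>\<omega>. F \<omega> \<partial>S) = (\<integral>\<omega>. F \<omega> \<partial>distr (S \<Otimes>\<^sub>M S) S (\<lambda>(\<omega>, \<omega>'). comb_seq n \<omega> \<omega>'))"
    by (simp add: PiM_comb_seq)
  also have "\<dots> = (\<integral>z. F (comb_seq n (fst z) (snd z)) \<partial>(S \<Otimes>\<^sub>M S))"
    by (subst integral_distr[OF measurable_comb_seq F]) (simp add: case_prod_beta')
  also have "\<dots> = (\<integral>\<omega>. (\<integral>\<omega>'. F (comb_seq n \<omega> \<omega>') \<partial>S) \<partial>S)"
  proof -
    have "\<bar>F (comb_seq n (fst z) (snd z))\<bar> \<le> B" if "z \<in> space (S \<Otimes>\<^sub>M S)" for z
      using that by (intro B comb_seq_space) (auto simp: space_pair_measure)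
    then have "integrable (S \<Otimes>\<^sub>M S) (\<lambda>z. F (comb_seq n (fst z) (snd z)))"
      by (rule SS.P.integrable_bounded[OF m])
    from SS.integral_fst'[OF this] show ?thesis unfolding fst_conv snd_conv by (rule sym)
  qed
  finally show ?thesis .
qed

text \<open>Functions of the first \<open>n\<close> coordinates. As the coordinates are independent, the conditional
  expectation given them is the integral over the remaining coordinates, that is, over the second
  argument of \<^const>\<open>comb_seq\<close>; the martingale property is stated in this form.\<close>
definition adapted :: "nat \<Rightarrow> ((nat \<Rightarrow> 'a) \<Rightarrow> real) \<Rightarrow> bool" where
  "adapted n Z \<longleftrightarrow> Z \<in> borel_measurable S \<and>
     (\<forall>\<omega>\<in>space S. \<forall>\<omega>'\<in>space S. (\<forall>i<n. \<omega> i = \<omega>' i) \<longrightarrow> Z \<omega> = Z \<omega>')"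

definition bounded_martingale :: "(nat \<Rightarrow> (nat \<Rightarrow> 'a) \<Rightarrow> real) \<Rightarrow> real \<Rightarrow> bool" where
  "bounded_martingale X B \<longleftrightarrow> (\<forall>n. adapted n (X n)) \<and> (\<forall>n. \<forall>\<omega>\<in>space S. \<bar>X n \<omega>\<bar> \<le> B) \<and>
     (\<forall>n j. \<forall>\<omega>\<in>space S. (\<integral>\<omega>'. X (n + j) (comb_seq n \<omega> \<omega>') \<partial>S) = X n \<omega>)"

lemma adaptedD:
  assumes "adapted n Z" "\<omega> \<in> space S" "\<omega>' \<in> space S" "\<And>i. i < n \<Longrightarrow> \<omega> i = \<omega>' i"
  shows "Z \<omega> = Z \<omega>'"
  using conjunct2[OF assms(1)[unfolded adapted_def], rule_format, OF assms(2,3)] assms(4) by blast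

lemma adapted_mono:
  assumes "adapted n Z" "n \<le> k" shows "adapted k Z"
  unfolding adapted_def
proof (intro conjI ballI impI)
  show "Z \<in> borel_measurable S" using assms(1) by (simp add: adapted_def)
  fix \<omega> \<omega>' assume w: "\<omega> \<in> space S" "\<omega>' \<in> space S" "\<forall>i<k. \<omega> i = \<omega>' i"
  show "Z \<omega> = Z \<omega>'"
  proof (rule adaptedD[OF assms(1) w(1,2)])
    fix i assume "i < n"
    then have "i < k" using assms(2) by simp
    then show "\<omega> i = \<omega>' i" using w(3) by blast
  qed
qed

lemma adapted_comb_seq:
  assumes "adapted n Z" "\<omega> \<in> space S" "\<omega>' \<in> space S"
  shows "Z (comb_seq n \<omega> \<omega>') = Z \<omega>"
  by (rule adaptedD[OF assms(1) comb_seq_space[OF assms(2,3)] assms(2)]) (rule comb_seq_less)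

lemma integral_adapted_times:
  fixes Z Y :: "_ \<Rightarrow> real"
  assumes Z: "adapted n Z" "\<And>\<omega>. \<omega> \<in> space S \<Longrightarrow> \<bar>Z \<omega>\<bar> \<le> C"
    and Y: "Y \<in> borel_measurable S" "\<And>\<omega>. \<omega> \<in> space S \<Longrightarrow> \<bar>Y \<omega>\<bar> \<le> B"
  shows "(\<integral>\<omega>. Z \<omega> * Y \<omega> \<partial>S) = (\<integral>\<omega>. Z \<omega> * (\<integral>\<omega>'. Y (comb_seq n \<omega> \<omega>') \<partial>S) \<partial>S)"
proof -
  have [measurable]: "Z \<in> borel_measurable S" using Z(1) by (simp add: adapted_def)
  have "(\<integral>\<omega>. Z \<omega> * Y \<omega> \<partial>S) = (\<integral>\<omega>. (\<integral>\<omega>'. Z (comb_seq n \<omega> \<omega>') * Y (comb_seq n \<omega> \<omega>') \<partial>S) \<partial>S)"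
  proof (rule integral_comb_seq)
    show "\<bar>Z \<omega> * Y \<omega>\<bar> \<le> C * B" if "\<omega> \<in> space S" for \<omega>
      using Z(2)[OF that] Y(2)[OF that] by (auto simp: abs_mult intro!: mult_mono)
  qed (use Y in measurable)
  also have "\<dots> = (\<integral>\<omega>. Z \<omega> * (\<integral>\<omega>'. Y (comb_seq n \<omega> \<omega>') \<partial>S) \<partial>S)"
  proof (rule Bochner_Integration.integral_cong[OF refl])
    fix \<omega> assume w: "\<omega> \<in> space S"
    have "(\<integral>\<omega>'. Z (comb_seq n \<omega> \<omega>') * Y (comb_seq n \<omega> \<omega>') \<partial>S) = (\<integral>\<omega>'. Z \<omega> * Y (comb_seq n \<omega> \<omega>') \<partial>S)"
      using adapted_comb_seq[OF Z(1) w] by (intro Bochner_Integration.integral_cong[OF refl]) simp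
    then show "(\<integral>\<omega>'. Z (comb_seq n \<omega> \<omega>') * Y (comb_seq n \<omega> \<omega>') \<partial>S) = Z \<omega> * (\<integral>\<omega>'. Y (comb_seq n \<omega> \<omega>') \<partial>S)"
      by simp
  qed
  finally show ?thesis .
qed

context
  fixes X B assumes X: "bounded_martingale X B"
begin

lemma X_adapted: "adapted n (X n)"
  and X_bound: "\<omega> \<in> space S \<Longrightarrow> \<bar>X n \<omega>\<bar> \<le> B"
  and X_martingale: "\<omega> \<in> space S \<Longrightarrow> (\<integral>\<omega>'. X (n + j) (comb_seq n \<omega> \<omega>') \<partial>S) = X n \<omega>"
  using X unfolding bounded_martingale_def by blast+

lemma X_measurable [measurable]: "X n \<in> borel_measurable S"
  using X_adapted by (simp add: adapted_def)

lemma martingale_orthogonal: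
  assumes Z: "adapted n Z" "\<And>\<omega>. \<omega> \<in> space S \<Longrightarrow> \<bar>Z \<omega>\<bar> \<le> C" and "n \<le> k"
  shows "(\<integral>\<omega>. Z \<omega> * X k \<omega> \<partial>S) = (\<integral>\<omega>. Z \<omega> * X n \<omega> \<partial>S)"
proof -
  have "(\<integral>\<omega>. Z \<omega> * X k \<omega> \<partial>S) = (\<integral>\<omega>. Z \<omega> * (\<integral>\<omega>'. X k (comb_seq n \<omega> \<omega>') \<partial>S) \<partial>S)"
    using Z X_bound by (intro integral_adapted_times) auto
  also have "\<dots> = (\<integral>\<omega>. Z \<omega> * X n \<omega> \<partial>S)"
    using X_martingale[of _ n "k - n"] \<open>n \<le> k\<close> by (intro Bochner_Integration.integral_cong) auto
  finally show ?thesis .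
qed

lemma X_diff_bound:
  assumes "\<omega> \<in> space S" shows "\<bar>X k \<omega> - X n \<omega>\<bar> \<le> 2 * B"
  using X_bound[OF assms, of k] X_bound[OF assms, of n] by linarith

lemma integrable_X2: "integrable S (\<lambda>\<omega>. (X k \<omega>)\<^sup>2)"
proof (rule P.integrable_bounded)
  show "\<bar>(X k \<omega>)\<^sup>2\<bar> \<le> B\<^sup>2" if "\<omega> \<in> space S" for \<omega>
    using X_bound[OF that, of k] by (simp add: abs_le_square_iff[symmetric] abs_le_iff)
qed measurable

lemma integrable_X_diff2: "integrable S (\<lambda>\<omega>. (X k \<omega> - X n \<omega>)\<^sup>2)"
proof (rule P.integrable_bounded)
  show "\<bar>(X k \<omega> - X n \<omega>)\<^sup>2\<bar> \<le> (2 * B)\<^sup>2" if "\<omega> \<in> space S" for \<omega>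
    using power_mono[OF X_diff_bound[OF that, of k n], of 2] by simp
qed measurable

lemma integral_X_diff2:
  assumes "n \<le> k"
  shows "(\<integral>\<omega>. (X k \<omega> - X n \<omega>)\<^sup>2 \<partial>S) = (\<integral>\<omega>. (X k \<omega>)\<^sup>2 \<partial>S) - (\<integral>\<omega>. (X n \<omega>)\<^sup>2 \<partial>S)"
proof -
  have o: "(\<integral>\<omega>. X n \<omega> * X k \<omega> \<partial>S) = (\<integral>\<omega>. (X n \<omega>)\<^sup>2 \<partial>S)"
    using martingale_orthogonal[OF X_adapted X_bound assms] by (simp add: power2_eq_square)
  have i: "integrable S (\<lambda>\<omega>. X n \<omega> * X k \<omega>)"
  proof (rule P.integrable_bounded)
    show "\<bar>X n \<omega> * X k \<omega>\<bar> \<le> B * B" if "\<omega> \<in> space S" for \<omega>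
      using X_bound[OF that, of n] X_bound[OF that, of k] unfolding abs_mult
      by (intro mult_mono) auto
  qed measurable
  have "(\<integral>\<omega>. (X k \<omega> - X n \<omega>)\<^sup>2 \<partial>S) = (\<integral>\<omega>. (X k \<omega>)\<^sup>2 + (X n \<omega>)\<^sup>2 - 2 * (X n \<omega> * X k \<omega>) \<partial>S)"
    by (intro Bochner_Integration.integral_cong) (auto simp: power2_diff)
  also have "\<dots> = (\<integral>\<omega>. (X k \<omega>)\<^sup>2 \<partial>S) + (\<integral>\<omega>. (X n \<omega>)\<^sup>2 \<partial>S) - 2 * (\<integral>\<omega>. X n \<omega> * X k \<omega> \<partial>S)"
    using i integrable_X2 by simp
  finally show ?thesis by (simp add: o)
qed

text \<open>Kolmogorov's maximal inequality: stop at the first time the martingale has moved by more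
  than \<open>e\<close>; after that time the increments are orthogonal to the past.\<close>
lemma maximal_inequality:
  assumes "n \<le> N" "0 < e"
  shows "e\<^sup>2 * P.prob {\<omega> \<in> space S. \<exists>k\<in>{n..N}. e < \<bar>X k \<omega> - X n \<omega>\<bar>}
           \<le> (\<integral>\<omega>. (X N \<omega>)\<^sup>2 \<partial>S) - (\<integral>\<omega>. (X n \<omega>)\<^sup>2 \<partial>S)"
proof -
  define E where "E k = {\<omega> \<in> space S. e < \<bar>X k \<omega> - X n \<omega>\<bar> \<and> (\<forall>j\<in>{n..<k}. \<bar>X j \<omega> - X n \<omega>\<bar> \<le> e)}" for k
  have E[measurable]: "E k \<in> sets S" for k unfolding E_def by measurable
  have "disjoint_family_on E {n..N}"
    unfolding disjoint_family_on_def
  proof (intro ballI impI)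
    fix i j assume ij: "i \<in> {n..N}" "j \<in> {n..N}" "i \<noteq> j"
    show "E i \<inter> E j = {}"
    proof (cases "i < j")
      case True
      then have "i \<in> {n..<j}" using ij by auto
      then show ?thesis unfolding E_def using not_less by blast
    next
      case False
      then have "j \<in> {n..<i}" using ij by auto
      then show ?thesis unfolding E_def using not_less by blast
    qed
  qed
  have cover: "{\<omega> \<in> space S. \<exists>k\<in>{n..N}. e < \<bar>X k \<omega> - X n \<omega>\<bar>} = (\<Union>k\<in>{n..N}. E k)"
  proof (intro equalityI subsetI)
    fix \<omega> assume w: "\<omega> \<in> {\<omega> \<in> space S. \<exists>k\<in>{n..N}. e < \<bar>X k \<omega> - X n \<omega>\<bar>}"
    let ?P = "\<lambda>k. n \<le> k \<and> e < \<bar>X k \<omega> - X n \<omega>\<bar>"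
    obtain k where k: "k \<in> {n..N}" "?P k" using w by auto
    have L: "?P (LEAST k. ?P k)" using k(2) by (rule LeastI)
    have "(LEAST k. ?P k) \<le> k" using k(2) by (rule Least_le)
    moreover have "\<bar>X j \<omega> - X n \<omega>\<bar> \<le> e" if "j \<in> {n..<(LEAST k. ?P k)}" for j
      using not_less_Least[of j ?P] that by auto
    ultimately have "\<omega> \<in> E (LEAST k. ?P k)" "(LEAST k. ?P k) \<in> {n..N}"
      using L w k(1) by (auto simp: E_def)
    then show "\<omega> \<in> (\<Union>k\<in>{n..N}. E k)" by blast
  qed (auto simp: E_def)
  have step: "e\<^sup>2 * P.prob (E k) \<le> (\<integral>\<omega>. indicator (E k) \<omega> * (X N \<omega> - X n \<omega>)\<^sup>2 \<partial>S)"
    if k: "k \<in> {n..N}" for k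
  proof -
    let ?I = "indicator (E k) :: _ \<Rightarrow> real"
    define Z where "Z \<omega> = ?I \<omega> * (X k \<omega> - X n \<omega>)" for \<omega>
    have Zad: "adapted k Z"
      unfolding adapted_def
    proof (intro conjI ballI impI)
      show "Z \<in> borel_measurable S" unfolding Z_def by measurable
      fix \<omega> \<omega>' assume w: "\<omega> \<in> space S" "\<omega>' \<in> space S" "\<forall>i<k. \<omega> i = \<omega>' i"
      have "X j \<omega> = X j \<omega>'" if "j \<le> k" for j
        using adapted_mono[OF X_adapted that] w unfolding adapted_def by blast
      then have "X k \<omega> = X k \<omega>'" "X n \<omega> = X n \<omega>'" "\<And>j. j \<in> {n..<k} \<Longrightarrow> X j \<omega> = X j \<omega>'"
        using k by auto
      then show "Z \<omega> = Z \<omega>'" using w by (simp add: Z_def E_def indicator_def)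
    qed
    have Zb: "\<bar>Z \<omega>\<bar> \<le> 2 * B" if "\<omega> \<in> space S" for \<omega>
      using X_diff_bound[OF that, of k n] by (auto simp: Z_def indicator_def)
    have [measurable]: "Z \<in> borel_measurable S" using Zad by (simp add: adapted_def)
    have iZ: "integrable S (\<lambda>\<omega>. Z \<omega> * X j \<omega>)" for j
    proof (rule P.integrable_bounded)
      show "\<bar>Z \<omega> * X j \<omega>\<bar> \<le> (2 * B) * B" if "\<omega> \<in> space S" for \<omega>
        using Zb[OF that] X_bound[OF that, of j] unfolding abs_mult by (intro mult_mono) auto
    qed measurable
    have i1: "integrable S (\<lambda>\<omega>. ?I \<omega> * (X i \<omega> - X j \<omega>)\<^sup>2)" for i j
      using integrable_real_mult_indicator[OF E integrable_X_diff2[of i j]] by (simp add: mult.commute)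
    have "e\<^sup>2 * P.prob (E k) = (\<integral>\<omega>. ?I \<omega> * e\<^sup>2 \<partial>S)" by (simp add: mult.commute)
    also have "\<dots> \<le> (\<integral>\<omega>. ?I \<omega> * (X k \<omega> - X n \<omega>)\<^sup>2 \<partial>S)"
    proof (rule integral_mono[OF _ i1])
      show "integrable S (\<lambda>\<omega>. ?I \<omega> * e\<^sup>2)"
        by (rule P.integrable_bounded[where B="e\<^sup>2"]) (auto simp: indicator_def)
      show "?I \<omega> * e\<^sup>2 \<le> ?I \<omega> * (X k \<omega> - X n \<omega>)\<^sup>2" for \<omega>
        using \<open>0 < e\<close> by (auto simp: indicator_def E_def abs_le_square_iff[symmetric])
    qed
    also have "\<dots> \<le> (\<integral>\<omega>. ?I \<omega> * (X k \<omega> - X n \<omega>)\<^sup>2 \<partial>S) + (\<integral>\<omega>. ?I \<omega> * (X N \<omega> - X k \<omega>)\<^sup>2 \<partial>S)"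
      by simp
    also have "\<dots> = (\<integral>\<omega>. ?I \<omega> * (X k \<omega> - X n \<omega>)\<^sup>2 \<partial>S) + (\<integral>\<omega>. ?I \<omega> * (X N \<omega> - X k \<omega>)\<^sup>2 \<partial>S)
        + 2 * ((\<integral>\<omega>. Z \<omega> * X N \<omega> \<partial>S) - (\<integral>\<omega>. Z \<omega> * X k \<omega> \<partial>S))"
      using martingale_orthogonal[OF Zad Zb, of N] k by simp
    also have "\<dots> = (\<integral>\<omega>. (?I \<omega> * (X k \<omega> - X n \<omega>)\<^sup>2 + ?I \<omega> * (X N \<omega> - X k \<omega>)\<^sup>2)
        + 2 * (Z \<omega> * X N \<omega> - Z \<omega> * X k \<omega>) \<partial>S)"
      using i1 iZ by simp
    also have "\<dots> = (\<integral>\<omega>. ?I \<omega> * (X N \<omega> - X n \<omega>)\<^sup>2 \<partial>S)"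
      by (intro Bochner_Integration.integral_cong) (auto simp: Z_def indicator_def power2_eq_square algebra_simps)
    finally show ?thesis .
  qed
  have i2: "integrable S (\<lambda>\<omega>. indicator (E k) \<omega> * (X N \<omega> - X n \<omega>)\<^sup>2)" for k
    using integrable_real_mult_indicator[OF E integrable_X_diff2[of N n]] by (simp add: mult.commute)
  have "e\<^sup>2 * P.prob (\<Union>k\<in>{n..N}. E k) = (\<Sum>k\<in>{n..N}. e\<^sup>2 * P.prob (E k))"
    using \<open>disjoint_family_on E {n..N}\<close>
    by (subst P.finite_measure_finite_Union) (auto simp: sum_distrib_left)
  also have "\<dots> \<le> (\<Sum>k\<in>{n..N}. \<integral>\<omega>. indicator (E k) \<omega> * (X N \<omega> - X n \<omega>)\<^sup>2 \<partial>S)"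
    by (intro sum_mono step)
  also have "\<dots> = (\<integral>\<omega>. (\<Sum>k\<in>{n..N}. indicator (E k) \<omega> * (X N \<omega> - X n \<omega>)\<^sup>2) \<partial>S)"
    using i2 by (intro Bochner_Integration.integral_sum[symmetric])
  also have "\<dots> \<le> (\<integral>\<omega>. (X N \<omega> - X n \<omega>)\<^sup>2 \<partial>S)"
  proof (rule integral_mono)
    fix \<omega>
    have "(\<Sum>k\<in>{n..N}. indicator (E k) \<omega>) = (indicator (\<Union>k\<in>{n..N}. E k) \<omega> :: real)"
      by (rule indicator_UN_disjoint[OF _ \<open>disjoint_family_on E {n..N}\<close>, symmetric]) simp
    then have "(\<Sum>k\<in>{n..N}. indicator (E k) \<omega>) \<le> (1::real)" by (simp add: indicator_def)
    then show "(\<Sum>k\<in>{n..N}. indicator (E k) \<omega> * (X N \<omega> - X n \<omega>)\<^sup>2) \<le> (X N \<omega> - X n \<omega>)\<^sup>2"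
      unfolding sum_distrib_right[symmetric] by (intro mult_left_le_one_le) (auto intro!: sum_nonneg)
  qed (rule Bochner_Integration.integrable_sum, rule i2, rule integrable_X_diff2)
  finally show ?thesis unfolding cover using integral_X_diff2[OF \<open>n \<le> N\<close>] by simp
qed

lemma martingale_AE_small:
  assumes "0 < e"
  shows "AE \<omega> in S. \<exists>n. \<forall>k\<ge>n. \<bar>X k \<omega> - X n \<omega>\<bar> \<le> e"
proof -
  define a where "a n = (\<integral>\<omega>. (X n \<omega>)\<^sup>2 \<partial>S)" for n
  have "incseq a"
  proof (rule incseq_SucI)
    fix n
    have "0 \<le> (\<integral>\<omega>. (X (Suc n) \<omega> - X n \<omega>)\<^sup>2 \<partial>S)" by simp
    then show "a n \<le> a (Suc n)" using integral_X_diff2[of n "Suc n"] by (simp add: a_def)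
  qed
  moreover have "a n \<le> B\<^sup>2" for n
  proof -
    have "\<bar>\<integral>\<omega>. (X n \<omega>)\<^sup>2 \<partial>S\<bar> \<le> B\<^sup>2"
    proof (rule P.abs_integral_le)
      show "\<bar>(X n \<omega>)\<^sup>2\<bar> \<le> B\<^sup>2" if "\<omega> \<in> space S" for \<omega>
        using power_mono[OF X_bound[OF that, of n], of 2] by simp
    qed measurable
    then show ?thesis by (simp add: a_def)
  qed
  ultimately obtain A where A: "a \<longlonglongrightarrow> A" "\<And>n. a n \<le> A" using incseq_convergent by blast
  define D where "D n = {\<omega> \<in> space S. \<exists>k\<ge>n. e < \<bar>X k \<omega> - X n \<omega>\<bar>}" for n
  have [measurable]: "D n \<in> sets S" for n unfolding D_def by measurable
  have Dn: "P.prob (D n) \<le> (A - a n) / e\<^sup>2" for n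
  proof -
    let ?D = "\<lambda>N. {\<omega> \<in> space S. \<exists>k\<in>{n..n + N}. e < \<bar>X k \<omega> - X n \<omega>\<bar>}"
    have "(\<Union>N. ?D N) = D n"
      unfolding D_def by (auto simp: Bex_def) (metis le_add_diff_inverse order_refl)
    moreover have "(\<lambda>N. P.prob (?D N)) \<longlonglongrightarrow> P.prob (\<Union>N. ?D N)"
      by (rule P.finite_Lim_measure_incseq) (auto simp: incseq_def)
    moreover have "P.prob (?D N) \<le> (A - a n) / e\<^sup>2" for N
    proof -
      have "e\<^sup>2 * P.prob (?D N) \<le> a (n + N) - a n"
        using maximal_inequality[of n "n + N" e] \<open>0 < e\<close> by (simp add: a_def)
      also have "\<dots> \<le> A - a n" using A(2) by simp
      finally show ?thesis using \<open>0 < e\<close> by (simp add: field_simps)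
    qed
    ultimately show ?thesis by (intro LIMSEQ_le_const2) auto
  qed
  have "(\<lambda>n. (A - a n) / e\<^sup>2) \<longlonglongrightarrow> (A - A) / e\<^sup>2"
    using \<open>0 < e\<close> A(1) by (intro tendsto_intros) auto
  moreover have "P.prob (\<Inter>n. D n) \<le> (A - a n) / e\<^sup>2" for n
    using Dn[of n] P.finite_measure_mono[of "\<Inter>n. D n" "D n"] by force
  ultimately have "P.prob (\<Inter>n. D n) \<le> (A - A) / e\<^sup>2"
    by (intro LIMSEQ_le_const) auto
  then have "P.prob (\<Inter>n. D n) = 0" by (simp add: measure_le_0_iff)
  then have "AE \<omega> in S. \<omega> \<notin> (\<Inter>n. D n)"
    by (intro AE_not_in) (auto simp: null_sets_def P.emeasure_eq_measure)
  then show ?thesis by (rule AE_mp) (auto intro!: AE_I2 simp: D_def not_less)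
qed

text \<open>The second moments increase to a finite limit, and by the maximal inequality the probability of a
  later move by more than \<open>e\<close> is controlled by what is missing to this limit.\<close>
theorem martingale_convergence: "AE \<omega> in S. convergent (\<lambda>n. X n \<omega>)"
proof -
  have "AE \<omega> in S. \<forall>j::nat. \<exists>n. \<forall>k\<ge>n. \<bar>X k \<omega> - X n \<omega>\<bar> \<le> 1 / Suc j"
    unfolding AE_all_countable by (intro allI martingale_AE_small) simp
  then show ?thesis
  proof (rule AE_mp, intro AE_I2 impI)
    fix \<omega> assume small: "\<forall>j::nat. \<exists>n. \<forall>k\<ge>n. \<bar>X k \<omega> - X n \<omega>\<bar> \<le> 1 / Suc j"
    have "Cauchy (\<lambda>n. X n \<omega>)"
    proof (rule metric_CauchyI)
      fix e :: real assume "0 < e"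
      then obtain j where j: "1 / real (Suc j) < e / 2" using nat_approx_posE[of "e / 2"] by auto
      obtain n where n: "\<And>k. k \<ge> n \<Longrightarrow> \<bar>X k \<omega> - X n \<omega>\<bar> \<le> 1 / Suc j" using small by blast
      have "dist (X k \<omega>) (X l \<omega>) < e" if "k \<ge> n" "l \<ge> n" for k l
        using n[OF that(1)] n[OF that(2)] j unfolding dist_real_def by linarith
      then show "\<exists>M. \<forall>m\<ge>M. \<forall>n\<ge>M. dist (X m \<omega>) (X n \<omega>) < e" by blast
    qed
    then show "convergent (\<lambda>n. X n \<omega>)" by (simp add: Cauchy_convergent_iff)
  qed
qed

end

declare X_measurable [measurable del]

text \<open>Adding the constant \<open>C\<close> turns \<open>D\<close> into a density; two finite measures that agree on cylinders
  are equal.\<close>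
lemma AE_zero_if_orthogonal_to_adapted:
  fixes D :: "_ \<Rightarrow> real"
  assumes D[measurable]: "D \<in> borel_measurable S" and bound: "\<And>\<omega>. \<omega> \<in> space S \<Longrightarrow> \<bar>D \<omega>\<bar> \<le> C"
    and orth: "\<And>n A. A \<in> sets S \<Longrightarrow> adapted n (indicator A) \<Longrightarrow> (\<integral>\<omega>. indicator A \<omega> * D \<omega> \<partial>S) = 0"
  shows "AE \<omega> in S. D \<omega> = 0"
proof -
  have iD: "integrable S (\<lambda>\<omega>. indicator A \<omega> * D \<omega>)" if [measurable]: "A \<in> sets S" for A
    using bound by (intro P.integrable_bounded[where B=C]) (auto simp: indicator_def intro: order_trans[OF abs_ge_zero])
  have iC: "integrable S (\<lambda>\<omega>. indicator A \<omega> * C)" if [measurable]: "A \<in> sets S" for A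
    by (intro P.integrable_bounded[where B="\<bar>C\<bar>"]) (auto simp: indicator_def)
  have pos: "0 \<le> D \<omega> + C" "0 \<le> C" if "\<omega> \<in> space S" for \<omega> using bound[OF that] by linarith+
  have nn: "emeasure (density S (\<lambda>\<omega>. ennreal (f \<omega>))) A = ennreal (\<integral>\<omega>. indicator A \<omega> * f \<omega> \<partial>S)"
    if [measurable]: "A \<in> sets S" "f \<in> borel_measurable S" and f: "\<And>\<omega>. \<omega> \<in> space S \<Longrightarrow> 0 \<le> f \<omega>"
      "integrable S (\<lambda>\<omega>. indicator A \<omega> * f \<omega>)" for A f
  proof -
    have "emeasure (density S (\<lambda>\<omega>. ennreal (f \<omega>))) A = (\<integral>\<^sup>+\<omega>. ennreal (indicator A \<omega> * f \<omega>) \<partial>S)"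
      by (subst emeasure_density) (auto intro!: nn_integral_cong simp: indicator_def)
    also have "\<dots> = ennreal (\<integral>\<omega>. indicator A \<omega> * f \<omega> \<partial>S)"
      using f by (intro nn_integral_eq_integral) auto
    finally show ?thesis .
  qed
  have "density S (\<lambda>\<omega>. ennreal (D \<omega> + C)) = density S (\<lambda>\<omega>. ennreal C)"
  proof (rule measure_eqI_PiM_infinite)
    have "emeasure (density S (\<lambda>\<omega>. ennreal (D \<omega> + C))) (space S) \<noteq> \<infinity>"
      using pos iD[OF sets.top] iC[OF sets.top] by (subst nn) (auto simp: distrib_left)
    then show "finite_measure (density S (\<lambda>\<omega>. ennreal (D \<omega> + C)))"
      by (intro finite_measureI) simp
    fix A and J :: "nat set" assume J: "finite J" "J \<subseteq> UNIV" and A: "\<And>i. i \<in> J \<Longrightarrow> A i \<in> sets M"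
    let ?A = "prod_emb UNIV (\<lambda>_. M) J (Pi\<^sub>E J A)"
    have m: "?A \<in> sets S" using J A by (intro sets_PiM_I) auto
    obtain n where n: "J \<subseteq> {..<n}" using J(1) finite_nat_iff_bounded by blast
    have "adapted n (indicator ?A)"
      unfolding adapted_def
    proof (intro conjI ballI impI)
      fix \<omega> \<omega>' assume w: "\<omega> \<in> space S" "\<omega>' \<in> space S" "\<forall>i<n. \<omega> i = \<omega>' i"
      then have eq: "restrict \<omega> J = restrict \<omega>' J" using n by (intro restrict_ext) auto
      have "\<omega> \<in> ?A \<longleftrightarrow> \<omega>' \<in> ?A" using w(1,2) unfolding prod_emb_def space_PiM by (simp add: eq)
      then show "indicator ?A \<omega> = (indicator ?A \<omega>' :: real)" by (simp add: indicator_def)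
    qed (use m in measurable)
    then have "(\<integral>\<omega>. indicator ?A \<omega> * D \<omega> \<partial>S) = 0" using orth m by blast
    then have "(\<integral>\<omega>. indicator ?A \<omega> * (D \<omega> + C) \<partial>S) = (\<integral>\<omega>. indicator ?A \<omega> * C \<partial>S)"
      using iD[OF m] iC[OF m] unfolding distrib_left by simp
    then show "emeasure (density S (\<lambda>\<omega>. ennreal (D \<omega> + C))) ?A = emeasure (density S (\<lambda>\<omega>. ennreal C)) ?A"
      using m pos iD[OF m] iC[OF m] by (subst (1 2) nn) (auto simp: distrib_left)
  qed simp_all
  then have "AE \<omega> in S. ennreal (D \<omega> + C) = ennreal C"
    by (intro P.density_unique) auto
  then show ?thesis
  proof (rule AE_mp, intro AE_I2 impI)
    fix \<omega> assume "\<omega> \<in> space S" "ennreal (D \<omega> + C) = ennreal C"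
    then show "D \<omega> = 0" using pos[of \<omega>] by simp
  qed
qed

text \<open>Levy's zero-one law. The conditional expectations of \<open>H\<close> form a bounded martingale, and its limit
  has the same integral as \<open>H\<close> over every set that depends on finitely many coordinates. As these
  sets generate the product measurable structure, the limit is \<open>H\<close>.\<close>
theorem levy:
  fixes H :: "_ \<Rightarrow> real"
  assumes H[measurable]: "H \<in> borel_measurable S" and bound: "\<And>\<omega>. \<omega> \<in> space S \<Longrightarrow> \<bar>H \<omega>\<bar> \<le> B"
  shows "AE \<omega> in S. (\<lambda>n. \<integral>\<omega>'. H (comb_seq n \<omega> \<omega>') \<partial>S) \<longlonglongrightarrow> H \<omega>"
proof -
  define X where "X n \<omega> = (\<integral>\<omega>'. H (comb_seq n \<omega> \<omega>') \<partial>S)" for n \<omega>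
  have Xm: "X n \<in> borel_measurable S" for n
    unfolding X_def by (rule P.borel_measurable_lebesgue_integral) (simp add: case_prod_beta')
  have Xb: "\<bar>X n \<omega>\<bar> \<le> B" if "\<omega> \<in> space S" for n \<omega>
    unfolding X_def using that bound comb_seq_space measurable_comb_seq_right[OF that]
    by (intro P.abs_integral_le) auto
  have "bounded_martingale X B"
    unfolding bounded_martingale_def
  proof (intro conjI allI ballI)
    show "adapted n (X n)" for n
      unfolding adapted_def
    proof (intro conjI ballI impI Xm)
      fix \<omega> \<omega>' :: "nat \<Rightarrow> 'a" assume "\<forall>i<n. \<omega> i = \<omega>' i"
      then have "comb_seq n \<omega> = comb_seq n \<omega>'" by (auto simp: comb_seq_def fun_eq_iff)
      then show "X n \<omega> = X n \<omega>'" by (simp add: X_def)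
    qed
    fix n j \<omega> assume w: "\<omega> \<in> space S"
    show "\<bar>X n \<omega>\<bar> \<le> B" by (rule Xb[OF w])
    have "(\<integral>\<omega>'. X (n + j) (comb_seq n \<omega> \<omega>') \<partial>S) = (\<integral>\<omega>'. (\<integral>\<omega>''. H (comb_seq n \<omega> (comb_seq j \<omega>' \<omega>'')) \<partial>S) \<partial>S)"
      by (simp add: X_def comb_seq_comb_seq)
    also have "\<dots> = X n \<omega>"
      unfolding X_def using w bound comb_seq_space measurable_comb_seq_right[OF w]
      by (intro integral_comb_seq[symmetric]) auto
    finally show "(\<integral>\<omega>'. X (n + j) (comb_seq n \<omega> \<omega>') \<partial>S) = X n \<omega>" .
  qed
  then have conv: "AE \<omega> in S. convergent (\<lambda>n. X n \<omega>)" by (rule martingale_convergence)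
  define Y where "Y \<omega> = (if convergent (\<lambda>n. X n \<omega>) then Topological_Spaces.lim (\<lambda>n. X n \<omega>) else 0)" for \<omega>
  note Xm[measurable]
  have [measurable]: "Y \<in> borel_measurable S"
    unfolding Y_def Cauchy_convergent_iff[symmetric] by measurable
  have XY: "AE \<omega> in S. (\<lambda>n. X n \<omega>) \<longlonglongrightarrow> Y \<omega>"
    using conv by (rule AE_mp) (auto simp: Y_def convergent_LIMSEQ_iff)
  have Yb: "\<bar>Y \<omega>\<bar> \<le> B" if w: "\<omega> \<in> space S" for \<omega>
  proof (cases "convergent (\<lambda>n. X n \<omega>)")
    case True
    then have "(\<lambda>n. X n \<omega>) \<longlonglongrightarrow> Y \<omega>" by (simp add: Y_def convergent_LIMSEQ_iff)
    then have "(\<lambda>n. \<bar>X n \<omega>\<bar>) \<longlonglongrightarrow> \<bar>Y \<omega>\<bar>" by (rule tendsto_rabs)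
    then show ?thesis using Xb[OF w] by (intro LIMSEQ_le_const2) auto
  qed (use Xb[OF w, of 0] in \<open>simp add: Y_def\<close>)
  have "AE \<omega> in S. Y \<omega> - H \<omega> = 0"
  proof (rule AE_zero_if_orthogonal_to_adapted)
    show "\<bar>Y \<omega> - H \<omega>\<bar> \<le> 2 * B" if "\<omega> \<in> space S" for \<omega>
      using Yb[OF that] bound[OF that] by linarith
    fix n A assume [measurable]: "A \<in> sets S" and A: "adapted n (indicator A)"
    let ?I = "indicator A :: _ \<Rightarrow> real"
    have "(\<lambda>k. \<integral>\<omega>. ?I \<omega> * X k \<omega> \<partial>S) \<longlonglongrightarrow> (\<integral>\<omega>. ?I \<omega> * Y \<omega> \<partial>S)"
    proof (rule integral_dominated_convergence[where w="\<lambda>_. B"])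
      show "AE \<omega> in S. (\<lambda>k. ?I \<omega> * X k \<omega>) \<longlonglongrightarrow> ?I \<omega> * Y \<omega>"
        using XY by (rule AE_mp) (auto intro!: AE_I2 tendsto_mult_left)
      show "AE \<omega> in S. norm (?I \<omega> * X k \<omega>) \<le> B" for k
        using Xb[of _ k] by (intro AE_I2) (force simp: indicator_def intro: order_trans[OF abs_ge_zero])
    qed auto
    moreover have "(\<integral>\<omega>. ?I \<omega> * X k \<omega> \<partial>S) = (\<integral>\<omega>. ?I \<omega> * H \<omega> \<partial>S)" if "k \<ge> n" for k
      unfolding X_def
      by (rule integral_adapted_times[where C=1, OF adapted_mono[OF A that] _ H bound, symmetric])
        (simp_all add: indicator_def)
    then have "(\<lambda>k. \<integral>\<omega>. ?I \<omega> * X k \<omega> \<partial>S) \<longlonglongrightarrow> (\<integral>\<omega>. ?I \<omega> * H \<omega> \<partial>S)"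
      by (intro tendsto_eventually) (auto simp: eventually_sequentially)
    ultimately have eq: "(\<integral>\<omega>. ?I \<omega> * Y \<omega> \<partial>S) = (\<integral>\<omega>. ?I \<omega> * H \<omega> \<partial>S)" by (rule LIMSEQ_unique)
    have i: "integrable S (\<lambda>\<omega>. ?I \<omega> * f \<omega>)" if [measurable]: "f \<in> borel_measurable S"
      and "\<And>\<omega>. \<omega> \<in> space S \<Longrightarrow> \<bar>f \<omega>\<bar> \<le> B" for f
      using that(2) by (intro P.integrable_bounded[where B=B])
        (force simp: indicator_def intro: order_trans[OF abs_ge_zero])+
    show "(\<integral>\<omega>. ?I \<omega> * (Y \<omega> - H \<omega>) \<partial>S) = 0"
      using i[of Y] i[of H] Yb bound by (simp add: right_diff_distrib eq)
  qed measurable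
  with XY show ?thesis unfolding X_def by eventually_elim simp
qed

end

section \<open>Conditional measures of stationary measures\<close>

lemma integral_bind_bounded:
  fixes f :: "'b \<Rightarrow> real"
  assumes N: "prob_space N" and K[measurable]: "K \<in> N \<rightarrow>\<^sub>M prob_algebra R"
    and f[measurable]: "f \<in> borel_measurable R" and B: "\<And>x. x \<in> space R \<Longrightarrow> \<bar>f x\<bar> \<le> B"
  shows "(\<integral>x. f x \<partial>bind N K) = (\<integral>y. (\<integral>x. f x \<partial>K y) \<partial>N)"
proof -
  interpret N: prob_space N by (rule N)
  have K': "K \<in> N \<rightarrow>\<^sub>M subprob_algebra R" using K by (rule measurable_prob_algebraD)
  have Ky: "prob_space (K y)" "sets (K y) = sets R" "space (K y) = space R" if "y \<in> space N" for y
    using measurable_space[OF K that] by (auto simp: space_prob_algebra dest: sets_eq_imp_space_eq)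
  have NK: "N \<in> space (prob_algebra N)" using N by (simp add: space_prob_algebra)
  have bN: "prob_space (bind N K)" "sets (bind N K) = sets R"
    using prob_space_bind'[OF NK K] sets_bind'[OF NK K] by auto
  then have sb: "space (bind N K) = space R" by (auto dest: sets_eq_imp_space_eq)
  define g where "g x = f x + B" for x
  have g[measurable]: "g \<in> borel_measurable R" unfolding g_def by measurable
  have g0: "0 \<le> g x" "\<bar>g x\<bar> \<le> 2 * B" "\<bar>f x\<bar> \<le> B" if "x \<in> space R" for x
    using B[OF that] by (auto simp: g_def)
  have ig: "integrable Q g" "integrable Q f" if "prob_space Q" "sets Q = sets R" for Q
  proof -
    have "space Q = space R" using that(2) by (rule sets_eq_imp_space_eq)
    then show "integrable Q g" "integrable Q f"
      using g f g0 that by (auto intro!: prob_space.integrable_bounded cong: measurable_cong_sets)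
  qed
  have "(\<lambda>y. \<integral>x. g x \<partial>K y) \<in> borel_measurable N"
    by (rule measurable_compose[OF K' integral_measurable_subprob_algebra[OF g]])
  moreover have gK: "0 \<le> (\<integral>x. g x \<partial>K y)" "\<bar>\<integral>x. g x \<partial>K y\<bar> \<le> 2 * B" if "y \<in> space N" for y
  proof -
    show "0 \<le> (\<integral>x. g x \<partial>K y)" using Ky[OF that] g0 by (intro integral_nonneg_AE AE_I2) auto
    show "\<bar>\<integral>x. g x \<partial>K y\<bar> \<le> 2 * B"
      using Ky[OF that] g0 g by (intro prob_space.abs_integral_le) (auto cong: measurable_cong_sets)
  qed
  ultimately have iN: "integrable N (\<lambda>y. \<integral>x. g x \<partial>K y)" by (intro N.integrable_bounded[where B="2 * B"])
  have "ennreal (\<integral>x. g x \<partial>bind N K) = (\<integral>\<^sup>+x. ennreal (g x) \<partial>bind N K)"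
    using ig bN g0 sb by (intro nn_integral_eq_integral[symmetric] AE_I2) auto
  also have "\<dots> = (\<integral>\<^sup>+y. \<integral>\<^sup>+x. ennreal (g x) \<partial>K y \<partial>N)"
    by (rule nn_integral_bind[OF _ K']) measurable
  also have "\<dots> = (\<integral>\<^sup>+y. ennreal (\<integral>x. g x \<partial>K y) \<partial>N)"
    using ig Ky g0 by (intro nn_integral_cong nn_integral_eq_integral AE_I2) auto
  also have "\<dots> = ennreal (\<integral>y. (\<integral>x. g x \<partial>K y) \<partial>N)"
    using iN gK by (intro nn_integral_eq_integral AE_I2) auto
  finally have "(\<integral>x. g x \<partial>bind N K) = (\<integral>y. (\<integral>x. g x \<partial>K y) \<partial>N)"
    using g0 gK sb by (subst (asm) ennreal_inj) (auto intro!: integral_nonneg_AE)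
  moreover have gf: "(\<integral>x. g x \<partial>Q) = (\<integral>x. f x \<partial>Q) + B" if "prob_space Q" "sets Q = sets R" for Q
  proof -
    interpret Q: prob_space Q by fact
    show ?thesis using ig[OF that] by (simp add: g_def Q.prob_space)
  qed
  moreover have "(\<integral>y. (\<integral>x. g x \<partial>K y) \<partial>N) = (\<integral>y. (\<integral>x. f x \<partial>K y) + B \<partial>N)"
    using gf Ky by (intro Bochner_Integration.integral_cong) auto
  moreover have "\<dots> = (\<integral>y. (\<integral>x. f x \<partial>K y) \<partial>N) + B"
  proof -
    have "integrable N (\<lambda>y. (\<integral>x. g x \<partial>K y) - B)" using iN by simp
    then have "integrable N (\<lambda>y. \<integral>x. f x \<partial>K y)"
      using gf Ky by (subst Bochner_Integration.integrable_cong[OF refl]) auto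
    then show ?thesis by (simp add: N.prob_space)
  qed
  ultimately show ?thesis using gf[OF bN] by simp
qed

context compact_metrizable
begin

lemma bind_prob_measures:
  assumes N: "prob_space N" and K: "K \<in> N \<rightarrow>\<^sub>M prob_algebra (borel_of T)"
  shows "bind N K \<in> prob_measures T"
proof -
  have "N \<in> space (prob_algebra N)" using N by (simp add: space_prob_algebra)
  then show ?thesis using prob_space_bind'[OF _ K] sets_bind'[OF _ K] by (auto simp: prob_measures_iff)
qed

lemma integral_bind_continuous:
  assumes N: "prob_space N" and K: "K \<in> N \<rightarrow>\<^sub>M prob_algebra (borel_of T)"
    and f: "continuous_map T euclideanreal f"
  shows "(\<integral>x. f x \<partial>bind N K) = (\<integral>y. (\<integral>x. f x \<partial>K y) \<partial>N)"
proof -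
  obtain B where "\<And>x. x \<in> topspace T \<Longrightarrow> \<bar>f x\<bar> \<le> B" using continuous_bounded[OF f] by blast
  then show ?thesis
    using integral_bind_bounded[OF N K borel_measurable_continuous_map[OF f], of B] by simp
qed

text \<open>The mixture gives measure zero to the complement of \<open>y\<close>, hence so do both components.\<close>
lemma dirac_extreme:
  assumes \<alpha>: "\<alpha> \<in> prob_measures T" and \<beta>: "\<beta> \<in> prob_measures T" and y: "y \<in> topspace T"
    and t: "0 < t" "t < (1::real)"
    and mix: "\<And>f. continuous_map T euclideanreal f \<Longrightarrow> t * (\<integral>x. f x \<partial>\<alpha>) + (1 - t) * (\<integral>x. f x \<partial>\<beta>) = f y"
  shows "\<alpha> = return (borel_of T) y" "\<beta> = return (borel_of T) y"
proof -
  have "closedin T {y}"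
    using y metrizable_imp_t1_space[OF metrizable] by (simp add: closedin_t1_singleton)
  then have U: "openin T (topspace T - {y})" by blast
  obtain u where u: "\<And>n. continuous_map T euclideanreal (u n)"
      "\<And>n x. x \<in> topspace T \<Longrightarrow> 0 \<le> u n x \<and> u n x \<le> (1::real)"
      "\<And>x. x \<in> topspace T \<Longrightarrow> (\<lambda>n. u n x) \<longlonglongrightarrow> indicator (topspace T - {y}) x"
    using open_approx[OF U] by blast
  have "(\<lambda>n. t * (\<integral>x. u n x \<partial>\<alpha>) + (1 - t) * (\<integral>x. u n x \<partial>\<beta>)) \<longlonglongrightarrow>
      t * measure \<alpha> (topspace T - {y}) + (1 - t) * measure \<beta> (topspace T - {y})"
    by (intro tendsto_intros measure_open_tendsto[OF \<alpha> U u] measure_open_tendsto[OF \<beta> U u])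
  moreover have "(\<lambda>n. t * (\<integral>x. u n x \<partial>\<alpha>) + (1 - t) * (\<integral>x. u n x \<partial>\<beta>)) \<longlonglongrightarrow> 0"
    using u(3)[OF y] by (simp add: mix[OF u(1)])
  ultimately have eq: "t * measure \<alpha> (topspace T - {y}) + (1 - t) * measure \<beta> (topspace T - {y}) = 0"
    by (rule LIMSEQ_unique)
  have "0 \<le> t * measure \<alpha> (topspace T - {y})" "0 \<le> (1 - t) * measure \<beta> (topspace T - {y})"
    using t by auto
  with eq have "t * measure \<alpha> (topspace T - {y}) = 0" "(1 - t) * measure \<beta> (topspace T - {y}) = 0"
    by linarith+
  then have 0: "measure \<alpha> (topspace T - {y}) = 0" "measure \<beta> (topspace T - {y}) = 0"
    using t by auto
  have "\<gamma> = return (borel_of T) y"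
    if \<gamma>: "\<gamma> \<in> prob_measures T" and 0: "measure \<gamma> (topspace T - {y}) = 0" for \<gamma>
  proof (rule prob_measures_eqI[OF \<gamma> return_prob_measures[OF y]])
    interpret prob_space \<gamma> using \<gamma> by (simp add: prob_measures_iff)
    fix f assume f: "continuous_map T euclideanreal f"
    have "topspace T - {y} \<in> null_sets \<gamma>"
      using 0 openin_sets_borel_of[OF U] \<gamma> by (auto simp: null_sets_def emeasure_eq_measure prob_measures_iff)
    then have "AE x in \<gamma>. x = y"
      using prob_measures_space[OF \<gamma>] by (intro AE_I'[of "topspace T - {y}"]) auto
    then have "(\<integral>x. f x \<partial>\<gamma>) = (\<integral>x. f y \<partial>\<gamma>)"
      using integrable_continuous[OF \<gamma> f] by (intro integral_cong_AE) auto
    then show "(\<integral>x. f x \<partial>\<gamma>) = (\<integral>x. f x \<partial>return (borel_of T) y)"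
      using y borel_measurable_continuous_map[OF f] by (simp add: prob_space integral_return)
  qed
  then show "\<alpha> = return (borel_of T) y" "\<beta> = return (borel_of T) y" using \<alpha> \<beta> 0 by auto
qed

end

lemma second_countable_euclidean: "second_countable (euclidean :: 'a::second_countable_topology topology)"
proof -
  obtain B :: "'a set set" where B: "countable B" "topological_basis B" using ex_countable_basis by blast
  show ?thesis
    unfolding second_countable_def
  proof (rule exI[of _ B], rule conjI[OF B(1)], rule conjI)
    show "\<forall>V\<in>B. openin euclidean V"
    proof
      fix V :: "'a set" assume "V \<in> B"
      from topological_basis_open[OF B(2) this] show "openin euclidean V" by simp
    qed
    show "\<forall>U x. openin euclidean U \<and> x \<in> U \<longrightarrow> (\<exists>V\<in>B. x \<in> V \<and> V \<subseteq> U)"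
    proof (intro allI impI, elim conjE)
      fix U :: "'a set" and x assume "openin euclidean U" "x \<in> U"
      then have "open U" "x \<in> U" by simp_all
      from topological_basisE[OF B(2) this] obtain V where "V \<in> B" "x \<in> V" "V \<subseteq> U" .
      then show "\<exists>V\<in>B. x \<in> V \<and> V \<subseteq> U" by (intro bexI conjI)
    qed
  qed
qed

lemma measurable_walk:
  fixes m :: "'g::{topological_group_add, second_countable_topology} measure"
  assumes m: "sets m = sets borel"
  shows "(\<lambda>\<omega>. walk \<omega> n) \<in> borel_measurable (PiM UNIV (\<lambda>_::nat. m))"
proof (induction n)
  case (Suc n)
  have "(\<lambda>\<omega>. \<omega> n) \<in> PiM UNIV (\<lambda>_::nat. m) \<rightarrow>\<^sub>M m" by (rule measurable_component_singleton) simp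
  then have "(\<lambda>\<omega>. \<omega> n) \<in> borel_measurable (PiM UNIV (\<lambda>_::nat. m))" 
    unfolding measurable_cong_sets[OF refl m] .
  from borel_measurable_add[OF Suc this] show ?case unfolding walk.simps .
qed (simp only: walk.simps measurable_const space_borel UNIV_I)

lemma walk_cong: "(\<And>i. i < n \<Longrightarrow> \<omega> i = \<omega>' i) \<Longrightarrow> walk \<omega> n = walk \<omega>' n"
proof (induction n)
  case (Suc n)
  have "walk \<omega> n = walk \<omega>' n" by (rule Suc.IH) (rule Suc.prems, simp)
  moreover have "\<omega> n = \<omega>' n" by (rule Suc.prems) simp
  ultimately show ?case by simp
qed simp

lemma walk_comb_seq: "walk (comb_seq n \<omega> \<omega>') (n + j) = walk \<omega> n + walk \<omega>' j"
proof (induction j)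
  case 0
  have "walk (comb_seq n \<omega> \<omega>') n = walk \<omega> n" by (rule walk_cong) (rule comb_seq_less)
  then show ?case by simp
next
  case (Suc j) then show ?case by (simp add: comb_seq_def add.assoc)
qed

locale gspace =
  fixes m :: "'g::{topological_group_add, second_countable_topology} measure" and X :: "('g, 'a) gsystem"
  assumes gspace: "compact_metric_gspace X" and prob_m: "prob_space m" and sets_m: "sets m = sets borel"
begin

abbreviation "T \<equiv> points X"

sublocale compact_metrizable T
  using gspace by unfold_locales (auto simp: compact_metric_gspace_def)

sublocale W: sequence_space m
proof -
  interpret prob_space m by (rule prob_m)
  show "sequence_space m" by unfold_locales
qed

lemma path_measure: "path_measure m = W.S" by (simp add: path_measure_def)

lemma act_continuous2: "continuous_map (prod_topology euclidean T) T (\<lambda>(g, x). act X g x)"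
  and act_0: "x \<in> topspace T \<Longrightarrow> act X 0 x = x"
  and act_add: "x \<in> topspace T \<Longrightarrow> act X (g + h) x = act X g (act X h x)"
  using gspace unfolding compact_metric_gspace_def by blast+

lemma act_continuous: "continuous_map T T (act X g)"
proof -
  have "continuous_map T (prod_topology euclidean T) (\<lambda>x. (g, x))"
    by (simp add: continuous_map_pairedI)
  from continuous_map_compose[OF this act_continuous2] show ?thesis by (simp add: o_def)
qed

lemma act_topspace: "x \<in> topspace T \<Longrightarrow> act X g x \<in> topspace T"
  using act_continuous by (auto simp: continuous_map_def)

lemma measurable_act2: "(\<lambda>(g, x). act X g x) \<in> borel \<Otimes>\<^sub>M borel_of T \<rightarrow>\<^sub>M borel_of T"
  using measurable_continuous_map[OF act_continuous2]
  by (simp add: sets_borel_of_prod[OF second_countable_euclidean second_countable] cong: measurable_cong_sets)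

lemma translate_prob_measures: "\<mu> \<in> prob_measures T \<Longrightarrow> translate X g \<mu> \<in> prob_measures T"
  unfolding translate_def by (rule distr_prob_measures[OF _ measurable_continuous_map[OF act_continuous]])

lemma integral_translate:
  "\<mu> \<in> prob_measures T \<Longrightarrow> continuous_map T euclideanreal f \<Longrightarrow>
     (\<integral>x. f x \<partial>translate X g \<mu>) = (\<integral>x. f (act X g x) \<partial>\<mu>)"
  unfolding translate_def by (rule integral_distr_continuous[OF _ act_continuous])

lemma continuous_act_compose:
  "continuous_map T euclideanreal f \<Longrightarrow> continuous_map T euclideanreal (\<lambda>x. f (act X g x))"
  using continuous_map_compose[OF act_continuous] by (simp add: o_def)

lemma translate_0:
  assumes "\<mu> \<in> prob_measures T" shows "translate X 0 \<mu> = \<mu>"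
proof (rule prob_measures_eqI[OF translate_prob_measures[OF assms] assms])
  fix f assume f: "continuous_map T euclideanreal f"
  show "(\<integral>x. f x \<partial>translate X 0 \<mu>) = (\<integral>x. f x \<partial>\<mu>)"
    unfolding integral_translate[OF assms f]
    by (intro Bochner_Integration.integral_cong) (simp_all add: act_0 prob_measures_space[OF assms])
qed

lemma translate_add:
  assumes "\<mu> \<in> prob_measures T"
  shows "translate X (g + h) \<mu> = translate X g (translate X h \<mu>)"
proof (rule prob_measures_eqI)
  fix f assume f: "continuous_map T euclideanreal f"
  show "(\<integral>x. f x \<partial>translate X (g + h) \<mu>) = (\<integral>x. f x \<partial>translate X g (translate X h \<mu>))"
    using assms f act_add prob_measures_space[OF assms]
    by (auto simp: integral_translate translate_prob_measures continuous_act_compose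
        intro!: Bochner_Integration.integral_cong)
qed (use assms translate_prob_measures in auto)

lemma measurable_translate2:
  "(\<lambda>(g, \<mu>). translate X g \<mu>) \<in> borel \<Otimes>\<^sub>M prob_algebra (borel_of T) \<rightarrow>\<^sub>M prob_algebra (borel_of T)"
proof -
  have a: "(\<lambda>(z, x). act X (fst z) x) \<in> (borel \<Otimes>\<^sub>M prob_algebra (borel_of T)) \<Otimes>\<^sub>M borel_of T \<rightarrow>\<^sub>M borel_of T"
  proof -
    have "(\<lambda>z. (fst (fst z), snd z)) \<in> (borel \<Otimes>\<^sub>M prob_algebra (borel_of T)) \<Otimes>\<^sub>M borel_of T \<rightarrow>\<^sub>M borel \<Otimes>\<^sub>M borel_of T"
      by measurable
    from measurable_compose[OF this measurable_act2] show ?thesis by (simp add: case_prod_beta')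
  qed
  show ?thesis
    using measurable_distr_prob_space2[OF measurable_snd a]
    by (simp add: translate_def case_prod_beta')
qed

lemma measurable_translate:
  "h \<in> N \<rightarrow>\<^sub>M borel \<Longrightarrow> K \<in> N \<rightarrow>\<^sub>M prob_algebra (borel_of T) \<Longrightarrow>
     (\<lambda>y. translate X (h y) (K y)) \<in> N \<rightarrow>\<^sub>M prob_algebra (borel_of T)"
  using measurable_compose[OF measurable_Pair measurable_translate2] by simp

text \<open>Joint continuity: by compactness of the space, \<open>f(g x)\<close> is uniformly close to
  \<open>f(g\<^sub>0 x)\<close> for \<open>g\<close> close to \<open>g\<^sub>0\<close>.\<close>
lemma continuous_translate2:
  "continuous_map (prod_topology euclidean (weak_star T)) (weak_star T) (\<lambda>(g, \<mu>). translate X g \<mu>)"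
proof (rule continuous_map_into_weak_star)
  fix f assume f: "continuous_map T euclideanreal f"
  let ?P = "prod_topology (euclidean :: 'g topology) (weak_star T)"
  let ?\<phi> = "\<lambda>z::'g \<times> 'a measure. \<integral>x. f (act X (fst z) x) \<partial>snd z"
  have "continuous_map ?P euclideanreal ?\<phi>"
    unfolding continuous_map_def
  proof (intro conjI allI impI)
    fix U :: "real set" assume U: "openin euclideanreal U"
    show "openin ?P {z \<in> topspace ?P. ?\<phi> z \<in> U}"
    proof (subst openin_subopen, intro ballI)
      fix z0 assume z0: "z0 \<in> {z \<in> topspace ?P. ?\<phi> z \<in> U}"
      obtain g0 \<mu>0 where z0_eq: "z0 = (g0, \<mu>0)" by (cases z0)
      have \<mu>0: "\<mu>0 \<in> prob_measures T" using z0 by (auto simp: z0_eq)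
      obtain e where e: "0 < e" "\<And>r. \<bar>r - ?\<phi> z0\<bar> < e \<Longrightarrow> r \<in> U"
        using U z0 unfolding open_openin[symmetric] open_dist dist_real_def by blast
      let ?d = "\<lambda>p. f (act X (fst p) (snd p)) - f (act X g0 (snd p))"
      have dc: "continuous_map (prod_topology euclidean T) euclideanreal ?d"
      proof (intro continuous_intros)
        show "continuous_map (prod_topology euclidean T) euclideanreal (\<lambda>p. f (act X (fst p) (snd p)))"
          using continuous_map_compose[OF act_continuous2 f] by (simp add: o_def case_prod_beta')
        show "continuous_map (prod_topology euclidean T) euclideanreal (\<lambda>p. f (act X g0 (snd p)))"
          using continuous_map_compose[OF continuous_map_snd continuous_act_compose[OF f]]
          by (simp add: o_def)
      qed
      define Q where "Q = {p \<in> topspace (prod_topology euclidean T). ?d p \<in> {- (e/2)<..<e/2}}"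
      have "openin (prod_topology euclidean T) Q"
        unfolding Q_def by (rule openin_continuous_map_preimage[OF dc]) simp
      moreover have "compactin T (topspace T)" using compact by (simp add: compact_space_def)
      moreover have "{g0} \<times> topspace T \<subseteq> Q" using e(1) by (auto simp: Q_def)
      ultimately obtain V V' where V: "openin euclidean V" "g0 \<in> V" "topspace T \<subseteq> V'" "V \<times> V' \<subseteq> Q"
        using tube_lemma_right[of euclidean T Q "topspace T" g0] by auto
      have close: "\<bar>f (act X g x) - f (act X g0 x)\<bar> \<le> e / 2" if "g \<in> V" "x \<in> topspace T" for g x
      proof -
        have "(g, x) \<in> Q" using V(3,4) that by blast
        then have "?d (g, x) \<in> {- (e/2)<..<e/2}" unfolding Q_def by blast
        then show ?thesis unfolding greaterThanLessThan_iff fst_conv snd_conv by linarith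
      qed
      let ?N = "{\<mu> \<in> topspace (weak_star T). (\<integral>x. f (act X g0 x) \<partial>\<mu>) \<in> {?\<phi> z0 - e/2<..<?\<phi> z0 + e/2}}"
      have "openin (weak_star T) ?N"
        by (rule openin_continuous_map_preimage[OF continuous_map_integral[OF continuous_act_compose[OF f]]]) simp
      then have "openin ?P (V \<times> ?N)" using V(1) by (simp add: openin_prod_Times_iff)
      moreover have "z0 \<in> V \<times> ?N" using V(2) \<mu>0 e(1) by (simp add: z0_eq)
      moreover have "V \<times> ?N \<subseteq> {z \<in> topspace ?P. ?\<phi> z \<in> U}"
      proof (rule subsetI)
        fix z assume z: "z \<in> V \<times> ?N"
        obtain g \<mu> where z_eq: "z = (g, \<mu>)" by (cases z)
        have "(\<integral>x. f (act X g0 x) \<partial>\<mu>) \<in> {?\<phi> z0 - e/2<..<?\<phi> z0 + e/2}"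
          using z unfolding z_eq by blast
        then have "\<bar>(\<integral>x. f (act X g0 x) \<partial>\<mu>) - ?\<phi> z0\<bar> < e / 2"
          unfolding greaterThanLessThan_iff by linarith
        then have \<mu>: "\<mu> \<in> prob_measures T" "g \<in> V" "\<bar>(\<integral>x. f (act X g0 x) \<partial>\<mu>) - ?\<phi> z0\<bar> < e / 2"
          using z by (simp_all add: z_eq)
        have "\<bar>(\<integral>x. f (act X g x) \<partial>\<mu>) - (\<integral>x. f (act X g0 x) \<partial>\<mu>)\<bar> \<le> e / 2"
          using close[OF \<mu>(2)]
          by (intro integral_uniform_close[OF \<mu>(1)] continuous_act_compose f) auto
        then have "\<bar>?\<phi> z - ?\<phi> z0\<bar> < e" using \<mu>(3) unfolding z_eq fst_conv snd_conv by linarith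
        then show "z \<in> {z \<in> topspace ?P. ?\<phi> z \<in> U}" using e(2) \<mu>(1) by (simp add: z_eq)
      qed
      ultimately show "\<exists>V. openin ?P V \<and> z0 \<in> V \<and> V \<subseteq> {z \<in> topspace ?P. ?\<phi> z \<in> U}"
        by (intro exI[of _ "V \<times> ?N"] conjI)
    qed
  qed simp
  then show "continuous_map ?P euclideanreal (\<lambda>y. \<integral>x. f x \<partial>(case y of (g, \<mu>) \<Rightarrow> translate X g \<mu>))"
    by (rule continuous_map_eq) (auto simp: integral_translate[OF _ f])
qed (auto intro: translate_prob_measures)

end

context compact_metrizable
begin

lemma integral_convex:
  assumes \<mu>: "\<mu> \<in> prob_measures T" "\<mu>1 \<in> prob_measures T" "\<mu>2 \<in> prob_measures T"
    and t: "0 \<le> t" "t \<le> (1::real)"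
    and mix: "\<And>A. A \<in> sets (borel_of T) \<Longrightarrow> measure \<mu> A = t * measure \<mu>1 A + (1 - t) * measure \<mu>2 A"
    and f: "continuous_map T euclideanreal f"
  shows "(\<integral>x. f x \<partial>\<mu>) = t * (\<integral>x. f x \<partial>\<mu>1) + (1 - t) * (\<integral>x. f x \<partial>\<mu>2)"
proof -
  define L where "L f = t * (\<integral>x. f x \<partial>\<mu>1) + (1 - t) * (\<integral>x. f x \<partial>\<mu>2)" for f
  interpret positive_functional T L
  proof unfold_locales
    fix f g assume "continuous_map T euclideanreal f" "continuous_map T euclideanreal g"
    then show "L (\<lambda>x. f x + g x) = L f + L g"
      using \<mu> integrable_continuous unfolding L_def by (simp add: algebra_simps)
  next
    fix f and c :: real assume "continuous_map T euclideanreal f"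
    show "L (\<lambda>x. c * f x) = c * L f" unfolding L_def by (simp add: algebra_simps)
  next
    fix f assume f: "\<And>x. x \<in> topspace T \<Longrightarrow> (0::real) \<le> f x"
    have "0 \<le> (\<integral>x. f x \<partial>\<mu>1)" "0 \<le> (\<integral>x. f x \<partial>\<mu>2)"
      using f prob_measures_space[OF \<mu>(2)] prob_measures_space[OF \<mu>(3)]
      by (auto intro!: integral_nonneg_AE AE_I2)
    then show "0 \<le> L f" using t unfolding L_def by simp
  next
    have "(\<integral>x. (1::real) \<partial>\<mu>1) = 1" "(\<integral>x. (1::real) \<partial>\<mu>2) = 1"
      using \<mu> by (simp_all add: prob_measures_iff prob_space.prob_space)
    then show "L (\<lambda>_. 1) = 1" by (simp add: L_def)
  qed
  have "riesz_measure = \<mu>"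
  proof (rule prob_measures_eqI_open[OF riesz_prob \<mu>(1)])
    fix U assume U: "openin T U"
    obtain u where u: "\<And>n. continuous_map T euclideanreal (u n)"
      "\<And>n x. x \<in> topspace T \<Longrightarrow> 0 \<le> u n x \<and> u n x \<le> (1::real)"
      "\<And>x. x \<in> topspace T \<Longrightarrow> (\<lambda>n. u n x) \<longlonglongrightarrow> indicator U x"
      using open_approx[OF U] by blast
    have "(\<lambda>n. t * (\<integral>x. u n x \<partial>\<mu>1) + (1 - t) * (\<integral>x. u n x \<partial>\<mu>2)) \<longlonglongrightarrow>
        t * measure \<mu>1 U + (1 - t) * measure \<mu>2 U"
      by (intro tendsto_intros measure_open_tendsto[OF \<mu>(2) U u] measure_open_tendsto[OF \<mu>(3) U u])
    moreover have "t * (\<integral>x. u n x \<partial>\<mu>1) + (1 - t) * (\<integral>x. u n x \<partial>\<mu>2) = (\<integral>x. u n x \<partial>riesz_measure)" for n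
      using riesz[OF u(1)[of n]] unfolding L_def .
    ultimately have "(\<lambda>n. \<integral>x. u n x \<partial>riesz_measure) \<longlonglongrightarrow> t * measure \<mu>1 U + (1 - t) * measure \<mu>2 U" by simp
    from LIMSEQ_unique[OF measure_open_tendsto[OF riesz_prob U u] this]
    have "measure riesz_measure U = t * measure \<mu>1 U + (1 - t) * measure \<mu>2 U" .
    then show "measure riesz_measure U = measure \<mu> U" using mix[OF openin_sets_borel_of[OF U]] by simp
  qed
  then show ?thesis using riesz[OF f] by (simp add: L_def)
qed

end

context gspace
begin

text \<open>The form of stationarity that the martingale argument uses; it agrees with \<^const>\<open>stationary\<close>
  because continuous functions determine measures.\<close>
definition is_stationary :: "'a measure \<Rightarrow> bool" where
  "is_stationary \<eta> \<longleftrightarrow> \<eta> \<in> prob_measures T \<and>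
     (\<forall>f. continuous_map T euclideanreal f \<longrightarrow> (\<integral>g. (\<integral>x. f (act X g x) \<partial>\<eta>) \<partial>m) = (\<integral>x. f x \<partial>\<eta>))"

lemma is_stationary_prob: "is_stationary \<eta> \<Longrightarrow> \<eta> \<in> prob_measures T"
  by (simp add: is_stationary_def)

lemma measurable_orbit:
  assumes "\<eta> \<in> prob_measures T"
  shows "(\<lambda>g. translate X g \<eta>) \<in> borel \<rightarrow>\<^sub>M prob_algebra (borel_of T)"
  using assms by (intro measurable_translate measurable_ident_sets[OF refl] measurable_const)

lemma measurable_orbit_m:
  assumes "\<eta> \<in> prob_measures T"
  shows "(\<lambda>g. translate X g \<eta>) \<in> m \<rightarrow>\<^sub>M prob_algebra (borel_of T)"
  using measurable_orbit[OF assms] unfolding measurable_cong_sets[OF sets_m refl] .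

lemma stationary_iff: "stationary m X \<eta> \<longleftrightarrow> is_stationary \<eta>"
proof -
  have "bind m (\<lambda>g. translate X g \<eta>) = \<eta> \<longleftrightarrow>
      (\<forall>f. continuous_map T euclideanreal f \<longrightarrow> (\<integral>g. (\<integral>x. f (act X g x) \<partial>\<eta>) \<partial>m) = (\<integral>x. f x \<partial>\<eta>))"
    if l: "\<eta> \<in> prob_measures T"
  proof -
    have K: "(\<lambda>g. translate X g \<eta>) \<in> m \<rightarrow>\<^sub>M prob_algebra (borel_of T)" by (rule measurable_orbit_m[OF l])
    have i: "(\<integral>x. f x \<partial>bind m (\<lambda>g. translate X g \<eta>)) = (\<integral>g. (\<integral>x. f (act X g x) \<partial>\<eta>) \<partial>m)"
      if f: "continuous_map T euclideanreal f" for f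
      unfolding integral_bind_continuous[OF prob_m K f] integral_translate[OF l f] ..
    show ?thesis
    proof
      assume "bind m (\<lambda>g. translate X g \<eta>) = \<eta>"
      then show "\<forall>f. continuous_map T euclideanreal f \<longrightarrow> (\<integral>g. (\<integral>x. f (act X g x) \<partial>\<eta>) \<partial>m) = (\<integral>x. f x \<partial>\<eta>)"
        using i by simp
    next
      assume r: "\<forall>f. continuous_map T euclideanreal f \<longrightarrow> (\<integral>g. (\<integral>x. f (act X g x) \<partial>\<eta>) \<partial>m) = (\<integral>x. f x \<partial>\<eta>)"
      show "bind m (\<lambda>g. translate X g \<eta>) = \<eta>"
        by (rule prob_measures_eqI[OF bind_prob_measures[OF prob_m K] l]) (simp add: i r)
    qed
  qed
  then show ?thesis unfolding stationary_def is_stationary_def by blast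
qed

text \<open>Conditional measures are studied for all stationary measures on the space, not only for the law
  of the system: the components of a convex decomposition of the law are needed too.\<close>
definition conv_at :: "'a measure \<Rightarrow> (nat \<Rightarrow> 'g) \<Rightarrow> 'a measure \<Rightarrow> bool" where
  "conv_at \<eta> \<omega> \<nu> \<longleftrightarrow> limitin (weak_star T) (\<lambda>n. translate X (walk \<omega> n) \<eta>) \<nu> sequentially"

definition cond :: "'a measure \<Rightarrow> (nat \<Rightarrow> 'g) \<Rightarrow> 'a measure" where
  "cond \<eta> \<omega> = cond_measure (X\<lparr>law := \<eta>\<rparr>) \<omega>"

lemma cond_law: "cond (law X) = cond_measure X"
  by (simp add: cond_def fun_eq_iff)

lemma conv_at_iff:
  assumes "\<eta> \<in> prob_measures T"
  shows "conv_at \<eta> \<omega> \<nu> \<longleftrightarrow> \<nu> \<in> prob_measures T \<and>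
     (\<forall>f. continuous_map T euclideanreal f \<longrightarrow>
        (\<lambda>n. \<integral>x. f (act X (walk \<omega> n) x) \<partial>\<eta>) \<longlonglongrightarrow> (\<integral>x. f x \<partial>\<nu>))"
  unfolding conv_at_def limitin_weak_star
  by (simp add: translate_prob_measures[OF assms] integral_translate[OF assms])

lemma conv_at_unique:
  assumes "conv_at \<eta> \<omega> \<nu>" "conv_at \<eta> \<omega> \<nu>'" shows "\<nu> = \<nu>'"
proof -
  interpret WS: compact_metrizable "weak_star T" by (rule compact_metrizable_weak_star)
  show ?thesis
    using limitin_Hausdorff_unique assms metrizable_imp_Hausdorff_space[OF WS.metrizable]
    unfolding conv_at_def by (metis trivial_limit_sequentially)
qed

lemma cond_eq:
  "cond \<eta> \<omega> = (if \<exists>\<nu>. conv_at \<eta> \<omega> \<nu> then THE \<nu>. conv_at \<eta> \<omega> \<nu> else \<eta>)"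
proof -
  have "cond_limit (X\<lparr>law := \<eta>\<rparr>) \<omega> = conv_at \<eta> \<omega>"
    by (rule ext) (simp add: cond_limit_def conv_at_def translate_def)
  then show ?thesis by (simp add: cond_def cond_measure_def)
qed

lemma cond_eqI: "conv_at \<eta> \<omega> \<nu> \<Longrightarrow> cond \<eta> \<omega> = \<nu>"
  unfolding cond_eq using conv_at_unique by (simp add: the_equality) blast

lemma conv_at_cond: "conv_at \<eta> \<omega> \<nu> \<Longrightarrow> conv_at \<eta> \<omega> (cond \<eta> \<omega>)"
  by (simp add: cond_eqI)

lemma cond_prob_measures:
  assumes "\<eta> \<in> prob_measures T" shows "cond \<eta> \<omega> \<in> prob_measures T"
proof (cases "\<exists>\<nu>. conv_at \<eta> \<omega> \<nu>")
  case True
  then show ?thesis using conv_at_cond conv_at_iff[OF assms] by blast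
next
  case False
  then show ?thesis using assms by (simp add: cond_eq)
qed

text \<open>The walk along a concatenated path is the walk along the tail, multiplied from the left by the
  product of the first \<open>n\<close> increments.\<close>
lemma conv_at_comb_seq:
  assumes l: "\<eta> \<in> prob_measures T" and c: "conv_at \<eta> \<omega>' \<nu>"
  shows "conv_at \<eta> (comb_seq n \<omega> \<omega>') (translate X (walk \<omega> n) \<nu>)"
proof -
  have \<nu>: "\<nu> \<in> prob_measures T" using c conv_at_iff[OF l] by blast
  have "(\<lambda>k. \<integral>x. f (act X (walk (comb_seq n \<omega> \<omega>') k) x) \<partial>\<eta>) \<longlonglongrightarrow> (\<integral>x. f x \<partial>translate X (walk \<omega> n) \<nu>)"
    if f: "continuous_map T euclideanreal f" for f
  proof (rule LIMSEQ_offset[of _ n])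
    let ?f = "\<lambda>x. f (act X (walk \<omega> n) x)"
    have fc: "continuous_map T euclideanreal ?f" by (rule continuous_act_compose[OF f])
    have "(\<lambda>j. \<integral>x. ?f (act X (walk \<omega>' j) x) \<partial>\<eta>) \<longlonglongrightarrow> (\<integral>x. ?f x \<partial>\<nu>)"
      using c fc unfolding conv_at_iff[OF l] by blast
    moreover have "(\<integral>x. ?f (act X (walk \<omega>' j) x) \<partial>\<eta>) = (\<integral>x. f (act X (walk (comb_seq n \<omega> \<omega>') (j + n)) x) \<partial>\<eta>)" for j
      using prob_measures_space[OF l] unfolding add.commute[of j n] walk_comb_seq
      by (intro Bochner_Integration.integral_cong) (simp_all add: act_add)
    ultimately show "(\<lambda>j. \<integral>x. f (act X (walk (comb_seq n \<omega> \<omega>') (j + n)) x) \<partial>\<eta>)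
        \<longlonglongrightarrow> (\<integral>x. f x \<partial>translate X (walk \<omega> n) \<nu>)"
      by (simp add: integral_translate[OF \<nu> f])
  qed
  then show ?thesis unfolding conv_at_iff[OF l] using translate_prob_measures[OF \<nu>] by blast
qed

lemma cond_comb_seq:
  assumes "\<eta> \<in> prob_measures T" "conv_at \<eta> \<omega>' \<nu>"
  shows "cond \<eta> (comb_seq n \<omega> \<omega>') = translate X (walk \<omega> n) (cond \<eta> \<omega>')"
  using conv_at_comb_seq[OF assms(1) conv_at_cond[OF assms(2)]] by (rule cond_eqI)

lemma measurable_walk_S: "(\<lambda>\<omega>. walk \<omega> n) \<in> borel_measurable W.S"
  by (rule measurable_walk[OF sets_m])

lemma measurable_integral_orbit:
  assumes l: "\<eta> \<in> prob_measures T" and f: "continuous_map T euclideanreal f"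
  shows "(\<lambda>g. \<integral>x. f (act X g x) \<partial>\<eta>) \<in> borel_measurable borel"
  using measurable_compose[OF measurable_orbit[OF l] measurable_integral_prob_algebra[OF f]]
  by (simp add: integral_translate[OF l f])

lemma integral_bound:
  assumes l: "\<eta> \<in> prob_measures T" and f: "continuous_map T euclideanreal f"
    and B: "\<And>x. x \<in> topspace T \<Longrightarrow> \<bar>f x\<bar> \<le> B"
  shows "\<bar>\<integral>x. f x \<partial>\<eta>\<bar> \<le> B"
  using integral_uniform_close[OF l f, of "\<lambda>_. 0" B] B by simp

text \<open>The integrals of a fixed function along the random walk form a bounded martingale: this is
  stationarity, iterated.\<close>
lemma integral_walk:
  assumes st: "is_stationary \<eta>"
  shows "continuous_map T euclideanreal f \<Longrightarrow> (\<integral>\<omega>. (\<integral>x. f (act X (walk \<omega> n) x) \<partial>\<eta>) \<partial>W.S) = (\<integral>x. f x \<partial>\<eta>)"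
proof (induction n arbitrary: f)
  note l = is_stationary_prob[OF st]
  case 0
  have "(\<integral>x. f (act X 0 x) \<partial>\<eta>) = (\<integral>x. f x \<partial>\<eta>)"
    using integral_translate[OF l 0, of 0] unfolding translate_0[OF l] by (rule sym)
  then show ?case by (simp add: W.P.prob_space)
next
  note l = is_stationary_prob[OF st]
  case (Suc n)
  let ?h = "\<lambda>g. \<integral>x. f (act X g x) \<partial>\<eta>"
  obtain B where B: "\<And>x. x \<in> topspace T \<Longrightarrow> \<bar>f x\<bar> \<le> B" using continuous_bounded[OF Suc.prems] by blast
  have hB: "\<bar>?h g\<bar> \<le> B" for g
    by (rule integral_bound[OF l continuous_act_compose[OF Suc.prems]]) (rule B, rule act_topspace)
  have hm: "(\<lambda>\<omega>. ?h (walk \<omega> k)) \<in> borel_measurable W.S" for k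
    by (rule measurable_compose[OF measurable_walk_S measurable_integral_orbit[OF l Suc.prems]])
  have "(\<integral>\<omega>. ?h (walk \<omega> (Suc n)) \<partial>W.S) = (\<integral>\<omega>. (\<integral>\<omega>'. ?h (walk (comb_seq 1 \<omega> \<omega>') (1 + n)) \<partial>W.S) \<partial>W.S)"
    using W.integral_comb_seq[OF hm[of "Suc n"] hB, of 1] by simp
  also have "\<dots> = (\<integral>\<omega>. ?h (\<omega> 0) \<partial>W.S)"
  proof (rule Bochner_Integration.integral_cong[OF refl])
    fix \<omega>
    have "(\<integral>\<omega>'. ?h (walk (comb_seq 1 \<omega> \<omega>') (1 + n)) \<partial>W.S)
        = (\<integral>\<omega>'. (\<integral>x. f (act X (\<omega> 0) (act X (walk \<omega>' n) x)) \<partial>\<eta>) \<partial>W.S)"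
      unfolding walk_comb_seq using prob_measures_space[OF l]
      by (intro Bochner_Integration.integral_cong) (simp_all add: act_add)
    also have "\<dots> = ?h (\<omega> 0)" by (rule Suc.IH[OF continuous_act_compose[OF Suc.prems]])
    finally show "(\<integral>\<omega>'. ?h (walk (comb_seq 1 \<omega> \<omega>') (1 + n)) \<partial>W.S) = ?h (\<omega> 0)" .
  qed
  also have "\<dots> = (\<integral>g. ?h g \<partial>distr W.S m (\<lambda>\<omega>. \<omega> 0))"
    using measurable_integral_orbit[OF l Suc.prems] sets_m
    by (subst integral_distr) (auto cong: measurable_cong_sets)
  also have "distr W.S m (\<lambda>\<omega>. \<omega> 0) = m" by (rule W.PiM_component) simp
  also have "(\<integral>g. ?h g \<partial>m) = (\<integral>x. f x \<partial>\<eta>)" using st Suc.prems by (simp add: is_stationary_def)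
  finally show ?case .
qed

lemma bounded_martingale_walk:
  assumes st: "is_stationary \<eta>" and f: "continuous_map T euclideanreal f"
    and B: "\<And>x. x \<in> topspace T \<Longrightarrow> \<bar>f x\<bar> \<le> B"
  shows "W.bounded_martingale (\<lambda>n \<omega>. \<integral>x. f (act X (walk \<omega> n) x) \<partial>\<eta>) B"
  unfolding W.bounded_martingale_def
proof (intro conjI allI ballI)
  note l = is_stationary_prob[OF st]
  show "W.adapted n (\<lambda>\<omega>. \<integral>x. f (act X (walk \<omega> n) x) \<partial>\<eta>)" for n
    unfolding W.adapted_def
  proof (intro conjI ballI impI)
    show "(\<lambda>\<omega>. \<integral>x. f (act X (walk \<omega> n) x) \<partial>\<eta>) \<in> borel_measurable W.S"
      by (rule measurable_compose[OF measurable_walk_S measurable_integral_orbit[OF l f]])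
    fix \<omega> \<omega>' :: "nat \<Rightarrow> 'g" assume "\<forall>i<n. \<omega> i = \<omega>' i"
    then have "walk \<omega> n = walk \<omega>' n" by (intro walk_cong) blast
    then show "(\<integral>x. f (act X (walk \<omega> n) x) \<partial>\<eta>) = (\<integral>x. f (act X (walk \<omega>' n) x) \<partial>\<eta>)" by simp
  qed
  fix n j \<omega>
  show "\<bar>\<integral>x. f (act X (walk \<omega> n) x) \<partial>\<eta>\<bar> \<le> B"
    by (rule integral_bound[OF l continuous_act_compose[OF f]]) (rule B, rule act_topspace)
  have "(\<integral>\<omega>'. (\<integral>x. f (act X (walk (comb_seq n \<omega> \<omega>') (n + j)) x) \<partial>\<eta>) \<partial>W.S)
      = (\<integral>\<omega>'. (\<integral>x. f (act X (walk \<omega> n) (act X (walk \<omega>' j) x)) \<partial>\<eta>) \<partial>W.S)"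
    unfolding walk_comb_seq using prob_measures_space[OF l]
    by (intro Bochner_Integration.integral_cong) (simp_all add: act_add)
  also have "\<dots> = (\<integral>x. f (act X (walk \<omega> n) x) \<partial>\<eta>)"
    by (rule integral_walk[OF st continuous_act_compose[OF f]])
  finally show "(\<integral>\<omega>'. (\<integral>x. f (act X (walk (comb_seq n \<omega> \<omega>') (n + j)) x) \<partial>\<eta>) \<partial>W.S)
      = (\<integral>x. f (act X (walk \<omega> n) x) \<partial>\<eta>)" .
qed

lemma ex_conv_at_iff:
  assumes l: "\<eta> \<in> prob_measures T"
  shows "(\<exists>\<nu>. conv_at \<eta> \<omega> \<nu>) \<longleftrightarrow> (\<forall>i. convergent (\<lambda>n. \<integral>x. dense_seq i (act X (walk \<omega> n) x) \<partial>\<eta>))"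
    (is "?L \<longleftrightarrow> ?R")
proof
  assume ?L
  then show ?R unfolding conv_at_iff[OF l] convergent_def using continuous_dense_seq by blast
next
  assume ?R
  then have "convergent (\<lambda>n. emb (translate X (walk \<omega> n) \<eta>) i)" for i
    by (simp add: emb_def integral_translate[OF l continuous_dense_seq])
  then show ?L unfolding conv_at_def by (intro ex_weak_star_limit translate_prob_measures[OF l])
qed

text \<open>It suffices that the integrals of countably many functions converge, and these are bounded
  martingales.\<close>
theorem AE_conv_at:
  assumes st: "is_stationary \<eta>"
  shows "AE \<omega> in W.S. conv_at \<eta> \<omega> (cond \<eta> \<omega>)"
proof -
  note l = is_stationary_prob[OF st]
  have "AE \<omega> in W.S. convergent (\<lambda>n. \<integral>x. dense_seq i (act X (walk \<omega> n) x) \<partial>\<eta>)" for i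
  proof -
    obtain B where "\<And>x. x \<in> topspace T \<Longrightarrow> \<bar>dense_seq i x\<bar> \<le> B"
      using continuous_bounded[OF continuous_dense_seq] by blast
    from bounded_martingale_walk[OF st continuous_dense_seq this]
    show ?thesis by (rule W.martingale_convergence)
  qed
  then have "AE \<omega> in W.S. \<forall>i. convergent (\<lambda>n. \<integral>x. dense_seq i (act X (walk \<omega> n) x) \<partial>\<eta>)"
    by (simp add: AE_all_countable)
  then show ?thesis
    unfolding ex_conv_at_iff[OF l, symmetric] by (rule AE_mp) (auto intro!: AE_I2 conv_at_cond)
qed

lemma measurable_cond:
  assumes l: "\<eta> \<in> prob_measures T"
  shows "cond \<eta> \<in> W.S \<rightarrow>\<^sub>M prob_algebra (borel_of T)"
proof (rule measurable_into_prob_algebra[OF cond_prob_measures[OF l]])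
  fix f assume f: "continuous_map T euclideanreal f"
  have m1: "(\<lambda>\<omega>. \<integral>x. h (act X (walk \<omega> n) x) \<partial>\<eta>) \<in> borel_measurable W.S"
    if "continuous_map T euclideanreal h" for h n
    by (rule measurable_compose[OF measurable_walk_S measurable_integral_orbit[OF l that]])
  define u where "u i n \<omega> = (\<integral>x. dense_seq i (act X (walk \<omega> n) x) \<partial>\<eta>)" for i n \<omega>
  define v where "v n \<omega> = (\<integral>x. f (act X (walk \<omega> n) x) \<partial>\<eta>)" for n \<omega>
  have [measurable]: "u i n \<in> borel_measurable W.S" "v n \<in> borel_measurable W.S" for i n
    unfolding u_def v_def by (rule m1[OF continuous_dense_seq], rule m1[OF f])
  then have [measurable]: "Measurable.pred W.S (\<lambda>\<omega>. Cauchy (\<lambda>n. u i n \<omega>))" for i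
    unfolding pred_def by (intro sets_Collect_Cauchy)
  let ?C = "\<lambda>\<omega>. \<forall>i. Cauchy (\<lambda>n. \<integral>x. dense_seq i (act X (walk \<omega> n) x) \<partial>\<eta>)"
  have "(\<integral>x. f x \<partial>cond \<eta> \<omega>) =
      (if ?C \<omega> then lim (\<lambda>n. \<integral>x. f (act X (walk \<omega> n) x) \<partial>\<eta>) else (\<integral>x. f x \<partial>\<eta>))" for \<omega>
  proof (cases "\<exists>\<nu>. conv_at \<eta> \<omega> \<nu>")
    case True
    then have "conv_at \<eta> \<omega> (cond \<eta> \<omega>)" using conv_at_cond by blast
    then have "(\<lambda>n. \<integral>x. f (act X (walk \<omega> n) x) \<partial>\<eta>) \<longlonglongrightarrow> (\<integral>x. f x \<partial>cond \<eta> \<omega>)"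
      using f unfolding conv_at_iff[OF l] by blast
    then show ?thesis
      using True unfolding ex_conv_at_iff[OF l] Cauchy_convergent_iff by (simp add: limI)
  next
    case False
    then have c: "cond \<eta> \<omega> = \<eta>" by (simp add: cond_eq)
    have n: "\<not> ?C \<omega>" using False unfolding ex_conv_at_iff[OF l] Cauchy_convergent_iff .
    show ?thesis unfolding c if_not_P[OF n] ..
  qed
  moreover have "(\<lambda>\<omega>. if \<forall>i. Cauchy (\<lambda>n. u i n \<omega>) then lim (\<lambda>n. v n \<omega>) else (\<integral>x. f x \<partial>\<eta>)) \<in> borel_measurable W.S"
    by measurable
  ultimately show "(\<lambda>\<omega>. \<integral>x. f x \<partial>cond \<eta> \<omega>) \<in> borel_measurable W.S"
    by (simp add: u_def v_def cong: if_cong)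
qed

text \<open>The expected integral is the same at every step of the walk, and dominated convergence carries
  this to the limit.\<close>
lemma bind_cond:
  assumes st: "is_stationary \<eta>"
  shows "bind W.S (cond \<eta>) = \<eta>"
proof (rule prob_measures_eqI)
  note l = is_stationary_prob[OF st]
  have K: "cond \<eta> \<in> W.S \<rightarrow>\<^sub>M prob_algebra (borel_of T)" by (rule measurable_cond[OF l])
  show "bind W.S (cond \<eta>) \<in> prob_measures T" by (rule bind_prob_measures[OF W.P.prob_space_axioms K])
  show "\<eta> \<in> prob_measures T" by (rule l)
  fix f assume f: "continuous_map T euclideanreal f"
  obtain B where B: "\<And>x. x \<in> topspace T \<Longrightarrow> \<bar>f x\<bar> \<le> B" using continuous_bounded[OF f] by blast
  have "(\<lambda>n. \<integral>\<omega>. (\<integral>x. f (act X (walk \<omega> n) x) \<partial>\<eta>) \<partial>W.S) \<longlonglongrightarrow> (\<integral>\<omega>. (\<integral>x. f x \<partial>cond \<eta> \<omega>) \<partial>W.S)"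
  proof (rule integral_dominated_convergence[where w="\<lambda>_. B"])
    show "(\<lambda>\<omega>. \<integral>x. f x \<partial>cond \<eta> \<omega>) \<in> borel_measurable W.S"
      by (rule measurable_compose[OF K measurable_integral_prob_algebra[OF f]])
    show "(\<lambda>\<omega>. \<integral>x. f (act X (walk \<omega> n) x) \<partial>\<eta>) \<in> borel_measurable W.S" for n
      by (rule measurable_compose[OF measurable_walk_S measurable_integral_orbit[OF l f]])
    show "AE \<omega> in W.S. (\<lambda>n. \<integral>x. f (act X (walk \<omega> n) x) \<partial>\<eta>) \<longlonglongrightarrow> (\<integral>x. f x \<partial>cond \<eta> \<omega>)"
      using AE_conv_at[OF st] by (rule AE_mp) (intro AE_I2 impI, use f in \<open>simp add: conv_at_iff[OF l]\<close>)
    have "\<bar>\<integral>x. f (act X (walk \<omega> n) x) \<partial>\<eta>\<bar> \<le> B" for n \<omega>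
      by (rule integral_bound[OF l continuous_act_compose[OF f]]) (rule B, rule act_topspace)
    then show "AE \<omega> in W.S. norm (\<integral>x. f (act X (walk \<omega> n) x) \<partial>\<eta>) \<le> B" for n by simp
  qed simp
  then have "(\<integral>x. f x \<partial>\<eta>) = (\<integral>\<omega>. (\<integral>x. f x \<partial>cond \<eta> \<omega>) \<partial>W.S)"
    by (simp add: integral_walk[OF st f] LIMSEQ_const_iff)
  then show "(\<integral>x. f x \<partial>bind W.S (cond \<eta>)) = (\<integral>x. f x \<partial>\<eta>)"
    by (simp add: integral_bind_continuous[OF W.P.prob_space_axioms K f])
qed

lemma stationary_eqI:
  assumes "is_stationary \<eta>1" "is_stationary \<eta>2" "AE \<omega> in W.S. cond \<eta>1 \<omega> = cond \<eta>2 \<omega>"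
  shows "\<eta>1 = \<eta>2"
proof -
  have "W.S \<in> space (prob_algebra W.S)" using W.P.prob_space_axioms by (simp add: space_prob_algebra)
  then have "bind W.S (cond \<eta>1) = bind W.S (cond \<eta>2)"
    by (rule bind_cong_AE'[OF _ measurable_cond measurable_cond assms(3)])
      (intro is_stationary_prob assms)+
  then show ?thesis using bind_cond assms by simp
qed

lemma AE_cond_convex:
  assumes st: "is_stationary \<eta>" "is_stationary \<eta>1" "is_stationary \<eta>2"
    and mix: "\<And>f. continuous_map T euclideanreal f \<Longrightarrow>
      (\<integral>x. f x \<partial>\<eta>) = t * (\<integral>x. f x \<partial>\<eta>1) + (1 - t) * (\<integral>x. f x \<partial>\<eta>2)"
  shows "AE \<omega> in W.S. \<forall>f. continuous_map T euclideanreal f \<longrightarrow>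
      (\<integral>x. f x \<partial>cond \<eta> \<omega>) = t * (\<integral>x. f x \<partial>cond \<eta>1 \<omega>) + (1 - t) * (\<integral>x. f x \<partial>cond \<eta>2 \<omega>)"
  using AE_conv_at[OF st(1)] AE_conv_at[OF st(2)] AE_conv_at[OF st(3)]
proof eventually_elim
  case (elim \<omega>)
  note l = st[THEN is_stationary_prob]
  show ?case
  proof (intro allI impI)
    fix f assume f: "continuous_map T euclideanreal f"
    have "(\<lambda>n. \<integral>x. f (act X (walk \<omega> n) x) \<partial>\<eta>) \<longlonglongrightarrow> (\<integral>x. f x \<partial>cond \<eta> \<omega>)"
      using elim(1) f unfolding conv_at_iff[OF l(1)] by blast
    moreover have "(\<lambda>n. \<integral>x. f (act X (walk \<omega> n) x) \<partial>\<eta>1) \<longlonglongrightarrow> (\<integral>x. f x \<partial>cond \<eta>1 \<omega>)"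
      using elim(2) f unfolding conv_at_iff[OF l(2)] by blast
    moreover have "(\<lambda>n. \<integral>x. f (act X (walk \<omega> n) x) \<partial>\<eta>2) \<longlonglongrightarrow> (\<integral>x. f x \<partial>cond \<eta>2 \<omega>)"
      using elim(3) f unfolding conv_at_iff[OF l(3)] by blast
    ultimately have "(\<lambda>n. \<integral>x. f (act X (walk \<omega> n) x) \<partial>\<eta>) \<longlonglongrightarrow>
        t * (\<integral>x. f x \<partial>cond \<eta>1 \<omega>) + (1 - t) * (\<integral>x. f x \<partial>cond \<eta>2 \<omega>)"
      unfolding mix[OF continuous_act_compose[OF f]] by (intro tendsto_intros)
    with \<open>(\<lambda>n. \<integral>x. f (act X (walk \<omega> n) x) \<partial>\<eta>) \<longlonglongrightarrow> (\<integral>x. f x \<partial>cond \<eta> \<omega>)\<close>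
    show "(\<integral>x. f x \<partial>cond \<eta> \<omega>) = t * (\<integral>x. f x \<partial>cond \<eta>1 \<omega>) + (1 - t) * (\<integral>x. f x \<partial>cond \<eta>2 \<omega>)"
      by (rule LIMSEQ_unique)
  qed
qed

end

lemma prob_algebra_cong: "sets M = sets N \<Longrightarrow> prob_algebra M = prob_algebra N"
  unfolding prob_algebra_def by (drule subprob_algebra_cong) (rule arg_cong)

context gspace
begin

lemma ergodic_iff_stationary:
  "ergodic m X \<longleftrightarrow> is_stationary (law X) \<and> (\<forall>\<mu>1 \<mu>2 t. is_stationary \<mu>1 \<and> is_stationary \<mu>2 \<and> 0 < t \<and> t < (1::real) \<and>
     (\<forall>A\<in>sets (borel_of T). measure (law X) A = t * measure \<mu>1 A + (1 - t) * measure \<mu>2 A) \<longrightarrow> \<mu>1 = \<mu>2)"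
  unfolding ergodic_def stationary_iff by (rule refl)

lemma m_system_iff: "m_system m X \<longleftrightarrow> ergodic m X"
proof
  assume e: "ergodic m X"
  show "m_system m X"
    unfolding m_system_def
    by (rule conjI[OF gspace conjI[OF conjunct1[OF e[unfolded ergodic_def]] e]])
next
  assume "m_system m X"
  then show "ergodic m X" unfolding m_system_def by blast
qed

text \<open>Ergodicity identifies the two components with each other; being a mixture of two equal measures,
  the law is this common measure.\<close>
lemma ergodic_mixture:
  assumes erg: "ergodic m X" and st: "is_stationary \<mu>1" "is_stationary \<mu>2" and t: "0 < t" "t < (1::real)"
    and mix: "\<And>A. A \<in> sets (borel_of T) \<Longrightarrow> measure (law X) A = t * measure \<mu>1 A + (1 - t) * measure \<mu>2 A"
  shows "\<mu>1 = law X" "\<mu>2 = law X"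
proof -
  have eq: "\<mu>1 = \<mu>2"
    by (rule conjunct2[OF erg[unfolded ergodic_iff_stationary], rule_format, of _ _ t])
      (intro conjI st t ballI mix)
  have "law X = \<mu>1"
  proof (rule prob_measures_eqI_open)
    show "law X \<in> prob_measures T" "\<mu>1 \<in> prob_measures T"
      using conjunct1[OF erg[unfolded ergodic_iff_stationary]] st by (simp_all add: is_stationary_prob)
    fix U assume "openin T U"
    from mix[OF openin_sets_borel_of[OF this]] show "measure (law X) U = measure \<mu>1 U"
      by (simp add: eq[symmetric] algebra_simps)
  qed
  then show "\<mu>1 = law X" "\<mu>2 = law X" using eq by auto
qed

text \<open>Since a stationary measure is the barycentre of its conditional measures, ergodicity may be
  tested on conditional measures.\<close>
lemma ergodicI_cond:
  assumes st: "is_stationary (law X)"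
    and eq: "\<And>\<mu>1 \<mu>2 t. is_stationary \<mu>1 \<Longrightarrow> is_stationary \<mu>2 \<Longrightarrow> 0 < t \<Longrightarrow> t < (1::real) \<Longrightarrow>
      (\<And>A. A \<in> sets (borel_of T) \<Longrightarrow> measure (law X) A = t * measure \<mu>1 A + (1 - t) * measure \<mu>2 A) \<Longrightarrow>
      AE \<omega> in W.S. cond \<mu>1 \<omega> = cond \<mu>2 \<omega>"
  shows "ergodic m X"
  unfolding ergodic_iff_stationary
proof (intro conjI st allI impI, elim conjE)
  fix \<mu>1 \<mu>2 t
  assume h: "is_stationary \<mu>1" "is_stationary \<mu>2" "0 < t" "t < (1::real)"
    and mix: "\<forall>A\<in>sets (borel_of T). measure (law X) A = t * measure \<mu>1 A + (1 - t) * measure \<mu>2 A"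
  have "AE \<omega> in W.S. cond \<mu>1 \<omega> = cond \<mu>2 \<omega>" by (rule eq[OF h]) (use mix in blast)
  then show "\<mu>1 = \<mu>2" by (rule stationary_eqI[OF h(1,2)])
qed

text \<open>The conditional measures of a convex decomposition decompose those of the law, and these are point
  masses, which are extreme.\<close>
lemma ergodicI_dirac:
  assumes st: "is_stationary (law X)"
    and dirac: "AE \<omega> in W.S. \<exists>y\<in>topspace T. cond (law X) \<omega> = return (borel_of T) y"
  shows "ergodic m X"
proof (rule ergodicI_cond[OF st])
  fix \<mu>1 \<mu>2 t
  assume h: "is_stationary \<mu>1" "is_stationary \<mu>2" and t: "0 < t" "t < (1::real)"
    and mix: "\<And>A. A \<in> sets (borel_of T) \<Longrightarrow> measure (law X) A = t * measure \<mu>1 A + (1 - t) * measure \<mu>2 A"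
  note p = st[THEN is_stationary_prob] h[THEN is_stationary_prob]
  have ic: "(\<integral>x. f x \<partial>law X) = t * (\<integral>x. f x \<partial>\<mu>1) + (1 - t) * (\<integral>x. f x \<partial>\<mu>2)"
    if "continuous_map T euclideanreal f" for f
    using t by (intro integral_convex[OF p _ _ mix that]) auto
  have "AE \<omega> in W.S. \<forall>f. continuous_map T euclideanreal f \<longrightarrow>
      (\<integral>x. f x \<partial>cond (law X) \<omega>) = t * (\<integral>x. f x \<partial>cond \<mu>1 \<omega>) + (1 - t) * (\<integral>x. f x \<partial>cond \<mu>2 \<omega>)"
    by (rule AE_cond_convex[OF st h]) (rule ic)
  with dirac show "AE \<omega> in W.S. cond \<mu>1 \<omega> = cond \<mu>2 \<omega>"
  proof eventually_elim
    case (elim \<omega>)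
    obtain y where y: "y \<in> topspace T" "cond (law X) \<omega> = return (borel_of T) y" using elim(1) by blast
    have "t * (\<integral>x. f x \<partial>cond \<mu>1 \<omega>) + (1 - t) * (\<integral>x. f x \<partial>cond \<mu>2 \<omega>) = f y"
      if f: "continuous_map T euclideanreal f" for f
      using elim(2)[rule_format, OF f] y borel_measurable_continuous_map[OF f]
      by (simp add: y integral_return)
    from dirac_extreme[OF cond_prob_measures[OF p(2)] cond_prob_measures[OF p(3)] y(1) t this]
    show ?case by simp
  qed
qed

lemma AE_cond_comb_seq:
  assumes st: "is_stationary \<eta>"
  shows "AE \<omega>' in W.S. \<forall>n \<omega>. cond \<eta> (comb_seq n \<omega> \<omega>') = translate X (walk \<omega> n) (cond \<eta> \<omega>')"
  using AE_conv_at[OF st]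
proof eventually_elim
  case (elim \<omega>')
  then show ?case using cond_comb_seq[OF is_stationary_prob[OF st]] by blast
qed

lemma measurable_cond_weak_star:
  assumes "\<eta> \<in> prob_measures T" shows "cond \<eta> \<in> W.S \<rightarrow>\<^sub>M borel_of (weak_star T)"
  using measurable_cond[OF assms] unfolding measurable_cong_sets[OF refl sets_borel_of_weak_star] .

lemma measurable_translate_weak_star:
  "translate X g \<in> borel_of (weak_star T) \<rightarrow>\<^sub>M borel_of (weak_star T)"
proof -
  have "translate X g \<in> prob_algebra (borel_of T) \<rightarrow>\<^sub>M prob_algebra (borel_of T)"
    by (intro measurable_translate measurable_const measurable_ident_sets[OF refl]) simp
  then show ?thesis unfolding measurable_cong_sets[OF sets_borel_of_weak_star sets_borel_of_weak_star] .
qed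

text \<open>Splitting off the first increment: the distribution of the conditional measure is stationary.\<close>
lemma integral_cond_shift:
  assumes st: "is_stationary \<eta>" and \<Phi>: "\<Phi> \<in> borel_measurable (borel_of (weak_star T))"
    and B: "\<And>\<nu>. \<nu> \<in> prob_measures T \<Longrightarrow> \<bar>\<Phi> \<nu>\<bar> \<le> (B::real)"
  shows "(\<integral>\<omega>. \<Phi> (cond \<eta> \<omega>) \<partial>W.S) = (\<integral>g. (\<integral>\<omega>. \<Phi> (translate X g (cond \<eta> \<omega>)) \<partial>W.S) \<partial>m)"
proof -
  note l = is_stationary_prob[OF st]
  let ?h = "\<lambda>g. \<integral>\<omega>. \<Phi> (translate X g (cond \<eta> \<omega>)) \<partial>W.S"
  have c: "cond \<eta> \<in> W.S \<rightarrow>\<^sub>M borel_of (weak_star T)" by (rule measurable_cond_weak_star[OF l])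
  have \<Phi>': "\<Phi> \<in> borel_measurable (prob_algebra (borel_of T))"
    using \<Phi> unfolding measurable_cong_sets[OF sets_borel_of_weak_star refl] .
  have "(\<lambda>p. translate X (fst p) (cond \<eta> (snd p))) \<in> borel \<Otimes>\<^sub>M W.S \<rightarrow>\<^sub>M prob_algebra (borel_of T)"
    by (intro measurable_translate measurable_compose[OF measurable_snd measurable_cond[OF l]] measurable_fst)
  from measurable_compose[OF this \<Phi>']
  have hm: "?h \<in> borel_measurable borel"
    by (intro W.P.borel_measurable_lebesgue_integral) (simp add: case_prod_beta')
  have "(\<integral>\<omega>. \<Phi> (cond \<eta> \<omega>) \<partial>W.S) = (\<integral>\<omega>. (\<integral>\<omega>'. \<Phi> (cond \<eta> (comb_seq 1 \<omega> \<omega>')) \<partial>W.S) \<partial>W.S)"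
    by (rule W.integral_comb_seq[OF measurable_compose[OF c \<Phi>]]) (rule B[OF cond_prob_measures[OF l]])
  also have "\<dots> = (\<integral>\<omega>. ?h (\<omega> 0) \<partial>W.S)"
  proof (rule Bochner_Integration.integral_cong[OF refl])
    fix \<omega> assume w: "\<omega> \<in> space W.S"
    show "(\<integral>\<omega>'. \<Phi> (cond \<eta> (comb_seq 1 \<omega> \<omega>')) \<partial>W.S) = ?h (\<omega> 0)"
    proof (rule integral_cong_AE)
      show "(\<lambda>\<omega>'. \<Phi> (cond \<eta> (comb_seq 1 \<omega> \<omega>'))) \<in> borel_measurable W.S"
        by (rule measurable_compose[OF W.measurable_comb_seq_right[OF w] measurable_compose[OF c \<Phi>]])
      show "(\<lambda>\<omega>'. \<Phi> (translate X (\<omega> 0) (cond \<eta> \<omega>'))) \<in> borel_measurable W.S"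
        by (rule measurable_compose[OF measurable_compose[OF c measurable_translate_weak_star] \<Phi>])
      show "AE \<omega>' in W.S. \<Phi> (cond \<eta> (comb_seq 1 \<omega> \<omega>')) = \<Phi> (translate X (\<omega> 0) (cond \<eta> \<omega>'))"
        using AE_cond_comb_seq[OF st]
      proof eventually_elim
        case (elim \<omega>')
        from elim[rule_format, of 1 \<omega>] show ?case by (simp del: comb_seq_Suc_0)
      qed
    qed
  qed
  also have "\<dots> = (\<integral>g. ?h g \<partial>distr W.S m (\<lambda>\<omega>. \<omega> 0))"
  proof (rule integral_distr[symmetric])
    show "(\<lambda>\<omega>. \<omega> 0) \<in> W.S \<rightarrow>\<^sub>M m" by (rule measurable_component_singleton) simp
    show "?h \<in> borel_measurable m" using hm unfolding measurable_cong_sets[OF sets_m refl] .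
  qed
  also have "distr W.S m (\<lambda>\<omega>. \<omega> 0) = m" by (rule W.PiM_component) simp
  finally show ?thesis .
qed

lemma Pi_simps [simp]:
  "points (Pi_system m X) = weak_star T" "act (Pi_system m X) = translate X"
  "law (Pi_system m X) = distr (path_measure m) (borel_of (weak_star T)) (cond_measure X)"
  by (simp_all add: Pi_system_def)

lemma gspace_Pi: "gspace m (Pi_system m X)"
proof
  interpret WS: compact_metrizable "weak_star T" by (rule compact_metrizable_weak_star)
  show "compact_metric_gspace (Pi_system m X)"
    unfolding compact_metric_gspace_def
    using WS.compact WS.metrizable continuous_translate2 translate_0 translate_add by simp
qed (rule sets_m)

end

section \<open>Equivariant continuous maps\<close>

locale equivariant_map = X: gspace m X + Y: gspace m Y
  for m :: "'g::{topological_group_add, second_countable_topology} measure"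
    and X :: "('g, 'a) gsystem" and Y :: "('g, 'b) gsystem" +
  fixes \<phi> :: "'a \<Rightarrow> 'b"
  assumes continuous: "continuous_map (points X) (points Y) \<phi>"
    and equivariant: "x \<in> topspace (points X) \<Longrightarrow> \<phi> (act X g x) = act Y g (\<phi> x)"
begin

abbreviation push :: "'a measure \<Rightarrow> 'b measure" where
  "push \<eta> \<equiv> distr \<eta> (borel_sys Y) \<phi>"

lemma measurable_\<phi>: "\<phi> \<in> borel_sys X \<rightarrow>\<^sub>M borel_sys Y"
  by (rule measurable_continuous_map[OF continuous])

lemma push_prob_measures: "\<eta> \<in> prob_measures (points X) \<Longrightarrow> push \<eta> \<in> prob_measures (points Y)"
  by (rule distr_prob_measures[OF _ measurable_\<phi>])

lemma continuous_compose:
  "continuous_map (points Y) euclideanreal f \<Longrightarrow> continuous_map (points X) euclideanreal (\<lambda>x. f (\<phi> x))"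
  using continuous_map_compose[OF continuous] by (simp add: o_def)

lemma integral_push:
  "\<eta> \<in> prob_measures (points X) \<Longrightarrow> continuous_map (points Y) euclideanreal f \<Longrightarrow>
     (\<integral>y. f y \<partial>push \<eta>) = (\<integral>x. f (\<phi> x) \<partial>\<eta>)"
  by (rule integral_distr_continuous[OF _ continuous])

lemma integral_push_act:
  assumes "\<eta> \<in> prob_measures (points X)" "continuous_map (points Y) euclideanreal f"
  shows "(\<integral>y. f (act Y g y) \<partial>push \<eta>) = (\<integral>x. f (\<phi> (act X g x)) \<partial>\<eta>)"
  unfolding integral_push[OF assms(1) Y.continuous_act_compose[OF assms(2)]]
  using prob_measures_space[OF assms(1)]
  by (intro Bochner_Integration.integral_cong) (simp_all add: equivariant)

text \<open>Images of stationary measures are stationary, and passing to conditional measures commutes with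
  taking images.\<close>
lemma stationary_push:
  assumes st: "X.is_stationary \<eta>" shows "Y.is_stationary (push \<eta>)"
  unfolding Y.is_stationary_def
proof (intro conjI allI impI)
  note l = X.is_stationary_prob[OF st]
  show "push \<eta> \<in> prob_measures (points Y)" by (rule push_prob_measures[OF l])
  fix f assume f: "continuous_map (points Y) euclideanreal f"
  show "(\<integral>g. (\<integral>y. f (act Y g y) \<partial>push \<eta>) \<partial>m) = (\<integral>y. f y \<partial>push \<eta>)"
    unfolding integral_push_act[OF l f] integral_push[OF l f]
    using st continuous_compose[OF f] unfolding X.is_stationary_def by blast
qed

lemma AE_cond_push:
  assumes st: "X.is_stationary \<eta>"
  shows "AE \<omega> in X.W.S. Y.cond (push \<eta>) \<omega> = push (X.cond \<eta> \<omega>)"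
  using X.AE_conv_at[OF st]
proof eventually_elim
  case (elim \<omega>)
  note l = X.is_stationary_prob[OF st]
  have "Y.conv_at (push \<eta>) \<omega> (push (X.cond \<eta> \<omega>))"
    unfolding Y.conv_at_iff[OF push_prob_measures[OF l]]
  proof (intro conjI allI impI)
    show "push (X.cond \<eta> \<omega>) \<in> prob_measures (points Y)"
      by (rule push_prob_measures[OF X.cond_prob_measures[OF l]])
    fix f assume f: "continuous_map (points Y) euclideanreal f"
    show "(\<lambda>n. \<integral>y. f (act Y (walk \<omega> n) y) \<partial>push \<eta>) \<longlonglongrightarrow> (\<integral>y. f y \<partial>push (X.cond \<eta> \<omega>))"
      unfolding integral_push_act[OF l f] integral_push[OF X.cond_prob_measures[OF l] f]
      using elim continuous_compose[OF f] unfolding X.conv_at_iff[OF l] by blast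
  qed
  then show ?case by (rule Y.cond_eqI)
qed

end

section \<open>The distribution of the conditional measures\<close>

locale stationary_gspace = gspace m X
  for m :: "'g::{topological_group_add, second_countable_topology} measure" and X :: "('g, 'a) gsystem" +
  assumes st: "is_stationary (law X)"
begin

sublocale Pi: gspace m "Pi_system m X" by (rule gspace_Pi)

abbreviation "\<P> \<equiv> Pi_system m X"

lemmas law_prob = is_stationary_prob[OF st]

lemma law_Pi: "law \<P> = distr W.S (borel_of (weak_star T)) (cond (law X))"
  by (simp add: path_measure cond_law)

lemma integral_law_Pi:
  assumes "\<Phi> \<in> borel_measurable (borel_of (weak_star T))"
  shows "(\<integral>\<nu>. \<Phi> \<nu> \<partial>law \<P>) = (\<integral>\<omega>. (\<Phi> (cond (law X) \<omega>) :: real) \<partial>W.S)"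
  unfolding law_Pi by (rule integral_distr[OF measurable_cond_weak_star[OF law_prob] assms])

lemma law_Pi_prob: "law \<P> \<in> prob_measures (weak_star T)"
proof -
  have "prob_space (law \<P>)"
    unfolding law_Pi by (rule W.P.prob_space_distr[OF measurable_cond_weak_star[OF law_prob]])
  then show ?thesis by (simp add: prob_measures_iff law_Pi)
qed

lemma stationary_Pi: "Pi.is_stationary (law \<P>)"
  unfolding Pi.is_stationary_def Pi_simps(1,2)
proof (intro conjI allI impI)
  show "law \<P> \<in> prob_measures (weak_star T)" by (rule law_Pi_prob)
  interpret WS: compact_metrizable "weak_star T" by (rule compact_metrizable_weak_star)
  fix \<Phi> assume c: "continuous_map (weak_star T) euclideanreal \<Phi>"
  note \<Phi> = borel_measurable_continuous_map[OF c]
  obtain B where B: "\<And>\<nu>. \<nu> \<in> prob_measures T \<Longrightarrow> \<bar>\<Phi> \<nu>\<bar> \<le> B"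
    using WS.continuous_bounded[OF c] by (metis topspace_weak_star)
  have eq: "(\<integral>\<nu>. \<Phi> (translate X g \<nu>) \<partial>law \<P>) = (\<integral>\<omega>. \<Phi> (translate X g (cond (law X) \<omega>)) \<partial>W.S)" for g
    by (rule integral_law_Pi[OF measurable_compose[OF measurable_translate_weak_star \<Phi>]])
  show "(\<integral>g. (\<integral>\<nu>. \<Phi> (translate X g \<nu>) \<partial>law \<P>) \<partial>m) = (\<integral>\<nu>. \<Phi> \<nu> \<partial>law \<P>)"
    unfolding integral_law_Pi[OF \<Phi>] eq by (rule integral_cond_shift[OF st \<Phi> B, symmetric])
qed

text \<open>The translate of the distribution of \<open>\<mu>\<^sub>\<omega>\<close> by the first \<open>n\<close> increments is the conditional
  distribution of \<open>\<mu>\<^sub>\<omega>\<close> given these increments, so by the zero-one law it concentrates at \<open>\<mu>\<^sub>\<omega>\<close>.\<close>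
theorem AE_cond_Pi:
  "AE \<omega> in W.S. Pi.cond (law \<P>) \<omega> = return (borel_of (weak_star T)) (cond (law X) \<omega>)"
proof -
  have lev: "AE \<omega> in W.S. (\<lambda>n. \<integral>\<omega>'. Pi.dense_seq i (cond (law X) (comb_seq n \<omega> \<omega>')) \<partial>W.S)
      \<longlonglongrightarrow> Pi.dense_seq i (cond (law X) \<omega>)" for i
  proof -
    have c: "continuous_map (weak_star T) euclideanreal (Pi.dense_seq i)"
      using Pi.continuous_dense_seq by simp
    obtain B where B: "\<And>\<nu>. \<nu> \<in> topspace (weak_star T) \<Longrightarrow> \<bar>Pi.dense_seq i \<nu>\<bar> \<le> B"
      using Pi.continuous_bounded[OF Pi.continuous_dense_seq[of i]] by (metis Pi_simps(1))
    show ?thesis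
      by (rule W.levy[OF measurable_compose[OF measurable_cond_weak_star[OF law_prob]
              borel_measurable_continuous_map[OF c]]])
        (rule B, simp add: cond_prob_measures[OF law_prob])
  qed
  have eq: "(\<integral>\<omega>'. Pi.dense_seq i (cond (law X) (comb_seq n \<omega> \<omega>')) \<partial>W.S)
      = (\<integral>\<nu>. Pi.dense_seq i (translate X (walk \<omega> n) \<nu>) \<partial>law \<P>)" if w: "\<omega> \<in> space W.S" for i n \<omega>
  proof -
    have c: "Pi.dense_seq i \<in> borel_measurable (borel_of (weak_star T))"
      using borel_measurable_continuous_map[OF Pi.continuous_dense_seq[of i]] by simp
    note cm = measurable_cond_weak_star[OF law_prob]
    have "(\<integral>\<omega>'. Pi.dense_seq i (cond (law X) (comb_seq n \<omega> \<omega>')) \<partial>W.S)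
        = (\<integral>\<omega>'. Pi.dense_seq i (translate X (walk \<omega> n) (cond (law X) \<omega>')) \<partial>W.S)"
    proof (rule integral_cong_AE)
      show "(\<lambda>\<omega>'. Pi.dense_seq i (cond (law X) (comb_seq n \<omega> \<omega>'))) \<in> borel_measurable W.S"
        by (rule measurable_compose[OF W.measurable_comb_seq_right[OF w] measurable_compose[OF cm c]])
      show "(\<lambda>\<omega>'. Pi.dense_seq i (translate X (walk \<omega> n) (cond (law X) \<omega>'))) \<in> borel_measurable W.S"
        by (rule measurable_compose[OF measurable_compose[OF cm measurable_translate_weak_star] c])
      show "AE \<omega>' in W.S. Pi.dense_seq i (cond (law X) (comb_seq n \<omega> \<omega>'))
          = Pi.dense_seq i (translate X (walk \<omega> n) (cond (law X) \<omega>'))"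
        using AE_cond_comb_seq[OF st] by eventually_elim simp
    qed
    also have "\<dots> = (\<integral>\<nu>. Pi.dense_seq i (translate X (walk \<omega> n) \<nu>) \<partial>law \<P>)"
      by (rule integral_law_Pi[symmetric, OF measurable_compose[OF measurable_translate_weak_star c]])
    finally show ?thesis .
  qed
  have "AE \<omega> in W.S. \<forall>i. (\<lambda>n. \<integral>\<omega>'. Pi.dense_seq i (cond (law X) (comb_seq n \<omega> \<omega>')) \<partial>W.S)
      \<longlonglongrightarrow> Pi.dense_seq i (cond (law X) \<omega>)"
    unfolding AE_all_countable using lev by blast
  with Pi.AE_conv_at[OF stationary_Pi] AE_space show ?thesis
  proof eventually_elim
    case (elim \<omega>)
    let ?\<nu> = "cond (law X) \<omega>"
    have \<nu>: "?\<nu> \<in> topspace (points \<P>)" by (simp add: cond_prob_measures[OF law_prob])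
    have "(\<integral>\<nu>. Pi.dense_seq i \<nu> \<partial>Pi.cond (law \<P>) \<omega>) = Pi.dense_seq i ?\<nu>" for i
    proof (rule LIMSEQ_unique)
      show "(\<lambda>n. \<integral>\<nu>. Pi.dense_seq i (act \<P> (walk \<omega> n) \<nu>) \<partial>law \<P>) \<longlonglongrightarrow> (\<integral>\<nu>. Pi.dense_seq i \<nu> \<partial>Pi.cond (law \<P>) \<omega>)"
        using elim(1) Pi.continuous_dense_seq
        unfolding Pi.conv_at_iff[OF Pi.is_stationary_prob[OF stationary_Pi]] by blast
      show "(\<lambda>n. \<integral>\<nu>. Pi.dense_seq i (act \<P> (walk \<omega> n) \<nu>) \<partial>law \<P>) \<longlonglongrightarrow> Pi.dense_seq i ?\<nu>"
        using elim(3)[rule_format, of i] unfolding eq[OF elim(2)] Pi_simps(2) .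
    qed
    moreover have "(\<integral>\<nu>. Pi.dense_seq i \<nu> \<partial>return (borel_sys \<P>) ?\<nu>) = Pi.dense_seq i ?\<nu>" for i
      using \<nu> borel_measurable_continuous_map[OF Pi.continuous_dense_seq] by (intro integral_return) simp_all
    ultimately have "Pi.emb (Pi.cond (law \<P>) \<omega>) = Pi.emb (return (borel_sys \<P>) ?\<nu>)"
      by (simp only: Pi.emb_def)
    from Pi.emb_inj[OF Pi.cond_prob_measures[OF Pi.is_stationary_prob[OF stationary_Pi]] Pi.return_prob_measures[OF \<nu>] this]
    show ?case by simp
  qed
qed

lemma AE_cond_Pi_dirac:
  "AE \<omega> in W.S. \<exists>\<nu>\<in>topspace (points \<P>). Pi.cond (law \<P>) \<omega> = return (borel_sys \<P>) \<nu>"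
  using AE_cond_Pi
proof eventually_elim
  case (elim \<omega>)
  have "cond (law X) \<omega> \<in> topspace (points \<P>)"
    unfolding Pi_simps(1) topspace_weak_star by (rule cond_prob_measures[OF law_prob])
  with elim show ?case unfolding Pi_simps(1) by (rule bexI)
qed

lemma ergodic_Pi: "ergodic m \<P>"
  by (rule Pi.ergodicI_dirac[OF stationary_Pi AE_cond_Pi_dirac])

theorem m_proximal_Pi: "m_proximal m \<P>"
  unfolding m_proximal_def path_measure
  using ergodic_Pi AE_cond_Pi_dirac unfolding Pi.m_system_iff Pi.cond_law by (rule conjI)

end

lemma integral_prob_const: "prob_space M \<Longrightarrow> (\<integral>x. (c::real) \<partial>M) = c"
  by (simp add: prob_space.prob_space)

context compact_metrizable
begin

lemma AE_return_eq: "y \<in> topspace T \<Longrightarrow> AE x in return (borel_of T) y. x = y"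
proof (rule AE_I')
  assume y: "y \<in> topspace T"
  have "closedin T {y}"
    using y metrizable_imp_t1_space[OF metrizable] by (simp add: closedin_t1_singleton)
  then have "openin T (topspace T - {y})" by blast
  from openin_sets_borel_of[OF this]
  show "topspace T - {y} \<in> null_sets (return (borel_of T) y)"
    by (simp add: null_sets_def)
  show "{x \<in> space (return (borel_of T) y). \<not> x = y} \<subseteq> topspace T - {y}" by auto
qed

lemma integral_return_continuous:
  "y \<in> topspace T \<Longrightarrow> continuous_map T euclideanreal f \<Longrightarrow> (\<integral>x. f x \<partial>return (borel_of T) y) = f y"
  by (rule integral_return) (simp_all add: borel_measurable_continuous_map)

end

lemma (in equivariant_map) push_mixture:
  assumes p: "\<mu> \<in> prob_measures (points X)" "\<mu>1 \<in> prob_measures (points X)" "\<mu>2 \<in> prob_measures (points X)"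
    and mix: "\<And>A. A \<in> sets (borel_sys X) \<Longrightarrow> measure \<mu> A = t * measure \<mu>1 A + (1 - t) * measure \<mu>2 A"
    and A: "A \<in> sets (borel_sys Y)"
  shows "measure (push \<mu>) A = t * measure (push \<mu>1) A + (1 - t) * measure (push \<mu>2) A"
proof -
  have m: "measure (push \<nu>) A = measure \<nu> (\<phi> -` A \<inter> space (borel_sys X))" if "\<nu> \<in> prob_measures (points X)" for \<nu>
  proof -
    have s: "sets \<nu> = sets (borel_sys X)" using that by (simp add: prob_measures_iff)
    have "\<phi> \<in> \<nu> \<rightarrow>\<^sub>M borel_sys Y" using measurable_\<phi> unfolding measurable_cong_sets[OF s refl] .
    from measure_distr[OF this A] show ?thesis unfolding sets_eq_imp_space_eq[OF s] .
  qed
  show ?thesis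
    unfolding m[OF p(1)] m[OF p(2)] m[OF p(3)] by (rule mix[OF measurable_sets[OF measurable_\<phi> A]])
qed

section \<open>The join of a system with the distribution of its conditional measures\<close>

context stationary_gspace
begin

abbreviation "\<W> \<equiv> weak_star T"
abbreviation "star \<equiv> star_system m X"

lemma star_simps:
  "points star = prod_topology T \<W>"
  "act star = (\<lambda>g (x, \<nu>). (act X g x, translate X g \<nu>))"
  "law star = bind W.S (\<lambda>\<omega>. cond (law X) \<omega> \<Otimes>\<^sub>M Pi.cond (law \<P>) \<omega>)"
  unfolding cond_law Pi.cond_law by (simp_all add: star_system_def m_join_def path_measure)

lemma act_star: "act star g z = (act X g (fst z), translate X g (snd z))"
  by (simp add: star_simps case_prod_beta')

interpretation WS: compact_metrizable \<W> by (rule compact_metrizable_weak_star)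

lemma gspace_star: "gspace m star"
proof
  let ?S = "prod_topology T \<W>"
  let ?P = "prod_topology (euclidean :: 'g topology) ?S"
  show "compact_metric_gspace star"
    unfolding compact_metric_gspace_def star_simps(1)
  proof (intro conjI allI ballI)
    have "compactin ?S (topspace T \<times> topspace \<W>)"
      using compact WS.compact unfolding compact_space_def compactin_Times by blast
    then show "compact_space ?S" by (simp add: compact_space_def)
    show "metrizable_space ?S"
      unfolding metrizable_space_prod_topology using metrizable WS.metrizable by blast
    have s: "continuous_map ?P ?S snd" by (rule continuous_map_snd)
    note a1 = continuous_map_compose[OF continuous_map_pairedI[OF continuous_map_fst
        continuous_map_compose[OF s continuous_map_fst]] act_continuous2]
    note a2 = continuous_map_compose[OF continuous_map_pairedI[OF continuous_map_fst
        continuous_map_compose[OF s continuous_map_snd]] continuous_translate2]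
    show "continuous_map ?P ?S (\<lambda>(g, z). act star g z)"
      using continuous_map_pairedI[OF a1 a2] by (simp add: act_star o_def case_prod_beta')
    fix z assume z: "z \<in> topspace ?S"
    then have z': "fst z \<in> topspace T" "snd z \<in> prob_measures T" by auto
    show "act star 0 z = z"
      using act_0[OF z'(1)] translate_0[OF z'(2)] by (simp add: act_star)
    show "act star (g + h) z = act star g (act star h z)" for g h
      unfolding act_star fst_conv snd_conv act_add[OF z'(1)] translate_add[OF z'(2)] ..
  qed
qed (rule sets_m)

interpretation St: gspace m star by (rule gspace_star)

interpretation F: equivariant_map m star X fst
proof
  show "continuous_map (points star) T fst" unfolding star_simps by (rule continuous_map_fst)
qed (simp add: act_star)

interpretation Sn: equivariant_map m star \<P> snd
proof
  show "continuous_map (points star) (points \<P>) snd"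
    unfolding star_simps Pi_simps(1) by (rule continuous_map_snd)
qed (simp add: act_star)

lemma topspace_star: "z \<in> topspace (points star) \<longleftrightarrow> fst z \<in> topspace T \<and> snd z \<in> prob_measures T"
  by (cases z) (simp add: star_simps)

lemma sets_star: "sets (borel_sys star) = sets (borel_of T \<Otimes>\<^sub>M borel_of \<W>)"
  unfolding star_simps(1) by (rule sets_borel_of_prod[OF second_countable WS.second_countable])

text \<open>The fibre of the join over the point \<open>\<nu>\<close>: the only measure with marginals \<open>\<nu>\<close> and the point mass
  at \<open>\<nu>\<close>.\<close>
definition J :: "'a measure \<Rightarrow> ('a \<times> 'a measure) measure" where
  "J \<nu> = \<nu> \<Otimes>\<^sub>M return (borel_of \<W>) \<nu>"

lemma J_prob:
  assumes "\<nu> \<in> prob_measures T" shows "J \<nu> \<in> prob_measures (points star)"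
proof -
  have "prob_space \<nu>" "prob_space (return (borel_of \<W>) \<nu>)" "sets \<nu> = sets (borel_of T)"
    using assms by (auto simp: prob_measures_iff prob_space_return)
  then show ?thesis
    unfolding prob_measures_iff J_def sets_star by (simp add: prob_space_pair cong: sets_pair_measure_cong)
qed

lemma continuous_section:
  assumes f: "continuous_map (points star) euclideanreal f"
  shows "x \<in> topspace T \<Longrightarrow> continuous_map \<W> euclideanreal (\<lambda>\<nu>. f (x, \<nu>))"
    and "\<nu> \<in> prob_measures T \<Longrightarrow> continuous_map T euclideanreal (\<lambda>x. f (x, \<nu>))"
proof -
  assume x: "x \<in> topspace T"
  have "continuous_map \<W> (prod_topology T \<W>) (\<lambda>\<nu>. (x, \<nu>))"
    using x by (intro continuous_map_pairedI) simp_all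
  from continuous_map_compose[OF this f[unfolded star_simps(1)]]
  show "continuous_map \<W> euclideanreal (\<lambda>\<nu>. f (x, \<nu>))" by (simp add: o_def)
next
  assume \<nu>: "\<nu> \<in> prob_measures T"
  have "continuous_map T (prod_topology T \<W>) (\<lambda>x. (x, \<nu>))"
    using \<nu> by (intro continuous_map_pairedI) simp_all
  from continuous_map_compose[OF this f[unfolded star_simps(1)]]
  show "continuous_map T euclideanreal (\<lambda>x. f (x, \<nu>))" by (simp add: o_def)
qed

lemma integral_J:
  assumes \<nu>: "\<nu> \<in> prob_measures T" and f: "continuous_map (points star) euclideanreal f"
  shows "(\<integral>z. f z \<partial>J \<nu>) = (\<integral>x. f (x, \<nu>) \<partial>\<nu>)"
proof -
  interpret N: prob_space \<nu> using \<nu> by (simp add: prob_measures_iff)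
  interpret R: prob_space "return (borel_of \<W>) \<nu>" using \<nu> by (simp add: prob_space_return)
  interpret NR: pair_prob_space \<nu> "return (borel_of \<W>) \<nu>" ..
  have "(\<integral>z. f z \<partial>J \<nu>) = (\<integral>x. (\<integral>y. f (x, y) \<partial>return (borel_of \<W>) \<nu>) \<partial>\<nu>)"
    using NR.integral_fst'[OF St.integrable_continuous[OF J_prob[OF \<nu>] f, unfolded J_def]]
    unfolding J_def by (rule sym)
  also have "\<dots> = (\<integral>x. f (x, \<nu>) \<partial>\<nu>)"
  proof (rule Bochner_Integration.integral_cong[OF refl])
    fix x assume "x \<in> space \<nu>"
    then have "x \<in> topspace T" using prob_measures_space[OF \<nu>] by simp
    from WS.integral_return_continuous[OF _ continuous_section(1)[OF f this], of \<nu>]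
    show "(\<integral>y. f (x, y) \<partial>return (borel_of \<W>) \<nu>) = f (x, \<nu>)" using \<nu> by simp
  qed
  finally show ?thesis .
qed

lemma push_fst_J:
  assumes \<nu>: "\<nu> \<in> prob_measures T" shows "F.push (J \<nu>) = \<nu>"
proof (rule prob_measures_eqI[OF F.push_prob_measures[OF J_prob[OF \<nu>]] \<nu>])
  fix f assume f: "continuous_map T euclideanreal f"
  show "(\<integral>x. f x \<partial>F.push (J \<nu>)) = (\<integral>x. f x \<partial>\<nu>)"
    unfolding F.integral_push[OF J_prob[OF \<nu>] f] integral_J[OF \<nu> F.continuous_compose[OF f]] by simp
qed

lemma AE_J_snd:
  assumes \<nu>: "\<nu> \<in> prob_measures T" shows "AE z in J \<nu>. snd z = \<nu>"
proof -
  have e: "Sn.push (J \<nu>) = return (borel_sys \<P>) \<nu>"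
  proof (rule Pi.prob_measures_eqI[OF Sn.push_prob_measures[OF J_prob[OF \<nu>]]])
    show "return (borel_sys \<P>) \<nu> \<in> prob_measures (points \<P>)"
      by (rule Pi.return_prob_measures) (simp add: \<nu>)
    fix f assume f: "continuous_map (points \<P>) euclideanreal f"
    have "prob_space \<nu>" using \<nu> by (simp add: prob_measures_iff)
    then have "(\<integral>y. f y \<partial>Sn.push (J \<nu>)) = f \<nu>"
      unfolding Sn.integral_push[OF J_prob[OF \<nu>] f] integral_J[OF \<nu> Sn.continuous_compose[OF f]]
      by (simp add: prob_space.prob_space)
    also have "\<dots> = (\<integral>y. f y \<partial>return (borel_sys \<P>) \<nu>)"
      by (rule Pi.integral_return_continuous[OF _ f, symmetric]) (simp add: \<nu>)
    finally show "(\<integral>y. f y \<partial>Sn.push (J \<nu>)) = (\<integral>y. f y \<partial>return (borel_sys \<P>) \<nu>)" .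
  qed
  have "AE y in Sn.push (J \<nu>). y = \<nu>"
    unfolding e by (rule Pi.AE_return_eq) (simp add: \<nu>)
  moreover have "sets (J \<nu>) = sets (borel_sys star)" using J_prob[OF \<nu>] unfolding prob_measures_iff by blast
  then have "snd \<in> J \<nu> \<rightarrow>\<^sub>M borel_sys \<P>" using Sn.measurable_\<phi> measurable_cong_sets by blast
  ultimately show ?thesis by (rule AE_distrD[rotated])
qed

text \<open>If the second marginal is a point mass at \<open>\<nu>\<close>, integrands may be evaluated with \<open>\<nu>\<close> as second
  argument, after which only the first marginal matters.\<close>
lemma J_unique:
  assumes \<theta>: "\<theta> \<in> prob_measures (points star)" and \<nu>: "\<nu> \<in> prob_measures T"
    and 1: "F.push \<theta> = \<nu>" and 2: "Sn.push \<theta> = return (borel_sys \<P>) \<nu>"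
  shows "\<theta> = J \<nu>"
proof (rule St.prob_measures_eqI[OF \<theta> J_prob[OF \<nu>]])
  fix f assume f: "continuous_map (points star) euclideanreal f"
  have s: "sets \<theta> = sets (borel_sys star)" using \<theta> unfolding prob_measures_iff by blast
  note m = measurable_cong_sets[OF s refl]
  have "AE y in Sn.push \<theta>. y = \<nu>" unfolding 2 by (rule Pi.AE_return_eq) (simp add: \<nu>)
  then have ae: "AE z in \<theta>. snd z = \<nu>" using Sn.measurable_\<phi> unfolding m[symmetric] by (rule AE_distrD[rotated])
  note c = continuous_section(2)[OF f \<nu>]
  have "(\<integral>z. f z \<partial>\<theta>) = (\<integral>z. f (fst z, \<nu>) \<partial>\<theta>)"
  proof (rule integral_cong_AE)
    show "f \<in> borel_measurable \<theta>" unfolding m by (rule borel_measurable_continuous_map[OF f])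
    show "(\<lambda>z. f (fst z, \<nu>)) \<in> borel_measurable \<theta>"
      unfolding m by (rule borel_measurable_continuous_map[OF F.continuous_compose[OF c]])
    show "AE z in \<theta>. f z = f (fst z, \<nu>)" using ae
    proof eventually_elim
      case (elim z) then show ?case by (cases z) simp
    qed
  qed
  also have "\<dots> = (\<integral>x. f (x, \<nu>) \<partial>\<nu>)" using F.integral_push[OF \<theta> c] unfolding 1 by (rule sym)
  finally show "(\<integral>z. f z \<partial>\<theta>) = (\<integral>z. f z \<partial>J \<nu>)" unfolding integral_J[OF \<nu> f] .
qed

lemma translate_J:
  assumes \<nu>: "\<nu> \<in> prob_measures T" shows "translate star g (J \<nu>) = J (translate X g \<nu>)"
proof (rule St.prob_measures_eqI)
  note t = translate_prob_measures[OF \<nu>]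
  show "translate star g (J \<nu>) \<in> prob_measures (points star)"
    by (rule St.translate_prob_measures[OF J_prob[OF \<nu>]])
  show "J (translate X g \<nu>) \<in> prob_measures (points star)" by (rule J_prob[OF t])
  fix f assume f: "continuous_map (points star) euclideanreal f"
  have "(\<integral>z. f z \<partial>translate star g (J \<nu>)) = (\<integral>x. f (act star g (x, \<nu>)) \<partial>\<nu>)"
    unfolding St.integral_translate[OF J_prob[OF \<nu>] f]
    by (rule integral_J[OF \<nu> St.continuous_act_compose[OF f]])
  also have "\<dots> = (\<integral>z. f z \<partial>J (translate X g \<nu>))"
    unfolding integral_J[OF t f] integral_translate[OF \<nu> continuous_section(2)[OF f t]] act_star fst_conv snd_conv ..
  finally show "(\<integral>z. f z \<partial>translate star g (J \<nu>)) = (\<integral>z. f z \<partial>J (translate X g \<nu>))" .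
qed

lemma measurable_J: "J \<in> borel_of \<W> \<rightarrow>\<^sub>M prob_algebra (borel_sys star)"
proof -
  have "(\<lambda>\<nu>. \<nu>) \<in> borel_of \<W> \<rightarrow>\<^sub>M prob_algebra (borel_of T)"
    by (rule measurable_ident_sets[OF sets_borel_of_weak_star])
  from measurable_pair_prob[OF this measurable_return_prob_space]
  show ?thesis unfolding J_def[abs_def] prob_algebra_cong[OF sets_star] .
qed

lemma measurable_J_cond: "(\<lambda>\<omega>. J (cond (law X) \<omega>)) \<in> W.S \<rightarrow>\<^sub>M prob_algebra (borel_sys star)"
  by (rule measurable_compose[OF measurable_cond_weak_star[OF law_prob] measurable_J])

text \<open>Along almost every path the conditional measure of the second factor is a point mass.\<close>
lemma law_star: "law star = bind W.S (\<lambda>\<omega>. J (cond (law X) \<omega>))"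
  unfolding star_simps(3)
proof (rule bind_cong_AE')
  show "W.S \<in> space (prob_algebra W.S)" using W.P.prob_space_axioms by (simp add: space_prob_algebra)
  show "(\<lambda>\<omega>. J (cond (law X) \<omega>)) \<in> W.S \<rightarrow>\<^sub>M prob_algebra (borel_sys star)" by (rule measurable_J_cond)
  have "Pi.cond (law \<P>) \<in> W.S \<rightarrow>\<^sub>M prob_algebra (borel_of \<W>)"
    using Pi.measurable_cond[OF Pi.is_stationary_prob[OF stationary_Pi]] unfolding Pi_simps(1) .
  from measurable_pair_prob[OF measurable_cond[OF law_prob] this]
  show "(\<lambda>\<omega>. cond (law X) \<omega> \<Otimes>\<^sub>M Pi.cond (law \<P>) \<omega>) \<in> W.S \<rightarrow>\<^sub>M prob_algebra (borel_sys star)"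
    unfolding prob_algebra_cong[OF sets_star] .
  show "AE \<omega> in W.S. cond (law X) \<omega> \<Otimes>\<^sub>M Pi.cond (law \<P>) \<omega> = J (cond (law X) \<omega>)"
    using AE_cond_Pi
  proof eventually_elim
    case (elim \<omega>) show ?case unfolding elim J_def ..
  qed
qed

lemma law_star_prob: "law star \<in> prob_measures (points star)"
  unfolding law_star by (rule St.bind_prob_measures[OF W.P.prob_space_axioms measurable_J_cond])

lemma integral_law_star:
  assumes f: "continuous_map (points star) euclideanreal f"
  shows "(\<integral>z. f z \<partial>law star) = (\<integral>\<omega>. (\<integral>z. f z \<partial>J (cond (law X) \<omega>)) \<partial>W.S)"
  unfolding law_star by (rule St.integral_bind_continuous[OF W.P.prob_space_axioms measurable_J_cond f])

lemma stationary_star: "St.is_stationary (law star)"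
  unfolding St.is_stationary_def
proof (intro conjI law_star_prob allI impI)
  fix f assume f: "continuous_map (points star) euclideanreal f"
  obtain B where B: "\<And>z. z \<in> topspace (points star) \<Longrightarrow> \<bar>f z\<bar> \<le> B" using St.continuous_bounded[OF f] by blast
  let ?\<Psi> = "\<lambda>\<nu>. \<integral>z. f z \<partial>J \<nu>"
  have m: "?\<Psi> \<in> borel_measurable (borel_of \<W>)"
    by (rule measurable_compose[OF measurable_J St.measurable_integral_prob_algebra[OF f]])
  have b: "\<bar>?\<Psi> \<nu>\<bar> \<le> B" if "\<nu> \<in> prob_measures T" for \<nu>
    by (rule St.integral_bound[OF J_prob[OF that] f B])
  have eq: "(\<integral>z. f (act star g z) \<partial>law star) = (\<integral>\<omega>. ?\<Psi> (translate X g (cond (law X) \<omega>)) \<partial>W.S)" for g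
    unfolding integral_law_star[OF St.continuous_act_compose[OF f]]
      St.integral_translate[OF J_prob[OF cond_prob_measures[OF law_prob]] f, symmetric]
      translate_J[OF cond_prob_measures[OF law_prob]] ..
  show "(\<integral>g. (\<integral>z. f (act star g z) \<partial>law star) \<partial>m) = (\<integral>z. f z \<partial>law star)"
    unfolding integral_law_star[OF f] eq by (rule integral_cond_shift[OF st m b, symmetric])
qed

lemma push_fst_law: "F.push (law star) = law X"
proof (rule prob_measures_eqI[OF F.push_prob_measures[OF law_star_prob] law_prob])
  fix f assume f: "continuous_map T euclideanreal f"
  have "(\<integral>x. f x \<partial>F.push (law star)) = (\<integral>\<omega>. (\<integral>x. f x \<partial>cond (law X) \<omega>) \<partial>W.S)"
    unfolding F.integral_push[OF law_star_prob f] integral_law_star[OF F.continuous_compose[OF f]]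
      integral_J[OF cond_prob_measures[OF law_prob] F.continuous_compose[OF f]] fst_conv ..
  also have "\<dots> = (\<integral>x. f x \<partial>law X)"
    using integral_bind_continuous[OF W.P.prob_space_axioms measurable_cond[OF law_prob] f]
    unfolding bind_cond[OF st] by (rule sym)
  finally show "(\<integral>x. f x \<partial>F.push (law star)) = (\<integral>x. f x \<partial>law X)" .
qed

lemma push_snd_law: "Sn.push (law star) = law \<P>"
proof (rule Pi.prob_measures_eqI[OF Sn.push_prob_measures[OF law_star_prob] Pi.is_stationary_prob[OF stationary_Pi]])
  fix f assume f: "continuous_map (points \<P>) euclideanreal f"
  have fm: "f \<in> borel_measurable (borel_of \<W>)"
    using borel_measurable_continuous_map[OF f] unfolding Pi_simps(1) .
  have k: "(\<integral>x. f \<nu> \<partial>\<nu>) = f \<nu>" if "\<nu> \<in> prob_measures T" for \<nu>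
    using that by (simp add: prob_measures_iff prob_space.prob_space)
  show "(\<integral>x. f x \<partial>Sn.push (law star)) = (\<integral>x. f x \<partial>law \<P>)"
    unfolding Sn.integral_push[OF law_star_prob f] integral_law_star[OF Sn.continuous_compose[OF f]]
      integral_J[OF cond_prob_measures[OF law_prob] Sn.continuous_compose[OF f]] snd_conv integral_law_Pi[OF fm]
      k[OF cond_prob_measures[OF law_prob]] ..
qed

text \<open>Conditional measures commute with both projections, so the marginals of the conditional measure
  are known, and the second one is a point mass.\<close>
lemma AE_cond_joining:
  assumes \<eta>: "St.is_stationary \<eta>" and 1: "F.push \<eta> = law X" and 2: "Sn.push \<eta> = law \<P>"
  shows "AE \<omega> in W.S. St.cond \<eta> \<omega> = J (cond (law X) \<omega>)"
  using F.AE_cond_push[OF \<eta>, unfolded 1] Sn.AE_cond_push[OF \<eta>, unfolded 2] AE_cond_Pi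
proof eventually_elim
  case (elim \<omega>)
  show ?case
  proof (rule J_unique[OF St.cond_prob_measures[OF St.is_stationary_prob[OF \<eta>]] cond_prob_measures[OF law_prob]])
    show "F.push (St.cond \<eta> \<omega>) = cond (law X) \<omega>" using elim(1) by (rule sym)
    show "Sn.push (St.cond \<eta> \<omega>) = return (borel_sys \<P>) (cond (law X) \<omega>)"
      using elim(2,3) unfolding Pi_simps(1) by (rule trans[OF sym])
  qed
qed

lemmas AE_cond_star = AE_cond_joining[OF stationary_star push_fst_law push_snd_law]

text \<open>The marginals of the components of a convex decomposition of the law are those of the law,
  because both marginals are ergodic; the second conditional marginal is a point mass, so the
  conditional measures of the components agree.\<close>
lemma ergodic_star:
  assumes erg: "ergodic m X" shows "ergodic m star"
proof (rule St.ergodicI_cond[OF stationary_star])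
  fix \<mu>1 \<mu>2 t
  assume h: "St.is_stationary \<mu>1" "St.is_stationary \<mu>2" and t: "0 < t" "t < (1::real)"
    and mix: "\<And>A. A \<in> sets (borel_sys star) \<Longrightarrow> measure (law star) A = t * measure \<mu>1 A + (1 - t) * measure \<mu>2 A"
  note p = law_star_prob h[THEN St.is_stationary_prob]
  have mF: "measure (law X) A = t * measure (F.push \<mu>1) A + (1 - t) * measure (F.push \<mu>2) A"
    if "A \<in> sets (borel_of T)" for A
    using F.push_mixture[OF p mix that] unfolding push_fst_law .
  have mS: "measure (law \<P>) A = t * measure (Sn.push \<mu>1) A + (1 - t) * measure (Sn.push \<mu>2) A"
    if "A \<in> sets (borel_sys \<P>)" for A
    using Sn.push_mixture[OF p mix that] unfolding push_snd_law .
  note sF = F.stationary_push[OF h(1)] F.stationary_push[OF h(2)]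
  note sS = Sn.stationary_push[OF h(1)] Sn.stationary_push[OF h(2)]
  have eF: "F.push \<mu>1 = law X" "F.push \<mu>2 = law X"
    by (rule ergodic_mixture(1)[OF erg sF t], rule mF, assumption)
      (rule ergodic_mixture(2)[OF erg sF t], rule mF, assumption)
  have eS: "Sn.push \<mu>1 = law \<P>" "Sn.push \<mu>2 = law \<P>"
    by (rule Pi.ergodic_mixture(1)[OF ergodic_Pi sS t], rule mS, assumption)
      (rule Pi.ergodic_mixture(2)[OF ergodic_Pi sS t], rule mS, assumption)
  from AE_cond_joining[OF h(1) eF(1) eS(1)] AE_cond_joining[OF h(2) eF(2) eS(2)]
  show "AE \<omega> in W.S. St.cond \<mu>1 \<omega> = St.cond \<mu>2 \<omega>" by eventually_elim simp
qed


section \<open>The structure theorem\<close>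

lemma system_hom_fst:
  assumes erg: "ergodic m X" shows "system_hom m star X fst"
  unfolding system_hom_def m_system_iff St.m_system_iff
proof (intro conjI allI erg ergodic_star[OF erg] F.measurable_\<phi> push_fst_law)
  show "AE z in law star. fst (act star g z) = act X g (fst z)" for g by (simp add: act_star)
qed

lemma system_hom_snd:
  assumes erg: "ergodic m X" shows "system_hom m star \<P> snd"
  unfolding system_hom_def Pi.m_system_iff St.m_system_iff
proof (intro conjI allI ergodic_Pi ergodic_star[OF erg] Sn.measurable_\<phi> push_snd_law)
  show "AE z in law star. snd (act star g z) = act \<P> g (snd z)" for g by (simp add: act_star)
qed

text \<open>Almost every conditional measure of the join lives on a horizontal slice, on which the projection
  is injective.\<close>
theorem m_proximal_hom_fst:
  assumes erg: "ergodic m X" shows "m_proximal_hom m star X fst"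
  unfolding m_proximal_hom_def path_measure
proof (intro conjI system_hom_fst[OF erg])
  show "AE \<omega> in W.S. \<exists>N\<in>null_sets (cond_measure star \<omega>). inj_on fst (space (cond_measure star \<omega>) - N)"
    using AE_cond_star unfolding St.cond_law
  proof eventually_elim
    case (elim \<omega>)
    obtain N where N: "{z \<in> space (J (cond (law X) \<omega>)). snd z \<noteq> cond (law X) \<omega>} \<subseteq> N"
      "emeasure (J (cond (law X) \<omega>)) N = 0" "N \<in> sets (J (cond (law X) \<omega>))"
      using AE_J_snd[OF cond_prob_measures[OF law_prob, of \<omega>]] by (rule AE_E)
    have "inj_on fst (space (J (cond (law X) \<omega>)) - N)"
    proof (rule inj_onI)
      fix z z' assume z: "z \<in> space (J (cond (law X) \<omega>)) - N" "z' \<in> space (J (cond (law X) \<omega>)) - N" "fst z = fst z'"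
      then have "snd z = cond (law X) \<omega>" "snd z' = cond (law X) \<omega>" using N(1) by blast+
      then show "z = z'" using z(3) by (simp add: prod_eq_iff)
    qed
    then show ?case unfolding elim using N(2,3) by (intro bexI[of _ N] null_setsI)
  qed
qed

text \<open>The disintegration is \<open>\<nu> \<mapsto> J \<nu>\<close>, which commutes with the action.\<close>
theorem measure_preserving_hom_snd:
  assumes erg: "ergodic m X" shows "measure_preserving_hom m star \<P> snd"
  unfolding measure_preserving_hom_def disintegration_def
proof (rule conjI[OF system_hom_snd[OF erg]], rule exI[of _ J], intro conjI allI)
  show mJ: "J \<in> borel_sys \<P> \<rightarrow>\<^sub>M prob_algebra (borel_sys star)"
    unfolding Pi_simps(1) by (rule measurable_J)
  have sp: "prob_space (law \<P>)" "sets (law \<P>) = sets (borel_of \<W>)"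
    using law_Pi_prob unfolding prob_measures_iff by blast+
  have mJ': "J \<in> law \<P> \<rightarrow>\<^sub>M prob_algebra (borel_sys star)"
    unfolding measurable_cong_sets[OF sp(2) refl] by (rule measurable_J)
  show "bind (law \<P>) J = law star"
  proof (rule St.prob_measures_eqI[OF St.bind_prob_measures[OF sp(1) mJ'] law_star_prob])
    fix f assume f: "continuous_map (points star) euclideanreal f"
    show "(\<integral>z. f z \<partial>bind (law \<P>) J) = (\<integral>z. f z \<partial>law star)"
      unfolding St.integral_bind_continuous[OF sp(1) mJ' f] integral_law_star[OF f]
      by (rule integral_law_Pi[OF measurable_compose[OF measurable_J St.measurable_integral_prob_algebra[OF f]]])
  qed
  have spc: "space (law \<P>) = prob_measures T" using sets_eq_imp_space_eq[OF sp(2)] by simp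
  show "AE \<nu> in law \<P>. AE z in J \<nu>. snd z = \<nu>"
    by (rule AE_I2) (simp only: spc AE_J_snd)
  show "AE \<nu> in law \<P>. translate star g (J \<nu>) = J (act \<P> g \<nu>)" for g
    unfolding Pi_simps(2) by (rule AE_I2) (simp only: spc translate_J)
qed

theorem standard_star:
  assumes erg: "ergodic m X" shows "standard TYPE('a measure) m star"
  unfolding standard_def St.m_system_iff
  using ergodic_star[OF erg] m_proximal_Pi measure_preserving_hom_snd[OF erg] by blast

text \<open>If the distribution of the conditional measures is a point mass, this point is the
  barycentre, that is, the law itself.\<close>
lemma law_Pi_dirac:
  assumes \<nu>: "\<nu> \<in> prob_measures T" and d: "law \<P> = return (borel_of \<W>) \<nu>"
  shows "law X = \<nu>"
proof (rule prob_measures_eqI[OF law_prob \<nu>])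
  fix f assume f: "continuous_map T euclideanreal f"
  have "(\<integral>x. f x \<partial>law X) = (\<integral>\<omega>. (\<integral>x. f x \<partial>cond (law X) \<omega>) \<partial>W.S)"
    using integral_bind_continuous[OF W.P.prob_space_axioms measurable_cond[OF law_prob] f]
    unfolding bind_cond[OF st] .
  also have "\<dots> = (\<integral>\<nu>'. (\<integral>x. f x \<partial>\<nu>') \<partial>law \<P>)"
    by (rule integral_law_Pi[OF borel_measurable_continuous_map[OF continuous_map_integral[OF f]], symmetric])
  also have "\<dots> = (\<integral>x. f x \<partial>\<nu>)"
    unfolding d by (rule WS.integral_return_continuous[OF _ continuous_map_integral[OF f]]) (simp add: \<nu>)
  finally show "(\<integral>x. f x \<partial>law X) = (\<integral>x. f x \<partial>\<nu>)" .
qed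

text \<open>For an invariant law the sequence of translates is constant.\<close>
lemma measure_preserving_law_Pi:
  assumes mp: "measure_preserving_system X"
  shows "law \<P> = return (borel_of \<W>) (law X)"
proof (rule WS.prob_measures_eqI[OF law_Pi_prob WS.return_prob_measures])
  show l: "law X \<in> topspace \<W>" using law_prob by simp
  have "conv_at (law X) \<omega> (law X)" for \<omega>
    using mp l unfolding conv_at_def measure_preserving_system_def by simp
  then have c: "cond (law X) \<omega> = law X" for \<omega> by (rule cond_eqI)
  fix \<Phi> assume \<Phi>: "continuous_map \<W> euclideanreal \<Phi>"
  show "(\<integral>\<nu>. \<Phi> \<nu> \<partial>law \<P>) = (\<integral>\<nu>. \<Phi> \<nu> \<partial>return (borel_of \<W>) (law X))"
    unfolding integral_law_Pi[OF borel_measurable_continuous_map[OF \<Phi>]] c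
      WS.integral_return_continuous[OF l \<Phi>] by (simp add: W.P.prob_space)
qed

abbreviation one :: "('g, unit) gsystem" where "one \<equiv> one_point_system"

lemma point_system: "gspace m one"
proof
  have "compact_space (discrete_topology (UNIV :: unit set))" by (simp add: compact_space_discrete_topology)
  then show "compact_metric_gspace one"
    unfolding compact_metric_gspace_def one_point_system_def by (simp add: case_prod_beta')
qed (rule sets_m)

interpretation One: gspace m one by (rule point_system)

lemma unit_prob_measures:
  assumes "\<mu> \<in> prob_measures (points one)"
    and "\<nu> \<in> prob_measures (points one)"
  shows "\<mu> = \<nu>"
proof (rule One.prob_measures_eqI[OF assms])
  fix f :: "unit \<Rightarrow> real"
  have "(\<integral>x. f x \<partial>\<eta>) = f ()" if "prob_space \<eta>" for \<eta>
  proof -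
    have "(\<integral>x. f x \<partial>\<eta>) = (\<integral>x. f () \<partial>\<eta>)" by (rule Bochner_Integration.integral_cong[OF refl]) simp
    also have "\<dots> = f ()" by (rule integral_prob_const[OF that])
    finally show ?thesis .
  qed
  then show "(\<integral>x. f x \<partial>\<mu>) = (\<integral>x. f x \<partial>\<nu>)" using assms by (simp only: prob_measures_iff)
qed

lemma law_point: "law one \<in> prob_measures (points one)"
  by (simp add: one_point_system_def prob_measures_iff prob_space_return)

lemma ergodic_point: "ergodic m one"
  unfolding One.ergodic_iff_stationary
proof (rule conjI)
  show "One.is_stationary (law one)"
    unfolding One.stationary_iff[symmetric] stationary_def
    by (intro conjI law_point unit_prob_measures One.bind_prob_measures prob_m One.measurable_orbit_m)
  have "\<mu>1 = \<mu>2" if "One.is_stationary \<mu>1" "One.is_stationary \<mu>2" for \<mu>1 \<mu>2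
    using that by (intro unit_prob_measures One.is_stationary_prob)
  then show "\<forall>\<mu>1 \<mu>2 t. One.is_stationary \<mu>1 \<and> One.is_stationary \<mu>2 \<and> 0 < t \<and> t < (1::real) \<and>
     (\<forall>A\<in>sets (borel_sys one). measure (law one) A = t * measure \<mu>1 A + (1 - t) * measure \<mu>2 A) \<longrightarrow> \<mu>1 = \<mu>2"
    by blast
qed

theorem measure_preserving_iff_trivial:
  "measure_preserving_system X \<longleftrightarrow> trivial_system m \<P>"
proof
  assume mp: "measure_preserving_system X"
  note d = measure_preserving_law_Pi[OF mp]
  have l: "law X \<in> topspace (points \<P>)" using law_prob by simp
  have 1: "system_hom m \<P> one (\<lambda>_. ())"
    unfolding system_hom_def Pi.m_system_iff One.m_system_iff
  proof (intro conjI allI ergodic_Pi ergodic_point)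
    show c: "(\<lambda>_. ()) \<in> borel_sys \<P> \<rightarrow>\<^sub>M borel_sys one"
      by (rule measurable_const) (simp add: one_point_system_def)
    show "distr (law \<P>) (borel_sys one) (\<lambda>_. ()) = law one"
      by (rule unit_prob_measures[OF distr_prob_measures[OF Pi.is_stationary_prob[OF stationary_Pi] c] law_point])
  qed simp
  have 2: "system_hom m one \<P> (\<lambda>_. law X)"
    unfolding system_hom_def Pi.m_system_iff One.m_system_iff
  proof (intro conjI allI ergodic_Pi ergodic_point)
    show c: "(\<lambda>_. law X) \<in> borel_sys one \<rightarrow>\<^sub>M borel_sys \<P>"
      by (rule measurable_const) (use l in simp)
    show "AE x in law one. law X = act \<P> g (law X)" for g
      using mp unfolding measure_preserving_system_def Pi_simps(2) by simp
    have pl: "prob_space (law one)"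
      using law_point unfolding prob_measures_iff by blast
    have c': "(\<lambda>_. law X) \<in> (law one) \<rightarrow>\<^sub>M borel_of \<W>"
      by (rule measurable_const) (use l in simp)
    show "distr (law one) (borel_sys \<P>) (\<lambda>_. law X) = law \<P>"
      unfolding d Pi_simps(1)
    proof (rule WS.prob_measures_eqI)
      show "distr (law one) (borel_of \<W>) (\<lambda>_. law X) \<in> prob_measures \<W>"
        unfolding prob_measures_iff using prob_space.prob_space_distr[OF pl c'] by simp
      show "return (borel_of \<W>) (law X) \<in> prob_measures \<W>"
        by (rule WS.return_prob_measures) (use l in simp)
      fix f assume f: "continuous_map \<W> euclideanreal f"
      have lx: "law X \<in> topspace \<W>" using l by simp
      show "(\<integral>x. f x \<partial>distr (law one) (borel_of \<W>) (\<lambda>_. law X)) = (\<integral>x. f x \<partial>return (borel_of \<W>) (law X))"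
        unfolding integral_distr[OF c' borel_measurable_continuous_map[OF f]]
          WS.integral_return_continuous[OF lx f] by (rule integral_prob_const[OF pl])
    qed
  qed
  have 3: "AE \<nu> in law \<P>. law X = \<nu>"
    unfolding d using WS.AE_return_eq[of "law X"] l by (auto elim: AE_mp)
  show "trivial_system m \<P>"
    unfolding trivial_system_def system_iso_def
    by (rule exI[of _ "\<lambda>_. ()"], rule conjI[OF 1], rule exI[of _ "\<lambda>_. law X"], intro conjI 2 3) simp
next
  assume "trivial_system m \<P>"
  then obtain \<rho> where \<rho>: "system_hom m one \<P> \<rho>"
    unfolding trivial_system_def system_iso_def by blast
  let ?\<nu> = "\<rho> ()"
  have pl: "prob_space (law one)"
    using law_point unfolding prob_measures_iff by blast
  have s1: "sets (law one) = sets (borel_sys one)"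
    using law_point unfolding prob_measures_iff by blast
  have m\<rho>: "\<rho> \<in> law one \<rightarrow>\<^sub>M borel_of \<W>"
    using \<rho> unfolding system_hom_def Pi_simps(1) measurable_cong_sets[OF s1 refl] by blast
  have "() \<in> space (law one)"
    using prob_space.not_empty[OF pl] by auto
  from measurable_space[OF m\<rho> this] have \<nu>: "?\<nu> \<in> topspace \<W>" by simp
  have ds: "distr (law one) (borel_of \<W>) \<rho> = law \<P>"
    using \<rho> unfolding system_hom_def Pi_simps(1) by blast
  have "law \<P> = return (borel_of \<W>) ?\<nu>"
  proof (rule WS.prob_measures_eqI[OF law_Pi_prob WS.return_prob_measures[OF \<nu>]])
    fix f assume f: "continuous_map \<W> euclideanreal f"
    have "(\<integral>x. f x \<partial>law \<P>) = (\<integral>x. f (\<rho> x) \<partial>law one)"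
      unfolding ds[symmetric] by (rule integral_distr[OF m\<rho> borel_measurable_continuous_map[OF f]])
    also have "\<dots> = (\<integral>x. f ?\<nu> \<partial>(law one))"
      by (rule Bochner_Integration.integral_cong[OF refl]) simp
    also have "\<dots> = f ?\<nu>" by (rule integral_prob_const[OF pl])
    finally show "(\<integral>x. f x \<partial>law \<P>) = (\<integral>x. f x \<partial>return (borel_of \<W>) ?\<nu>)"
      unfolding WS.integral_return_continuous[OF \<nu> f] .
  qed
  from law_Pi_dirac[OF _ this] have l: "law X = ?\<nu>" using \<nu> by simp
  have "translate X g ?\<nu> = ?\<nu>" for g
  proof -
    have "AE x in law one. \<rho> (act one g x) = translate X g (\<rho> x)"
      using \<rho> unfolding system_hom_def Pi_simps(2) by blast
    then have "AE x in (law one). ?\<nu> = translate X g ?\<nu>"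
    proof eventually_elim
      case (elim x)
      then show ?case by simp
    qed
    then show ?thesis unfolding prob_space.AE_const[OF pl] by (rule sym)
  qed
  then show "measure_preserving_system X" unfolding measure_preserving_system_def l by blast
qed


lemma integral_dirac_law:
  assumes f: "continuous_map (points star) euclideanreal f" and x: "x \<in> topspace T"
  shows "(\<integral>z. f z \<partial>J (return (borel_of T) x)) = f (x, return (borel_of T) x)"
  unfolding integral_J[OF return_prob_measures[OF x] f]
  by (rule integral_return_continuous[OF x continuous_section(2)[OF f return_prob_measures[OF x]]])

lemma translate_return:
  assumes x: "x \<in> topspace T"
  shows "translate X g (return (borel_of T) x) = return (borel_of T) (act X g x)"
proof (rule prob_measures_eqI)
  fix f assume f: "continuous_map T euclideanreal f"
  show "(\<integral>x. f x \<partial>translate X g (return (borel_of T) x)) = (\<integral>x. f x \<partial>return (borel_of T) (act X g x))"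
    unfolding integral_translate[OF return_prob_measures[OF x] f]
      integral_return_continuous[OF act_topspace[OF x] f]
    by (rule integral_return_continuous[OF x continuous_act_compose[OF f]])
qed (intro translate_prob_measures return_prob_measures act_topspace x)+

text \<open>For a proximal system the join is carried by the graph of \<open>x \<mapsto> \<delta>\<^sub>x\<close>.\<close>
context
  assumes erg: "ergodic m X" and prox: "AE \<omega> in W.S. \<exists>x\<in>topspace T. cond (law X) \<omega> = return (borel_of T) x"
begin

abbreviation graph :: "'a \<Rightarrow> 'a \<times> 'a measure" where
  "graph x \<equiv> (x, return (borel_of T) x)"

lemma continuous_graph: "continuous_map T (points star) graph"
  unfolding star_simps(1) by (intro continuous_map_pairedI continuous_return continuous_map_id[unfolded id_def])

lemma measurable_graph: "graph \<in> borel_of T \<rightarrow>\<^sub>M borel_sys star"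
  by (rule measurable_continuous_map[OF continuous_graph])

lemma distr_graph: "distr (law X) (borel_sys star) graph = law star"
proof (rule St.prob_measures_eqI[OF distr_prob_measures[OF law_prob measurable_graph] law_star_prob])
  fix f assume f: "continuous_map (points star) euclideanreal f"
  have fc: "continuous_map T euclideanreal (\<lambda>x. f (graph x))"
    using continuous_map_compose[OF continuous_graph f] by (simp add: o_def)
  have "(\<integral>z. f z \<partial>distr (law X) (borel_sys star) graph) = (\<integral>x. f (graph x) \<partial>law X)"
    by (rule integral_distr_continuous[OF law_prob continuous_graph f])
  also have "\<dots> = (\<integral>\<omega>. (\<integral>x. f (graph x) \<partial>cond (law X) \<omega>) \<partial>W.S)"
    using integral_bind_continuous[OF W.P.prob_space_axioms measurable_cond[OF law_prob] fc]
    unfolding bind_cond[OF st] .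
  also have "\<dots> = (\<integral>\<omega>. (\<integral>z. f z \<partial>J (cond (law X) \<omega>)) \<partial>W.S)"
  proof (rule integral_cong_AE)
    show "(\<lambda>\<omega>. \<integral>x. f (graph x) \<partial>cond (law X) \<omega>) \<in> borel_measurable W.S"
      by (rule measurable_compose[OF measurable_cond[OF law_prob] measurable_integral_prob_algebra[OF fc]])
    show "(\<lambda>\<omega>. \<integral>z. f z \<partial>J (cond (law X) \<omega>)) \<in> borel_measurable W.S"
      by (rule measurable_compose[OF measurable_J_cond St.measurable_integral_prob_algebra[OF f]])
    show "AE \<omega> in W.S. (\<integral>x. f (graph x) \<partial>cond (law X) \<omega>) = (\<integral>z. f z \<partial>J (cond (law X) \<omega>))"
      using prox
    proof eventually_elim
      case (elim \<omega>)
      then obtain x where x: "x \<in> topspace T" "cond (law X) \<omega> = return (borel_of T) x" by blast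
      show ?case
        unfolding x(2) integral_dirac_law[OF f x(1)] by (rule integral_return_continuous[OF x(1) fc])
    qed
  qed
  also have "\<dots> = (\<integral>z. f z \<partial>law star)" unfolding integral_law_star[OF f] ..
  finally show "(\<integral>z. f z \<partial>distr (law X) (borel_sys star) graph) = (\<integral>z. f z \<partial>law star)" .
qed

lemma AE_graph: "AE z in law star. graph (fst z) = z"
proof -
  have "closedin (points star) {z \<in> topspace (points star). return (borel_of T) (fst z) = snd z}"
  proof (rule closedin_continuous_maps_eq[OF metrizable_imp_Hausdorff_space[OF WS.metrizable]])
    show "continuous_map (points star) \<W> (\<lambda>z. return (borel_of T) (fst z))"
      using continuous_map_compose[OF F.continuous continuous_return] by (simp add: o_def)
    show "continuous_map (points star) \<W> snd" using Sn.continuous unfolding Pi_simps(1) .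
  qed
  moreover have "graph (fst z) = z \<longleftrightarrow> return (borel_of T) (fst z) = snd z" for z by (cases z) simp
  ultimately have "{z \<in> space (borel_sys star). graph (fst z) = z} \<in> sets (borel_sys star)"
    using closedin_sets_borel_of by simp
  moreover have "graph \<in> law X \<rightarrow>\<^sub>M borel_sys star"
  proof -
    have "sets (law X) = sets (borel_of T)" using law_prob unfolding prob_measures_iff by blast
    from measurable_graph[folded measurable_cong_sets[OF this refl]] show ?thesis .
  qed
  ultimately have "(AE z in distr (law X) (borel_sys star) graph. graph (fst z) = z) \<longleftrightarrow>
      (AE x in law X. graph (fst (graph x)) = graph x)"
    by (intro AE_distr_iff)
  then show ?thesis unfolding distr_graph by simp
qed

lemma act_graph: "x \<in> topspace T \<Longrightarrow> graph (act X g x) = act star g (graph x)"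
  by (simp add: act_star translate_return)

lemma system_iso_fst: "system_iso m star X fst"
  unfolding system_iso_def
proof (intro conjI exI[of _ graph] system_hom_fst[OF erg] AE_graph)
  show "system_hom m X star graph"
    unfolding system_hom_def m_system_iff St.m_system_iff
  proof (intro conjI allI erg ergodic_star[OF erg] measurable_graph distr_graph)
    show "AE x in law X. graph (act X g x) = act star g (graph x)" for g
      by (rule AE_I2) (simp only: prob_measures_space[OF law_prob] act_graph)
  qed
qed simp

text \<open>The inverse of \<open>x \<mapsto> \<delta>\<^sub>x\<close> is measurable: it maps a point mass into an open set iff the
  open set has full measure. Elsewhere it takes a fixed value.\<close>
definition unreturn :: "'a measure \<Rightarrow> 'a" where
  "unreturn \<nu> = (if \<nu> \<in> return (borel_of T) ` topspace T then SOME x. x \<in> topspace T \<and> \<nu> = return (borel_of T) x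
     else SOME x. x \<in> topspace T)"

lemma return_inj:
  assumes "x \<in> topspace T" "y \<in> topspace T" "return (borel_of T) x = return (borel_of T) y"
  shows "x = y"
proof -
  have "AE z in return (borel_of T) x. z = x" "AE z in return (borel_of T) x. z = y"
    using AE_return_eq[OF assms(1)] AE_return_eq[OF assms(2)] unfolding assms(3) by blast+
  then have "AE z in return (borel_of T) x. x = y" by eventually_elim simp
  then show ?thesis using prob_space.AE_const[OF prob_space_return[of x "borel_of T"]] assms(1) by simp
qed

lemma unreturn_return: "x \<in> topspace T \<Longrightarrow> unreturn (return (borel_of T) x) = x"
proof -
  assume x: "x \<in> topspace T"
  have "(SOME y. y \<in> topspace T \<and> return (borel_of T) x = return (borel_of T) y) = x"
  proof (rule some_equality)
    fix y assume "y \<in> topspace T \<and> return (borel_of T) x = return (borel_of T) y"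
    then show "y = x" using return_inj[OF x, of y] by simp
  qed (use x in simp)
  then show ?thesis using x by (simp add: unreturn_def)
qed

lemma unreturn_topspace: "unreturn \<nu> \<in> topspace T"
proof (cases "\<nu> \<in> return (borel_of T) ` topspace T")
  case True then show ?thesis using unreturn_return by auto
next
  case False
  have "prob_space (law X)" using law_prob unfolding prob_measures_iff by blast
  from prob_space.not_empty[OF this] have "\<exists>x. x \<in> topspace T"
    unfolding prob_measures_space[OF law_prob] by blast
  from someI_ex[OF this] show ?thesis using False by (simp add: unreturn_def)
qed

lemma sets_dirac: "return (borel_of T) ` topspace T \<in> sets (borel_of \<W>)"
proof -
  have "compactin \<W> (return (borel_of T) ` topspace T)"
    using compact unfolding compact_space_def by (rule image_compactin[OF _ continuous_return])
  from compactin_imp_closedin[OF metrizable_imp_Hausdorff_space[OF WS.metrizable] this]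
  show ?thesis by (rule closedin_sets_borel_of)
qed

lemma measurable_unreturn: "unreturn \<in> borel_of \<W> \<rightarrow>\<^sub>M borel_of T"
proof (rule measurable_into_borel_of[OF unreturn_topspace])
  fix U assume U: "openin T U"
  let ?D = "return (borel_of T) ` topspace T" and ?x0 = "SOME x. x \<in> topspace T"
  have D: "?D \<subseteq> space (borel_of \<W>)" using return_prob_measures by auto
  have "(\<lambda>\<nu>. measure \<nu> U) \<in> borel_measurable (borel_of \<W>)"
    using measurable_measure_prob_algebra[OF openin_sets_borel_of[OF U]]
    unfolding measurable_cong_sets[OF sets_borel_of_weak_star refl] .
  then have m1: "(\<lambda>\<nu>. measure \<nu> U) -` {1} \<inter> space (borel_of \<W>) \<in> sets (borel_of \<W>)"
    by (rule measurable_sets) simp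
  define E where "E = (if ?x0 \<in> U then space (borel_of \<W>) - ?D else {})"
  have Em: "E \<in> sets (borel_of \<W>)"
    unfolding E_def using sets.Diff[OF sets.top sets_dirac]
    by (cases "?x0 \<in> U") (simp_all only: if_True if_False sets.empty_sets)
  have "?D \<inter> ((\<lambda>\<nu>. measure \<nu> U) -` {1} \<inter> space (borel_of \<W>)) \<union> E \<in> sets (borel_of \<W>)"
    by (rule sets.Un[OF sets.Int[OF sets_dirac m1] Em])
  moreover have "{\<nu> \<in> space (borel_of \<W>). unreturn \<nu> \<in> U} = ?D \<inter> ((\<lambda>\<nu>. measure \<nu> U) -` {1} \<inter> space (borel_of \<W>)) \<union> E"
    (is "?L = ?R")
  proof (rule set_eqI)
    fix \<nu> show "\<nu> \<in> ?L \<longleftrightarrow> \<nu> \<in> ?R"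
    proof (cases "\<nu> \<in> ?D")
      case True
      then obtain x where x: "x \<in> topspace T" "\<nu> = return (borel_of T) x" by blast
      have me: "measure \<nu> U = indicator U x"
        unfolding x(2) by (rule measure_return[OF openin_sets_borel_of[OF U]])
      have u: "unreturn \<nu> = x" unfolding x(2) by (rule unreturn_return[OF x(1)])
      have "\<nu> \<in> space (borel_of \<W>)" "\<nu> \<notin> E" using True D by (auto simp only: E_def split: if_splits)
      then show ?thesis using True by (simp add: me u indicator_def)
    next
      case False
      then have "unreturn \<nu> = ?x0" unfolding unreturn_def by (rule if_not_P)
      then show ?thesis using False by (auto simp: E_def)
    qed
  qed
  ultimately show "{\<nu> \<in> space (borel_of \<W>). unreturn \<nu> \<in> U} \<in> sets (borel_of \<W>)" by simp
qed

lemma AE_law_Pi_dirac: "AE \<nu> in law \<P>. \<nu> \<in> return (borel_of T) ` topspace T"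
proof -
  have "{\<nu> \<in> space (borel_of \<W>). \<nu> \<in> return (borel_of T) ` topspace T} = return (borel_of T) ` topspace T"
    using sets.sets_into_space[OF sets_dirac] by blast
  then have "{\<nu> \<in> space (borel_of \<W>). \<nu> \<in> return (borel_of T) ` topspace T} \<in> sets (borel_of \<W>)"
    using sets_dirac by simp
  from AE_distr_iff[OF measurable_cond_weak_star[OF law_prob] this]
  show ?thesis unfolding law_Pi using prox by (simp only: image_iff Bex_def)
qed

lemma system_iso_snd: "system_iso m star \<P> snd"
proof -
  define \<rho> where "\<rho> \<nu> = (unreturn \<nu>, \<nu>)" for \<nu>
  have \<rho>m: "\<rho> \<in> borel_of \<W> \<rightarrow>\<^sub>M borel_sys star"
    unfolding measurable_cong_sets[OF refl sets_star] \<rho>_def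
    by (rule measurable_Pair[OF measurable_unreturn measurable_ident_sets[OF refl]])
  have s: "sets (law \<P>) = sets (borel_of \<W>)" using law_Pi_prob unfolding prob_measures_iff by blast
  have \<rho>g: "\<rho> (return (borel_of T) x) = graph x" if "x \<in> topspace T" for x
    unfolding \<rho>_def unreturn_return[OF that] ..
  have d: "distr (law \<P>) (borel_sys star) \<rho> = law star"
  proof (rule St.prob_measures_eqI)
    have \<rho>m': "\<rho> \<in> law \<P> \<rightarrow>\<^sub>M borel_sys star" using \<rho>m unfolding measurable_cong_sets[OF s refl] .
    have "prob_space (law \<P>)" using law_Pi_prob unfolding prob_measures_iff by blast
    from prob_space.prob_space_distr[OF this \<rho>m']
    show "distr (law \<P>) (borel_sys star) \<rho> \<in> prob_measures (points star)"
      unfolding prob_measures_iff by simp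
    show "law star \<in> prob_measures (points star)" by (rule law_star_prob)
    fix f assume f: "continuous_map (points star) euclideanreal f"
    have fm: "f \<in> borel_measurable (borel_sys star)" by (rule borel_measurable_continuous_map[OF f])
    have "(\<integral>z. f z \<partial>distr (law \<P>) (borel_sys star) \<rho>) = (\<integral>\<nu>. f (\<rho> \<nu>) \<partial>law \<P>)"
      by (rule integral_distr[OF \<rho>m' fm])
    also have "\<dots> = (\<integral>\<omega>. f (\<rho> (cond (law X) \<omega>)) \<partial>W.S)"
      by (rule integral_law_Pi[OF measurable_compose[OF \<rho>m fm]])
    also have "\<dots> = (\<integral>\<omega>. (\<integral>z. f z \<partial>J (cond (law X) \<omega>)) \<partial>W.S)"
    proof (rule integral_cong_AE)
      show "(\<lambda>\<omega>. f (\<rho> (cond (law X) \<omega>))) \<in> borel_measurable W.S"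
        by (rule measurable_compose[OF measurable_cond_weak_star[OF law_prob] measurable_compose[OF \<rho>m fm]])
      show "(\<lambda>\<omega>. \<integral>z. f z \<partial>J (cond (law X) \<omega>)) \<in> borel_measurable W.S"
        by (rule measurable_compose[OF measurable_J_cond St.measurable_integral_prob_algebra[OF f]])
      show "AE \<omega> in W.S. f (\<rho> (cond (law X) \<omega>)) = (\<integral>z. f z \<partial>J (cond (law X) \<omega>))"
        using prox
      proof eventually_elim
        case (elim \<omega>)
        then obtain x where x: "x \<in> topspace T" "cond (law X) \<omega> = return (borel_of T) x" by blast
        show ?case unfolding x(2) integral_dirac_law[OF f x(1)] \<rho>g[OF x(1)] ..
      qed
    qed
    also have "\<dots> = (\<integral>z. f z \<partial>law star)" unfolding integral_law_star[OF f] ..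
    finally show "(\<integral>z. f z \<partial>distr (law \<P>) (borel_sys star) \<rho>) = (\<integral>z. f z \<partial>law star)" .
  qed
  show ?thesis
    unfolding system_iso_def
  proof (intro conjI exI[of _ \<rho>] system_hom_snd[OF erg])
    show "system_hom m \<P> star \<rho>"
      unfolding system_hom_def Pi.m_system_iff St.m_system_iff
    proof (intro conjI allI ergodic_Pi ergodic_star[OF erg] d)
      show "\<rho> \<in> borel_sys \<P> \<rightarrow>\<^sub>M borel_sys star" using \<rho>m unfolding Pi_simps(1) .
      show "AE \<nu> in law \<P>. \<rho> (act \<P> g \<nu>) = act star g (\<rho> \<nu>)" for g
        using AE_law_Pi_dirac
      proof eventually_elim
        case (elim \<nu>)
        then obtain x where x: "x \<in> topspace T" "\<nu> = return (borel_of T) x" by blast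
        show ?case
          unfolding Pi_simps(2) x(2) translate_return[OF x(1)] \<rho>g[OF x(1)] \<rho>g[OF act_topspace[OF x(1)]]
          by (rule act_graph[OF x(1)])
      qed
    qed
    have sp: "space (law star) = topspace (points star)" by (rule prob_measures_space[OF law_star_prob])
    from AE_graph AE_space[of "law star"] show "AE z in law star. \<rho> (snd z) = z"
    proof eventually_elim
      case (elim z)
      have x: "fst z \<in> topspace T" using elim(2) unfolding sp topspace_star by (rule conjunct1)
      have "snd z = return (borel_of T) (fst z)" using arg_cong[OF elim(1), of snd] unfolding snd_conv by (rule sym)
      then have "\<rho> (snd z) = graph (fst z)" using \<rho>g[OF x] by (rule ssubst)
      then show ?case unfolding elim(1) .
    qed
    show "AE \<nu> in law \<P>. snd (\<rho> \<nu>) = \<nu>" by (simp add: \<rho>_def)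
  qed
qed

end

text \<open>For the converse, an inverse of the second projection selects a point from the fibre \<open>J \<nu>\<close> for almost
  every \<open>\<nu>\<close>; so the first marginal \<open>\<nu>\<close> of this fibre is a point mass.\<close>
theorem proximal_iff_iso:
  assumes erg: "ergodic m X"
  shows "m_proximal m X \<longleftrightarrow> system_iso m star X fst \<and> system_iso m star \<P> snd"
proof
  assume "m_proximal m X"
  then have "AE \<omega> in W.S. \<exists>x\<in>topspace T. cond (law X) \<omega> = return (borel_of T) x"
    unfolding m_proximal_def path_measure cond_law by blast
  from system_iso_fst[OF erg this] system_iso_snd[OF erg this]
  show "system_iso m star X fst \<and> system_iso m star \<P> snd" by (rule conjI)
next
  assume "system_iso m star X fst \<and> system_iso m star \<P> snd"
  then obtain \<rho> where \<rho>: "system_hom m \<P> star \<rho>" "AE z in law star. \<rho> (snd z) = z"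
    unfolding system_iso_def by blast
  obtain N where N: "{z \<in> space (law star). \<rho> (snd z) \<noteq> z} \<subseteq> N" "emeasure (law star) N = 0" "N \<in> sets (law star)"
    using \<rho>(2) by (rule AE_E)
  have ss: "sets (law star) = sets (borel_sys star)" using law_star_prob unfolding prob_measures_iff by blast
  have Nm: "Measurable.pred (borel_sys star) (\<lambda>z. z \<notin> N)"
  proof -
    have e: "{z \<in> space (borel_sys star). z \<notin> N} = space (borel_sys star) - N" by blast
    show ?thesis unfolding pred_def e by (rule sets.compl_sets[OF N(3)[unfolded ss]])
  qed
  have "AE z in law star. z \<notin> N" using N(2,3) by (intro AE_not_in null_setsI)
  then have "AE \<omega> in W.S. AE z in J (cond (law X) \<omega>). z \<notin> N"
    unfolding law_star AE_bind[OF measurable_prob_algebraD[OF measurable_J_cond] Nm] .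
  then have "AE \<omega> in W.S. \<exists>x\<in>topspace T. cond (law X) \<omega> = return (borel_of T) x"
  proof eventually_elim
    case (elim \<omega>)
    let ?\<nu> = "cond (law X) \<omega>"
    note \<nu> = cond_prob_measures[OF law_prob, of \<omega>]
    let ?x = "fst (\<rho> ?\<nu>)"
    have "\<rho> \<in> borel_of \<W> \<rightarrow>\<^sub>M borel_sys star"
      using \<rho>(1) unfolding system_hom_def Pi_simps(1) by blast
    then have "\<rho> ?\<nu> \<in> space (borel_sys star)"
      by (rule measurable_space) (simp add: \<nu>)
    then have x: "?x \<in> topspace T" unfolding space_borel_of topspace_star by (rule conjunct1)
    have sp: "space (J ?\<nu>) = space (law star)"
      unfolding prob_measures_space[OF J_prob[OF \<nu>]] prob_measures_space[OF law_star_prob] ..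
    have ae: "AE z in J ?\<nu>. fst z = ?x"
      using elim AE_J_snd[OF \<nu>] AE_space
    proof eventually_elim
      case (elim z)
      then have "\<rho> (snd z) = z" using N(1) unfolding sp by blast
      then show ?case using elim(2) by simp
    qed
    have "?\<nu> = return (borel_of T) ?x"
    proof (rule prob_measures_eqI[OF \<nu> return_prob_measures[OF x]])
      fix f assume f: "continuous_map T euclideanreal f"
      have sJ: "sets (J ?\<nu>) = sets (borel_sys star)" "prob_space (J ?\<nu>)"
        using J_prob[OF \<nu>] unfolding prob_measures_iff by blast+
      have "(\<integral>y. f y \<partial>?\<nu>) = (\<integral>z. f (fst z) \<partial>J ?\<nu>)"
        using F.integral_push[OF J_prob[OF \<nu>] f] unfolding push_fst_J[OF \<nu>] .
      also have "\<dots> = (\<integral>z. f ?x \<partial>J ?\<nu>)"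
      proof (rule integral_cong_AE)
        show "(\<lambda>z. f (fst z)) \<in> borel_measurable (J ?\<nu>)"
          unfolding measurable_cong_sets[OF sJ(1) refl]
          by (rule borel_measurable_continuous_map[OF F.continuous_compose[OF f]])
        show "AE z in J ?\<nu>. f (fst z) = f ?x" using ae by eventually_elim simp
      qed simp
      also have "\<dots> = f ?x" by (simp add: prob_space.prob_space[OF sJ(2)])
      finally show "(\<integral>y. f y \<partial>?\<nu>) = (\<integral>y. f y \<partial>return (borel_of T) ?x)"
        unfolding integral_return_continuous[OF x f] .
    qed
    then show ?case using x by blast
  qed
  then show "m_proximal m X"
    unfolding m_proximal_def m_system_iff path_measure cond_law using erg by (rule conjI[rotated])
qed

end

theorem theorem4p3:
  fixes m :: "'g::{topological_group_add, t2_space, second_countable_topology} measure"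
    and X :: "('g, 'x) gsystem"
  assumes "locally_compact_space (euclidean :: 'g topology)"
    and "admissible m"
    and "m_system m X"
  shows "standard TYPE('x measure) m (star_system m X) \<and>
         m_proximal m (Pi_system m X) \<and>
         m_proximal_hom m (star_system m X) X fst \<and>
         measure_preserving_hom m (star_system m X) (Pi_system m X) snd \<and>
         (\<exists>(Z :: ('g, 'x \<times> 'x measure) gsystem) \<phi>.
            standard TYPE('x measure) m Z \<and> m_proximal_hom m Z X \<phi>) \<and>
         (measure_preserving_system X \<longleftrightarrow> trivial_system m (Pi_system m X)) \<and>
         (m_proximal m X \<longleftrightarrow>
            system_iso m (star_system m X) X fst \<and>
            system_iso m (star_system m X) (Pi_system m X) snd)"
proof -
  interpret gspace m X
  proof (rule gspace.intro)
    show "compact_metric_gspace X" using assms(3) unfolding m_system_def by (rule conjunct1)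
    have "prob_space m \<and> sets m = sets borel"
      using assms(2) unfolding admissible_def by (elim conjE, intro conjI)
    then show "prob_space m" "sets m = sets borel" by simp_all
  qed
  have erg: "ergodic m X" using assms(3) unfolding m_system_iff .
  interpret stationary_gspace m X
  proof
    show "is_stationary (law X)" using erg unfolding ergodic_iff_stationary by (rule conjunct1)
  qed
  have ex: "\<exists>(Z :: ('g, 'x \<times> 'x measure) gsystem) \<phi>. standard TYPE('x measure) m Z \<and> m_proximal_hom m Z X \<phi>"
    by (rule exI[of _ star], rule exI[of _ fst], rule conjI[OF standard_star[OF erg] m_proximal_hom_fst[OF erg]])
  show ?thesis
    by (rule conjI[OF standard_star[OF erg] conjI[OF m_proximal_Pi conjI[OF m_proximal_hom_fst[OF erg]
            conjI[OF measure_preserving_hom_snd[OF erg] conjI[OF ex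
            conjI[OF measure_preserving_iff_trivial proximal_iff_iso[OF erg]]]]]]])
qed

end
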